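(* Let $\Gamma$ be an infinite group with property (T) and $(Q,\epsilon)$ a Kazhdan pair for $\Gamma$. If $\mathrm{card}(Q)=n$, then $$C(\Gamma)\le n\left(1-\frac{\epsilon^2}{2}\right)+\frac{n-1}{2n-1}.$$
   Context: A Kazhdan pair for a countable group $\Gamma$ is a pair $(Q,\epsilon)$ with $Q\subseteq\Gamma$ a finite generating set and $\epsilon>0$ such that for any unitary representation $\pi$ of $\Gamma$ on a Hilbert space $\mathcal H$, if some $\xi\in\mathcal H$ satisfies $\|\pi(\gamma)(\xi)-\xi\|<\epsilon\|\xi\|$ for all $\gamma\in Q$, then $\pi$ has a non-zero invariant vector; $\Gamma$ has property (T) iff it has a Kazhdan pair. $C(\Gamma)$ is the cost of $\Gamma$ (in the sense of Gaboriau): the infimum of $C_\mu(E^X_\Gamma)$ over all free measure preserving actions of $\Gamma$ on standard probability spaces $(X,\mu)$, where the cost $C_\mu(E)$ of a countable measure preserving equivalence relation $E$ is the infimum over all graphings $\mathcal G$ of $E$ (Borel graphs on $X$ whose connected components are the $E$-classes a.e.) of $\frac12\int_X \deg_{\mathcal G}(x)\,d\mu(x)$. *)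

theory Defs
  imports
    "HOL-Algebra.Generated_Groups"
    "HOL-Algebra.Group_Action"
    "HOL-Algebra.Algebraic_Closure_Type"
    "HOL-Probability.Probability"
begin

section \<open>Unitary representations and Kazhdan pairs\<close>

record 'h inner_module = "(complex, 'h) module" +
  sprod :: "'h \<Rightarrow> 'h \<Rightarrow> complex"

definition hnorm :: "('h, 'm) inner_module_scheme \<Rightarrow> 'h \<Rightarrow> real" where
  "hnorm H x = sqrt (Re (sprod H x x))"

text \<open>
  Carrier-based complex Hilbert spaces; the scalar product is linear in its first argument.
  The multiplication and the unit of the underlying \<open>ring\<close> record are not used.
\<close>

locale complex_hilbert_space =
  Module.module "ring_of_type_algebra :: complex ring" H
  for H :: "('h, 'm) inner_module_scheme" (structure) +
  assumes sprod_add: "\<lbrakk>x \<in> carrier H; y \<in> carrier H; z \<in> carrier H\<rbrakk>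
      \<Longrightarrow> sprod H (x \<oplus> y) z = sprod H x z + sprod H y z"
    and sprod_smult: "\<lbrakk>x \<in> carrier H; y \<in> carrier H\<rbrakk>
      \<Longrightarrow> sprod H (c \<odot> x) y = c * sprod H x y"
    and sprod_commute: "\<lbrakk>x \<in> carrier H; y \<in> carrier H\<rbrakk> \<Longrightarrow> sprod H y x = cnj (sprod H x y)"
    and sprod_nonneg: "x \<in> carrier H \<Longrightarrow> 0 \<le> Re (sprod H x x)"
    and sprod_definite: "\<lbrakk>x \<in> carrier H; sprod H x x = 0\<rbrakk> \<Longrightarrow> x = \<zero>"
    and complete: "\<lbrakk>range s \<subseteq> carrier H;
        \<forall>e>0. \<exists>N. \<forall>m\<ge>N. \<forall>n\<ge>N. hnorm H (s m \<ominus> s n) < e\<rbrakk>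
      \<Longrightarrow> \<exists>x\<in>carrier H. (\<lambda>n. hnorm H (s n \<ominus> x)) \<longlonglongrightarrow> 0"

definition unitary_rep ::
  "('g, 'n) monoid_scheme \<Rightarrow> ('h, 'm) inner_module_scheme \<Rightarrow> ('g \<Rightarrow> 'h \<Rightarrow> 'h) \<Rightarrow> bool" where
  "unitary_rep G H \<pi> \<longleftrightarrow>
     group_action G (carrier H) \<pi> \<and>
     (\<forall>g\<in>carrier G. \<forall>x\<in>carrier H. \<forall>y\<in>carrier H.
        \<pi> g (x \<oplus>\<^bsub>H\<^esub> y) = \<pi> g x \<oplus>\<^bsub>H\<^esub> \<pi> g y \<and>
        (\<forall>c. \<pi> g (c \<odot>\<^bsub>H\<^esub> x) = c \<odot>\<^bsub>H\<^esub> \<pi> g x) \<and>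
        sprod H (\<pi> g x) (\<pi> g y) = sprod H x y)"

definition almost_invariant_imp_invariant ::
  "('g, 'n) monoid_scheme \<Rightarrow> 'g set \<Rightarrow> real \<Rightarrow>
   ('h, 'm) inner_module_scheme \<Rightarrow> ('g \<Rightarrow> 'h \<Rightarrow> 'h) \<Rightarrow> bool" where
  "almost_invariant_imp_invariant G Q \<epsilon> H \<pi> \<longleftrightarrow>
     ((\<exists>\<xi>\<in>carrier H. \<forall>\<gamma>\<in>Q. hnorm H (\<pi> \<gamma> \<xi> \<ominus>\<^bsub>H\<^esub> \<xi>) < \<epsilon> * hnorm H \<xi>) \<longrightarrow>
      (\<exists>\<eta>\<in>carrier H. \<eta> \<noteq> \<zero>\<^bsub>H\<^esub> \<and> (\<forall>\<gamma>\<in>carrier G. \<pi> \<gamma> \<eta> = \<eta>)))"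

text \<open>
  Types cannot be quantified over inside a formula, so the Hilbert spaces have to live on
  subsets of one fixed type. Nothing is lost: \<open>kazhdan_pair_all_hilbert_spaces\<close> below extends the
  condition to Hilbert spaces on an arbitrary type.
\<close>

definition kazhdan_pair :: "('g, 'n) monoid_scheme \<Rightarrow> 'g set \<Rightarrow> real \<Rightarrow> bool" where
  "kazhdan_pair G Q \<epsilon> \<longleftrightarrow>
     Q \<subseteq> carrier G \<and> finite Q \<and> generate G Q = carrier G \<and> 0 < \<epsilon> \<and>
     (\<forall>(H :: (nat \<Rightarrow> complex) inner_module) \<pi>.
        complex_hilbert_space H \<longrightarrow> unitary_rep G H \<pi> \<longrightarrow>
        almost_invariant_imp_invariant G Q \<epsilon> H \<pi>)"

definition property_T :: "('g, 'n) monoid_scheme \<Rightarrow> bool" where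
  "property_T G \<longleftrightarrow> (\<exists>Q \<epsilon>. kazhdan_pair G Q \<epsilon>)"


section \<open>Cost\<close>

definition standard_borel :: "'x measure \<Rightarrow> bool" where
  "standard_borel M \<longleftrightarrow>
     (\<exists>T. topspace T = space M \<and> completely_metrizable_space T \<and> second_countable T \<and>
          sets M = sigma_sets (space M) {U. openin T U})"

definition standard_prob_space :: "'x measure \<Rightarrow> bool" where
  "standard_prob_space M \<longleftrightarrow> prob_space M \<and> standard_borel M"

definition pmp_action :: "('g, 'n) monoid_scheme \<Rightarrow> 'x measure \<Rightarrow> ('g \<Rightarrow> 'x \<Rightarrow> 'x) \<Rightarrow> bool" where
  "pmp_action G M \<alpha> \<longleftrightarrow>
     group_action G (space M) \<alpha> \<and>
     (\<forall>g\<in>carrier G. \<alpha> g \<in> M \<rightarrow>\<^sub>M M \<and> distr M M (\<alpha> g) = M)"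

text \<open>Freeness is required almost everywhere, in line with graphings.\<close>

definition free_action :: "('g, 'n) monoid_scheme \<Rightarrow> 'x measure \<Rightarrow> ('g \<Rightarrow> 'x \<Rightarrow> 'x) \<Rightarrow> bool" where
  "free_action G M \<alpha> \<longleftrightarrow> (AE x in M. \<forall>g\<in>carrier G - {\<one>\<^bsub>G\<^esub>}. \<alpha> g x \<noteq> x)"

definition orbit_rel :: "('g, 'n) monoid_scheme \<Rightarrow> 'x measure \<Rightarrow> ('g \<Rightarrow> 'x \<Rightarrow> 'x) \<Rightarrow> 'x rel" where
  "orbit_rel G M \<alpha> = {(x, y). x \<in> space M \<and> y \<in> orbit G \<alpha> x}"

definition borel_graph :: "'x measure \<Rightarrow> 'x rel \<Rightarrow> bool" where
  "borel_graph M \<G> \<longleftrightarrow> \<G> \<in> sets (M \<Otimes>\<^sub>M M) \<and> sym \<G> \<and> irrefl \<G>"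

definition graphing :: "'x measure \<Rightarrow> 'x rel \<Rightarrow> 'x rel \<Rightarrow> bool" where
  "graphing M E \<G> \<longleftrightarrow> borel_graph M \<G> \<and> (AE x in M. \<G>\<^sup>* `` {x} = E `` {x})"

text \<open>Vertices with infinitely many neighbours get degree \<open>\<infinity>\<close>.\<close>

definition vertex_degree :: "'x rel \<Rightarrow> 'x \<Rightarrow> ennreal" where
  "vertex_degree \<G> x = emeasure (count_space UNIV) (\<G> `` {x})"

definition cost :: "'x measure \<Rightarrow> 'x rel \<Rightarrow> ennreal" where
  "cost M E = (INF \<G>\<in>{\<G>. graphing M E \<G>}. (1/2) * (\<integral>\<^sup>+ x. vertex_degree \<G> x \<partial>M))"

text \<open>
  The spaces range over all standard probability spaces whose points are reals. Again this loses
  nothing: by \<open>group_cost_le_cost\<close> below, free actions on standard probability spaces over any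
  other type do not have smaller cost.
\<close>

definition group_cost :: "('g, 'n) monoid_scheme \<Rightarrow> ennreal" where
  "group_cost G =
     (INF (M, \<alpha>)\<in>{(M :: real measure, \<alpha>).
        standard_prob_space M \<and> pmp_action G M \<alpha> \<and> free_action G M \<alpha>}.
      cost M (orbit_rel G M \<alpha>))"


section \<open>Independence of the choice of underlying types\<close>

lemma group_actionI:
  fixes G (structure)
  assumes "group G"
    and ext: "\<And>g. g \<in> carrier G \<Longrightarrow> \<phi> g \<in> extensional E"
    and closed: "\<And>g x. \<lbrakk>g \<in> carrier G; x \<in> E\<rbrakk> \<Longrightarrow> \<phi> g x \<in> E"
    and one: "\<And>x. x \<in> E \<Longrightarrow> \<phi> \<one> x = x"
    and mult: "\<And>g h x. \<lbrakk>g \<in> carrier G; h \<in> carrier G; x \<in> E\<rbrakk> \<Longrightarrow> \<phi> (g \<otimes> h) x = \<phi> g (\<phi> h x)"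
  shows "group_action G E \<phi>"
proof -
  interpret group G by fact
  have bij: "\<phi> g \<in> Bij E" if g: "g \<in> carrier G" for g
  proof -
    have "bij_betw (\<phi> g) E E"
    proof (rule bij_betw_byWitness[where f' = "\<phi> (inv g)"])
      show "\<forall>x\<in>E. \<phi> (inv g) (\<phi> g x) = x"
        using g by (metis inv_closed l_inv mult one)
      show "\<forall>x\<in>E. \<phi> g (\<phi> (inv g) x) = x"
        using g by (metis inv_closed r_inv mult one)
    qed (use g closed in auto)
    then show ?thesis using ext[OF g] by (simp add: Bij_def)
  qed
  have "group_hom G (BijGroup E) \<phi>"
  proof (intro group_hom.intro group_hom_axioms.intro homI)
    show "group (BijGroup E)" by (rule group_BijGroup)
    fix g h assume gh: "g \<in> carrier G" "h \<in> carrier G"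
    have "\<phi> (g \<otimes> h) = compose E (\<phi> g) (\<phi> h)"
      by (rule extensionalityI[where A = E])
        (use gh ext mult in \<open>auto simp: compose_eq\<close>)
    then show "\<phi> (g \<otimes> h) = \<phi> g \<otimes>\<^bsub>BijGroup E\<^esub> \<phi> h"
      using gh bij by (simp add: BijGroup_def)
  qed (use bij in \<open>auto simp: BijGroup_def\<close>)
  then show ?thesis by (rule group_action.intro)
qed

lemma (in group) countable_generate:
  assumes "countable Q" "Q \<subseteq> carrier G"
  shows "countable (generate G Q)"
proof -
  define W where "W = lists (Q \<union> (\<lambda>x. inv x) ` Q)"
  define ev where "ev = (\<lambda>w. foldr (\<otimes>) w \<one>)"
  have car: "ev w \<in> carrier G" if "w \<in> W" for w
    using that assms(2) unfolding W_def ev_def by (induction w) auto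
  have app: "ev (u @ v) = ev u \<otimes> ev v" if "u \<in> W" "v \<in> W" for u v
    using that(1)
  proof (induction u)
    case Nil
    then show ?case using car[OF that(2)] by (simp add: ev_def)
  next
    case (Cons a u)
    then have "a \<in> carrier G" "u \<in> W" using assms(2) by (auto simp: W_def)
    with Cons car[OF \<open>u \<in> W\<close>] car[OF that(2)] show ?case
      by (simp add: ev_def m_assoc)
  qed
  have "generate G Q \<subseteq> ev ` W"
  proof
    fix x assume "x \<in> generate G Q"
    then show "x \<in> ev ` W"
    proof (induction rule: generate.induct)
      case one
      have "\<one> = ev []" "[] \<in> W" by (auto simp: ev_def W_def)
      then show ?case by blast
    next
      case (incl h)
      then have "h = ev [h]" "[h] \<in> W" using assms(2) by (auto simp: ev_def W_def)
      then show ?case by blast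
    next
      case (inv h)
      then have "inv h = ev [inv h]" "[inv h] \<in> W" using assms(2) by (auto simp: ev_def W_def)
      then show ?case by blast
    next
      case (eng h1 h2)
      then obtain u v where "u \<in> W" "v \<in> W" "h1 = ev u" "h2 = ev v" by blast
      moreover then have "u @ v \<in> W" by (simp add: W_def)
      ultimately show ?case using app by (metis imageI)
    qed
  qed
  moreover have "countable (ev ` W)" unfolding W_def using assms(1) by auto
  ultimately show ?thesis by (rule countable_subset)
qed

context complex_hilbert_space begin

lemma smult_closed' [simp, intro]: "x \<in> carrier H \<Longrightarrow> c \<odot> x \<in> carrier H"
  using smult_closed by (simp add: ring_of_type_algebra_def)

lemma sprod_zero: "x \<in> carrier H \<Longrightarrow> sprod H \<zero> x = 0"
  using sprod_add[of \<zero> \<zero> x] by simp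

lemma sprod_uminus:
  assumes "x \<in> carrier H" "y \<in> carrier H"
  shows "sprod H (\<ominus> x) y = - sprod H x y"
  using sprod_add[of "\<ominus> x" x y] assms sprod_zero[of y] l_neg[of x]
  by (simp add: eq_neg_iff_add_eq_0)

lemma sprod_minus:
  assumes "x \<in> carrier H" "y \<in> carrier H" "z \<in> carrier H"
  shows "sprod H (x \<ominus> y) z = sprod H x z - sprod H y z"
  using assms by (simp add: a_minus_def sprod_add sprod_uminus)

lemma sprod_minus_right:
  assumes "x \<in> carrier H" "y \<in> carrier H" "z \<in> carrier H"
  shows "sprod H z (x \<ominus> y) = sprod H z x - sprod H z y"
  using sprod_commute[of "x \<ominus> y" z] sprod_commute[of x z] sprod_commute[of y z] assms
  by (simp add: sprod_minus)

lemma sprod_smult_right: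
  assumes "x \<in> carrier H" "y \<in> carrier H"
  shows "sprod H x (c \<odot> y) = cnj c * sprod H x y"
  using sprod_commute[of "c \<odot> y" x] sprod_commute[of y x] assms by (simp add: sprod_smult)

lemma sprod_self:
  assumes "x \<in> carrier H"
  shows "sprod H x x = of_real ((hnorm H x)\<^sup>2)"
proof -
  have "sprod H x x = cnj (sprod H x x)" using sprod_commute assms by blast
  then have "Im (sprod H x x) = 0" by (simp add: complex_eq_iff)
  then show ?thesis using sprod_nonneg[OF assms] by (simp add: complex_eq_iff hnorm_def)
qed

lemma hnorm_nonneg [simp]: "x \<in> carrier H \<Longrightarrow> 0 \<le> hnorm H x"
  by (simp add: hnorm_def sprod_nonneg)

lemma Cauchy_Schwarz:
  assumes x: "x \<in> carrier H" and y: "y \<in> carrier H"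
  shows "cmod (sprod H x y) \<le> hnorm H x * hnorm H y"
proof (cases "hnorm H y = 0")
  case True
  then have "y = \<zero>" using sprod_self[OF y] sprod_definite[OF y] by simp
  then have "sprod H y x = 0" using sprod_zero[OF x] by simp
  then have "sprod H x y = 0" using sprod_commute[OF y x] by simp
  then show ?thesis using x y by simp
next
  case False
  define a b c where "a = hnorm H x" and "b = hnorm H y" and "c = sprod H x y"
  define z where "z = x \<ominus> (c / b\<^sup>2) \<odot> y"
  have z: "z \<in> carrier H" using x y by (simp add: z_def)
  have b: "b \<noteq> 0" using False by (simp add: b_def)
  have yx: "sprod H y x = cnj c" using sprod_commute[OF x y] by (simp add: c_def)
  have "sprod H z z = of_real (a\<^sup>2) - c * cnj c / b\<^sup>2"
    using x y b sprod_self[OF x] sprod_self[OF y]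
    by (simp add: z_def sprod_minus sprod_minus_right sprod_smult sprod_smult_right yx
        field_simps power2_eq_square flip: a_def b_def c_def)
  also have "\<dots> = of_real (a\<^sup>2 - (cmod c)\<^sup>2 / b\<^sup>2)"
    by (simp add: complex_mult_cnj cmod_def)
  finally have "0 \<le> a\<^sup>2 - (cmod c)\<^sup>2 / b\<^sup>2" using sprod_nonneg[OF z] by simp
  then have "(cmod c)\<^sup>2 \<le> (a * b)\<^sup>2" using b by (simp add: field_simps power_mult_distrib)
  then show ?thesis using x y unfolding a_def b_def c_def by (auto dest!: power2_le_imp_le)
qed

lemma transport:
  fixes j :: "'h \<Rightarrow> 'k"
  assumes K: "K \<subseteq> carrier H" "\<zero> \<in> K"
    and addK: "\<And>x y. \<lbrakk>x \<in> K; y \<in> K\<rbrakk> \<Longrightarrow> x \<oplus> y \<in> K"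
    and smultK: "\<And>c x. x \<in> K \<Longrightarrow> c \<odot> x \<in> K"
    and uminusK: "\<And>x. x \<in> K \<Longrightarrow> \<ominus> x \<in> K"
    and limK: "\<And>s x. \<lbrakk>range s \<subseteq> K; x \<in> carrier H; (\<lambda>n. hnorm H (s n \<ominus> x)) \<longlonglongrightarrow> 0\<rbrakk> \<Longrightarrow> x \<in> K"
    and inj: "inj_on j K"
  shows "\<exists>H' :: 'k inner_module. complex_hilbert_space H' \<and> carrier H' = j ` K \<and> \<zero>\<^bsub>H'\<^esub> = j \<zero> \<and>
    (\<forall>x\<in>K. \<forall>y\<in>K. j x \<oplus>\<^bsub>H'\<^esub> j y = j (x \<oplus> y) \<and> j x \<ominus>\<^bsub>H'\<^esub> j y = j (x \<ominus> y) \<and>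
      sprod H' (j x) (j y) = sprod H x y) \<and>
    (\<forall>c. \<forall>x\<in>K. c \<odot>\<^bsub>H'\<^esub> j x = j (c \<odot> x))"
proof -
  define i where "i = the_inv_into K j"
  have i [simp]: "i (j x) = x" if "x \<in> K" for x
    using that inj by (simp add: i_def the_inv_into_f_f)
  have sub: "x \<in> carrier H" if "x \<in> K" for x using that K by auto
  define H' :: "'k inner_module" where
    "H' = \<lparr>carrier = j ` K, monoid.mult = (\<lambda>_ _. undefined), one = undefined,
       zero = j \<zero>, add = (\<lambda>a b. j (i a \<oplus> i b)), module.smult = (\<lambda>c a. j (c \<odot> i a)),
       sprod = (\<lambda>a b. sprod H (i a) (i b))\<rparr>"
  have car: "carrier H' = j ` K" and zero: "\<zero>\<^bsub>H'\<^esub> = j \<zero>"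
    and add: "\<And>x y. \<lbrakk>x \<in> K; y \<in> K\<rbrakk> \<Longrightarrow> j x \<oplus>\<^bsub>H'\<^esub> j y = j (x \<oplus> y)"
    and smult: "\<And>c x. x \<in> K \<Longrightarrow> c \<odot>\<^bsub>H'\<^esub> j x = j (c \<odot> x)"
    and sprod: "\<And>x y. \<lbrakk>x \<in> K; y \<in> K\<rbrakk> \<Longrightarrow> sprod H' (j x) (j y) = sprod H x y"
    by (simp_all add: H'_def)
  have ag: "abelian_group H'"
  proof (rule abelian_groupI)
    fix x assume "x \<in> carrier H'"
    then obtain u where "u \<in> K" "x = j u" by (auto simp: car)
    then show "\<exists>y\<in>carrier H'. y \<oplus>\<^bsub>H'\<^esub> x = \<zero>\<^bsub>H'\<^esub>"
      using uminusK sub by (intro bexI[of _ "j (\<ominus> u)"]) (auto simp: car add zero l_neg)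
  qed (use K addK sub in \<open>auto simp: car zero add a_ac\<close>)
  interpret H': abelian_group H' by (rule ag)
  have minus: "j x \<ominus>\<^bsub>H'\<^esub> j y = j (x \<ominus> y)" if xy: "x \<in> K" "y \<in> K" for x y
  proof -
    have "\<ominus>\<^bsub>H'\<^esub> j y = j (\<ominus> y)"
      using xy uminusK sub by (intro H'.minus_equality) (auto simp: car add zero l_neg)
    then show ?thesis using xy uminusK by (simp add: a_minus_def add)
  qed
  have minusK: "x \<ominus> y \<in> K" if "x \<in> K" "y \<in> K" for x y
    using that addK uminusK by (simp add: a_minus_def)
  have hnorm': "hnorm H' (j x) = hnorm H x" if "x \<in> K" for x
    using that by (simp add: hnorm_def sprod)
  have mod: "Module.module (ring_of_type_algebra :: complex ring) H'"
  proof (rule moduleI)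
    show "cring (ring_of_type_algebra :: complex ring)" by (rule R.is_cring)
    show "abelian_group H'" by (rule ag)
  next
    fix a b :: complex and x
    assume ab: "a \<in> carrier ring_of_type_algebra" "b \<in> carrier ring_of_type_algebra"
      and "x \<in> carrier H'"
    then obtain u where u: "u \<in> K" "x = j u" by (auto simp: car)
    show "(a \<oplus>\<^bsub>ring_of_type_algebra\<^esub> b) \<odot>\<^bsub>H'\<^esub> x = a \<odot>\<^bsub>H'\<^esub> x \<oplus>\<^bsub>H'\<^esub> b \<odot>\<^bsub>H'\<^esub> x"
      using smult_l_distr[OF ab sub[OF u(1)]] u smultK by (simp add: smult add)
    show "(a \<otimes>\<^bsub>ring_of_type_algebra\<^esub> b) \<odot>\<^bsub>H'\<^esub> x = a \<odot>\<^bsub>H'\<^esub> (b \<odot>\<^bsub>H'\<^esub> x)"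
      using smult_assoc1[OF ab sub[OF u(1)]] u smultK by (simp add: smult)
  next
    fix a :: complex and x y
    assume a: "a \<in> carrier ring_of_type_algebra" and "x \<in> carrier H'" "y \<in> carrier H'"
    then obtain u v where uv: "u \<in> K" "x = j u" "v \<in> K" "y = j v" by (auto simp: car)
    show "a \<odot>\<^bsub>H'\<^esub> (x \<oplus>\<^bsub>H'\<^esub> y) = a \<odot>\<^bsub>H'\<^esub> x \<oplus>\<^bsub>H'\<^esub> a \<odot>\<^bsub>H'\<^esub> y"
      using smult_r_distr[OF a sub[OF uv(1)] sub[OF uv(3)]] uv smultK addK
      by (simp add: smult add)
  qed (use smultK sub in \<open>auto simp: car smult\<close>)
  have "complex_hilbert_space H'"
  proof (intro complex_hilbert_space.intro mod complex_hilbert_space_axioms.intro)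
    fix s :: "nat \<Rightarrow> 'k"
    assume s: "range s \<subseteq> carrier H'"
      and cau: "\<forall>e>0. \<exists>N. \<forall>m\<ge>N. \<forall>n\<ge>N. hnorm H' (s m \<ominus>\<^bsub>H'\<^esub> s n) < e"
    define t where "t = i \<circ> s"
    have t: "t n \<in> K" and st: "s n = j (t n)" for n
    proof -
      have "s n \<in> j ` K" using s by (auto simp: car)
      then obtain u where "u \<in> K" "s n = j u" by blast
      then show "t n \<in> K" "s n = j (t n)" by (simp_all add: t_def)
    qed
    have "\<exists>x\<in>carrier H. (\<lambda>n. hnorm H (t n \<ominus> x)) \<longlonglongrightarrow> 0"
      using cau t sub by (intro complete) (auto simp: st minus minusK hnorm')
    then obtain x where x: "x \<in> carrier H" "(\<lambda>n. hnorm H (t n \<ominus> x)) \<longlonglongrightarrow> 0" by blast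
    have xK: "x \<in> K" by (rule limK[OF _ x]) (use t in auto)
    show "\<exists>x\<in>carrier H'. (\<lambda>n. hnorm H' (s n \<ominus>\<^bsub>H'\<^esub> x)) \<longlonglongrightarrow> 0"
      using x xK t by (intro bexI[of _ "j x"]) (auto simp: st minus minusK hnorm' car)
  next
    fix x assume "x \<in> carrier H'" "sprod H' x x = 0"
    then obtain u where u: "u \<in> K" "x = j u" "sprod H u u = 0" by (auto simp: car sprod)
    then have "u = \<zero>" using sprod_definite sub by blast
    then show "x = \<zero>\<^bsub>H'\<^esub>" using u by (simp add: zero)
  next
    fix x y assume "x \<in> carrier H'" "y \<in> carrier H'"
    then obtain u v where uv: "u \<in> K" "x = j u" "v \<in> K" "y = j v" by (auto simp: car)
    then show "sprod H' y x = cnj (sprod H' x y)"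
      using sprod_commute[OF sub[OF uv(1)] sub[OF uv(3)]] by (simp add: sprod)
  qed (auto simp: car add smult sprod sub addK smultK sprod_add sprod_smult sprod_nonneg)
  then show ?thesis 
    by (intro exI[of _ H'] conjI ballI allI) (simp_all add: car zero add smult minus sprod)
qed

end

lemma kazhdan_pair_all_hilbert_spaces:
  fixes G :: "('g, 'n) monoid_scheme" and H :: "('h, 'm) inner_module_scheme"
  assumes G: "group G" and kp: "kazhdan_pair G Q \<epsilon>"
    and H: "complex_hilbert_space H" and rep: "unitary_rep G H \<pi>"
  shows "almost_invariant_imp_invariant G Q \<epsilon> H \<pi>"
  unfolding almost_invariant_imp_invariant_def
proof
  assume "\<exists>\<xi>\<in>carrier H. \<forall>\<gamma>\<in>Q. hnorm H (\<pi> \<gamma> \<xi> \<ominus>\<^bsub>H\<^esub> \<xi>) < \<epsilon> * hnorm H \<xi>"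
  then obtain \<xi> where \<xi>: "\<xi> \<in> carrier H"
    and alm: "\<And>\<gamma>. \<gamma> \<in> Q \<Longrightarrow> hnorm H (\<pi> \<gamma> \<xi> \<ominus>\<^bsub>H\<^esub> \<xi>) < \<epsilon> * hnorm H \<xi>" by blast
  interpret G: group G by fact
  interpret complex_hilbert_space H by fact
  interpret \<pi>: group_action G "carrier H" \<pi> using rep by (simp add: unitary_rep_def)
  have Q: "Q \<subseteq> carrier G" "finite Q" "generate G Q = carrier G"
    using kp by (auto simp: kazhdan_pair_def)
  have "countable (carrier G)"
    using G.countable_generate[of Q] Q by (simp add: countable_finite)
  have \<pi>_closed [simp]: "\<pi> g x \<in> carrier H" if "g \<in> carrier G" "x \<in> carrier H" for g x
    using \<pi>.element_image that by blast
  have \<pi>_add: "\<pi> g (x \<oplus>\<^bsub>H\<^esub> y) = \<pi> g x \<oplus>\<^bsub>H\<^esub> \<pi> g y"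
    and \<pi>_sprod: "sprod H (\<pi> g x) (\<pi> g y) = sprod H x y"
    if "g \<in> carrier G" "x \<in> carrier H" "y \<in> carrier H" for g x y
    using rep that by (auto simp: unitary_rep_def)
  have \<pi>_smult: "\<pi> g (c \<odot>\<^bsub>H\<^esub> x) = c \<odot>\<^bsub>H\<^esub> \<pi> g x"
    if "g \<in> carrier G" "x \<in> carrier H" for g x c
    using rep that by (auto simp: unitary_rep_def)
  have \<pi>_inv: "\<pi> g (\<pi> (inv\<^bsub>G\<^esub> g) x) = x" "\<pi> (inv\<^bsub>G\<^esub> g) (\<pi> g x) = x"
    if "g \<in> carrier G" "x \<in> carrier H" for g x
    using that \<pi>.composition_rule[of x g "inv\<^bsub>G\<^esub> g"] \<pi>.composition_rule[of x "inv\<^bsub>G\<^esub> g" g]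
      \<pi>.id_eq_one[symmetric] by auto
  define P where "P = {y \<in> carrier H. \<forall>g\<in>carrier G. sprod H (\<pi> g \<xi>) y = 0}"
  define K where "K = {x \<in> carrier H. \<forall>y\<in>P. sprod H x y = 0}"
  have Psub: "y \<in> carrier H" if "y \<in> P" for y using that by (simp add: P_def)
  have Ksub: "x \<in> carrier H" if "x \<in> K" for x using that by (simp add: K_def)
  have K1: "K \<subseteq> carrier H" "\<zero>\<^bsub>H\<^esub> \<in> K"
    and K2: "\<And>x y. \<lbrakk>x \<in> K; y \<in> K\<rbrakk> \<Longrightarrow> x \<oplus>\<^bsub>H\<^esub> y \<in> K"
    and K3: "\<And>c x. x \<in> K \<Longrightarrow> c \<odot>\<^bsub>H\<^esub> x \<in> K"
    and K4: "\<And>x. x \<in> K \<Longrightarrow> \<ominus>\<^bsub>H\<^esub> x \<in> K"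
    by (auto simp: K_def Psub sprod_zero sprod_add sprod_smult sprod_uminus)
  have K5: "x \<in> K" if s: "range s \<subseteq> K" and x: "x \<in> carrier H"
    and lim: "(\<lambda>n. hnorm H (s n \<ominus>\<^bsub>H\<^esub> x)) \<longlonglongrightarrow> 0" for s x
  proof -
    have "sprod H x y = 0" if y: "y \<in> P" for y
    proof -
      have sK: "s n \<in> K" for n using s by auto
      have "cmod (sprod H x y) \<le> hnorm H (s n \<ominus>\<^bsub>H\<^esub> x) * hnorm H y" for n
      proof -
        have "sprod H (s n \<ominus>\<^bsub>H\<^esub> x) y = - sprod H x y"
          using sK[of n] x y Psub[OF y] Ksub[OF sK[of n]] by (simp add: sprod_minus K_def)
        then show ?thesis
          using Cauchy_Schwarz[of "s n \<ominus>\<^bsub>H\<^esub> x" y] x Psub[OF y] Ksub[OF sK[of n]] by simp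
      qed
      moreover have "(\<lambda>n. hnorm H (s n \<ominus>\<^bsub>H\<^esub> x) * hnorm H y) \<longlonglongrightarrow> 0"
        using tendsto_mult_right[OF lim, of "hnorm H y"] by simp
      ultimately have "cmod (sprod H x y) \<le> 0"
        by (intro LIMSEQ_le_const) auto
      then show ?thesis by simp
    qed
    then show ?thesis using x by (simp add: K_def)
  qed
  have P\<pi>: "\<pi> g y \<in> P" if g: "g \<in> carrier G" and y: "y \<in> P" for g y
    unfolding P_def
  proof (intro CollectI conjI ballI)
    show "\<pi> g y \<in> carrier H" using g Psub[OF y] by simp
    fix h assume h: "h \<in> carrier G"
    have "sprod H (\<pi> h \<xi>) (\<pi> g y) = sprod H (\<pi> g (\<pi> (inv\<^bsub>G\<^esub> g \<otimes>\<^bsub>G\<^esub> h) \<xi>)) (\<pi> g y)"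
      using g h \<xi> by (simp add: \<pi>.composition_rule \<pi>_inv)
    also have "\<dots> = sprod H (\<pi> (inv\<^bsub>G\<^esub> g \<otimes>\<^bsub>G\<^esub> h) \<xi>) y"
      using g h \<xi> Psub[OF y] by (intro \<pi>_sprod) auto
    also have "\<dots> = 0" using y g h by (auto simp: P_def)
    finally show "sprod H (\<pi> h \<xi>) (\<pi> g y) = 0" .
  qed
  have K\<pi>: "\<pi> g x \<in> K" if g: "g \<in> carrier G" and x: "x \<in> K" for g x
    unfolding K_def
  proof (intro CollectI conjI ballI)
    show "\<pi> g x \<in> carrier H" using g Ksub[OF x] by simp
    fix y assume y: "y \<in> P"
    have "sprod H (\<pi> g x) y = sprod H (\<pi> g x) (\<pi> g (\<pi> (inv\<^bsub>G\<^esub> g) y))"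
      using g Psub[OF y] by (simp add: \<pi>_inv)
    also have "\<dots> = sprod H x (\<pi> (inv\<^bsub>G\<^esub> g) y)"
      using g Psub[OF y] Ksub[OF x] by (intro \<pi>_sprod) auto
    also have "\<dots> = 0" using P\<pi>[of "inv\<^bsub>G\<^esub> g" y] g x y by (auto simp: K_def)
    finally show "sprod H (\<pi> g x) y = 0" .
  qed
  have \<pi>_one: "\<pi> \<one>\<^bsub>G\<^esub> x = x" if "x \<in> carrier H" for x
    using that \<pi>.id_eq_one[symmetric] by simp
  have \<xi>K: "\<xi> \<in> K"
    using \<xi> \<pi>_one[OF \<xi>] by (force simp: K_def P_def)
  define j where "j = (\<lambda>x (n::nat). sprod H x (\<pi> (from_nat_into (carrier G) n) \<xi>))"
  have inj: "inj_on j K"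
  proof (rule inj_onI)
    fix x y assume x: "x \<in> K" and y: "y \<in> K" and xy: "j x = j y"
    define z where "z = x \<ominus>\<^bsub>H\<^esub> y"
    have z: "z \<in> carrier H" "z \<in> K"
      using x y K2 K4 Ksub by (auto simp: z_def a_minus_def)
    have "sprod H (\<pi> g \<xi>) z = 0" if g: "g \<in> carrier G" for g
    proof -
      obtain n where n: "from_nat_into (carrier G) n = g"
        using from_nat_into_surj[OF \<open>countable (carrier G)\<close> g] ..
      have "sprod H x (\<pi> g \<xi>) = sprod H y (\<pi> g \<xi>)"
        using fun_cong[OF xy, of n] by (simp add: j_def n)
      then have "sprod H z (\<pi> g \<xi>) = 0"
        using g \<xi> Ksub[OF x] Ksub[OF y] by (simp add: z_def sprod_minus)
      then show ?thesis using sprod_commute[of z "\<pi> g \<xi>"] z g \<xi> by simp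
    qed
    then have "z \<in> P" using z by (simp add: P_def)
    then have "sprod H z z = 0" using z by (auto simp: K_def)
    then have "z = \<zero>\<^bsub>H\<^esub>" using sprod_definite z by blast
    then have "x \<ominus>\<^bsub>H\<^esub> y = \<zero>\<^bsub>H\<^esub>" by (simp add: z_def)
    moreover have "(x \<ominus>\<^bsub>H\<^esub> y) \<oplus>\<^bsub>H\<^esub> y = x"
      using Ksub x y by (simp add: a_minus_def a_assoc l_neg)
    ultimately show "x = y" using Ksub x y by simp
  qed
  obtain H' :: "(nat \<Rightarrow> complex) inner_module" where H'0:
    "complex_hilbert_space H' \<and> carrier H' = j ` K \<and> \<zero>\<^bsub>H'\<^esub> = j \<zero>\<^bsub>H\<^esub> \<and>
    (\<forall>x\<in>K. \<forall>y\<in>K. j x \<oplus>\<^bsub>H'\<^esub> j y = j (x \<oplus>\<^bsub>H\<^esub> y) \<and> j x \<ominus>\<^bsub>H'\<^esub> j y = j (x \<ominus>\<^bsub>H\<^esub> y) \<and>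
      sprod H' (j x) (j y) = sprod H x y) \<and>
    (\<forall>c. \<forall>x\<in>K. c \<odot>\<^bsub>H'\<^esub> j x = j (c \<odot>\<^bsub>H\<^esub> x))"
    using transport[OF K1 K2 K3 K4 K5 inj] ..
  have H': "complex_hilbert_space H'" "carrier H' = j ` K" "\<zero>\<^bsub>H'\<^esub> = j \<zero>\<^bsub>H\<^esub>"
    "\<And>x y. \<lbrakk>x \<in> K; y \<in> K\<rbrakk> \<Longrightarrow> j x \<oplus>\<^bsub>H'\<^esub> j y = j (x \<oplus>\<^bsub>H\<^esub> y)"
    "\<And>c x. x \<in> K \<Longrightarrow> c \<odot>\<^bsub>H'\<^esub> j x = j (c \<odot>\<^bsub>H\<^esub> x)"
    "\<And>x y. \<lbrakk>x \<in> K; y \<in> K\<rbrakk> \<Longrightarrow> j x \<ominus>\<^bsub>H'\<^esub> j y = j (x \<ominus>\<^bsub>H\<^esub> y)"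
    "\<And>x y. \<lbrakk>x \<in> K; y \<in> K\<rbrakk> \<Longrightarrow> sprod H' (j x) (j y) = sprod H x y"
    using H'0 by simp_all
  define i where "i = the_inv_into K j"
  have i [simp]: "i (j x) = x" if "x \<in> K" for x
    using that inj by (simp add: i_def the_inv_into_f_f)
  define \<pi>' where "\<pi>' = (\<lambda>g. restrict (\<lambda>a. j (\<pi> g (i a))) (j ` K))"
  have \<pi>' [simp]: "\<pi>' g (j x) = j (\<pi> g x)" if "x \<in> K" for g x
    using that by (simp add: \<pi>'_def)
  have "group_action G (carrier H') \<pi>'"
    by (rule group_actionI)
      (auto simp: H' G K\<pi> \<pi>_one Ksub \<pi>.composition_rule, simp add: \<pi>'_def)
  then have rep': "unitary_rep G H' \<pi>'"
    by (auto simp: unitary_rep_def H' K2 K3 K\<pi> \<pi>_add \<pi>_smult \<pi>_sprod Ksub)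
  have hnorm': "hnorm H' (j x) = hnorm H x" if "x \<in> K" for x
    using that by (simp add: hnorm_def H')
  have "\<exists>\<xi>\<in>carrier H'. \<forall>\<gamma>\<in>Q. hnorm H' (\<pi>' \<gamma> \<xi> \<ominus>\<^bsub>H'\<^esub> \<xi>) < \<epsilon> * hnorm H' \<xi>"
  proof (intro bexI[of _ "j \<xi>"] ballI)
    fix \<gamma> assume \<gamma>: "\<gamma> \<in> Q"
    then have *: "\<pi> \<gamma> \<xi> \<in> K" using Q K\<pi> \<xi>K by auto
    then have "\<pi> \<gamma> \<xi> \<ominus>\<^bsub>H\<^esub> \<xi> \<in> K" using K2 K4 \<xi>K by (simp add: a_minus_def)
    then show "hnorm H' (\<pi>' \<gamma> (j \<xi>) \<ominus>\<^bsub>H'\<^esub> j \<xi>) < \<epsilon> * hnorm H' (j \<xi>)"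
      using alm[OF \<gamma>] \<xi>K * by (simp add: H' hnorm')
  qed (use \<xi>K in \<open>simp add: H'\<close>)
  moreover have "almost_invariant_imp_invariant G Q \<epsilon> H' \<pi>'"
    using kp H'(1) rep' by (simp add: kazhdan_pair_def)
  ultimately have "\<exists>\<eta>'\<in>carrier H'. \<eta>' \<noteq> \<zero>\<^bsub>H'\<^esub> \<and> (\<forall>\<gamma>\<in>carrier G. \<pi>' \<gamma> \<eta>' = \<eta>')"
    unfolding almost_invariant_imp_invariant_def by (rule rev_mp)
  then obtain \<eta>' where \<eta>': "\<eta>' \<in> carrier H'" "\<eta>' \<noteq> \<zero>\<^bsub>H'\<^esub>"
    "\<forall>\<gamma>\<in>carrier G. \<pi>' \<gamma> \<eta>' = \<eta>'" by (elim bexE conjE)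
  then obtain \<eta> where \<eta>: "\<eta> \<in> K" "\<eta>' = j \<eta>" by (auto simp: H')
  show "\<exists>\<eta>\<in>carrier H. \<eta> \<noteq> \<zero>\<^bsub>H\<^esub> \<and> (\<forall>\<gamma>\<in>carrier G. \<pi> \<gamma> \<eta> = \<eta>)"
  proof (intro bexI[of _ \<eta>] conjI ballI)
    show "\<eta> \<noteq> \<zero>\<^bsub>H\<^esub>" using \<eta>' \<eta> by (auto simp: H')
    fix \<gamma> assume "\<gamma> \<in> carrier G"
    then show "\<pi> \<gamma> \<eta> = \<eta>" using bspec[OF \<eta>'(3), of \<gamma>] \<eta> K\<pi>[of \<gamma> \<eta>] inj by (simp add: inj_on_eq_iff)
  qed (use \<eta> Ksub in auto)
qed

lemma AE_embed_measure:
  assumes inj: "inj_on j (space M)" and ae: "AE x in M. P (j x)"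
  shows "AE y in embed_measure M j. P y"
proof -
  from ae obtain S where S: "{x \<in> space M. \<not> P (j x)} \<subseteq> S" "S \<in> null_sets M"
    by (auto elim!: AE_E intro: null_setsI)
  have "j ` S \<in> null_sets (embed_measure M j)"
    using S inj by (auto simp: null_sets_def in_sets_embed_measure emeasure_embed_measure_image')
  moreover have "{y \<in> space (embed_measure M j). \<not> P y} \<subseteq> j ` S"
    using S by (auto simp: space_embed_measure)
  ultimately show ?thesis by (rule AE_I')
qed

lemma nn_integral_embed_measure_le:
  assumes inj: "inj_on j (space M)" and le: "\<And>x. x \<in> space M \<Longrightarrow> f (j x) \<le> g x"
  shows "(\<integral>\<^sup>+ y. f y \<partial>embed_measure M j) \<le> (\<integral>\<^sup>+ x. g x \<partial>M)"
  unfolding nn_integral_def[of "embed_measure M j"]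
proof (rule SUP_least)
  fix s assume "s \<in> {s. simple_function (embed_measure M j) s \<and> s \<le> f}"
  then have s: "simple_function (embed_measure M j) s" "s \<le> f" by auto
  have "integral\<^sup>S (embed_measure M j) s = (\<integral>\<^sup>+ y. s y \<partial>embed_measure M j)"
    using s by (simp add: nn_integral_eq_simple_integral)
  also have "\<dots> = (\<integral>\<^sup>+ x. s (j x) \<partial>M)"
    using s inj by (intro nn_integral_embed_measure' borel_measurable_simple_function)
  also have "\<dots> \<le> (\<integral>\<^sup>+ x. g x \<partial>M)"
    using s le by (intro nn_integral_mono) (metis le_funD order_trans)
  finally show "integral\<^sup>S (embed_measure M j) s \<le> (\<integral>\<^sup>+ x. g x \<partial>M)" .
qed

lemma second_countable_Hausdorff_embeds_real:
  assumes "second_countable T" "Hausdorff_space T"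
  obtains j :: "'x \<Rightarrow> real" where "inj_on j (topspace T)"
proof -
  obtain \<B> where \<B>: "countable \<B>"
    "\<And>U x. \<lbrakk>openin T U; x \<in> U\<rbrakk> \<Longrightarrow> \<exists>V\<in>\<B>. x \<in> V \<and> V \<subseteq> U"
    using assms(1) unfolding second_countable_def by metis
  obtain c :: "nat set \<Rightarrow> real" where c: "inj c"
    using nat_sets_eqpoll_reals by (auto simp: eqpoll_def bij_betw_def)
  define code where "code = (\<lambda>x. {n. x \<in> from_nat_into \<B> n})"
  have "inj_on code (topspace T)"
  proof (intro inj_onI, rule ccontr)
    fix x y assume xy: "x \<in> topspace T" "y \<in> topspace T" "code x = code y" "x \<noteq> y"
    then obtain U V where "openin T U" "openin T V" "x \<in> U" "y \<in> V" "disjnt U V"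
      using assms(2) unfolding Hausdorff_space_def by metis
    moreover then obtain W where "W \<in> \<B>" "x \<in> W" "W \<subseteq> U" using \<B>(2) by blast
    moreover then obtain n where "from_nat_into \<B> n = W"
      using from_nat_into_surj[OF \<B>(1)] by metis
    ultimately have "n \<in> code x" "n \<notin> code y" by (auto simp: code_def disjnt_def)
    then show False using xy by simp
  qed
  then have "inj_on (c \<circ> code) (topspace T)"
    using c by (meson comp_inj_on inj_on_subset subset_UNIV)
  then show thesis by (rule that)
qed

lemma standard_borel_embed_measure:
  assumes inj: "inj_on j (space M)" and M: "standard_borel M"
  shows "standard_borel (embed_measure M j)"
proof -
  obtain T where T: "topspace T = space M" "completely_metrizable_space T" "second_countable T"
    "sets M = sigma_sets (space M) {U. openin T U}"
    using M unfolding standard_borel_def by metis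
  define i where "i = the_inv_into (space M) j"
  have i [simp]: "i (j x) = x" if "x \<in> space M" for x
    using that inj by (simp add: i_def the_inv_into_f_f)
  define T' where "T' = pullback_topology (j ` space M) i T"
  have im: "i -` A \<inter> j ` space M = j ` A" if "A \<subseteq> space M" for A
    using that inj by (simp add: i_def the_inv_into_vimage)
  have sub: "U \<subseteq> space M" if "openin T U" for U using that T(1) openin_subset by metis
  have op: "openin T' S \<longleftrightarrow> (\<exists>U. openin T U \<and> S = j ` U)" for S
    unfolding T'_def openin_pullback_topology using im sub by metis
  have top: "topspace T' = j ` space M"
    by (auto simp: T'_def topspace_pullback_topology T(1))
  have "homeomorphic_maps T T' j i"
    unfolding homeomorphic_maps_def
  proof (intro conjI ballI)
    show "continuous_map T T' j"
    proof (unfold continuous_map, intro conjI allI impI)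
      fix S assume "openin T' S"
      then obtain U where U: "openin T U" "S = j ` U" using op by blast
      then have "{x \<in> topspace T. j x \<in> S} = U"
        using sub[OF U(1)] inj T(1) by (auto dest: inj_onD)
      then show "openin T {x \<in> topspace T. j x \<in> S}" using U by simp
    qed (simp add: top T(1))
    show "continuous_map T' T i"
    proof (unfold continuous_map, intro conjI allI impI)
      fix U assume U: "openin T U"
      then have "{x \<in> topspace T'. i x \<in> U} = j ` U"
        using im[OF sub[OF U]] top by blast
      then show "openin T' {x \<in> topspace T'. i x \<in> U}" using U op by auto
    qed (auto simp: top T(1))
  qed (auto simp: top T(1))
  then have homeo: "T homeomorphic_space T'" by (auto simp: homeomorphic_space_def)
  have im': "i -` A \<inter> j ` space M = j ` A" if "A \<in> sets M" for A
    using im sets.sets_into_space[OF that] .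
  have "sets (embed_measure M j) = {i -` A \<inter> j ` space M |A. A \<in> sets M}"
    unfolding sets_embed_measure'[OF inj] by (rule Collect_cong) (metis im')
  also have "\<dots> = sigma_sets (j ` space M) {i -` A \<inter> j ` space M |A. A \<in> {U. openin T U}}"
    unfolding T(4) by (rule sigma_sets_vimage_commute) auto
  also have "{i -` A \<inter> j ` space M |A. A \<in> {U. openin T U}} = {S. openin T' S}"
    unfolding T'_def openin_pullback_topology by auto
  finally have "sets (embed_measure M j) = sigma_sets (space (embed_measure M j)) {S. openin T' S}"
    by (simp add: space_embed_measure)
  then show ?thesis
    unfolding standard_borel_def
    using homeo T homeomorphic_completely_metrizable_space[OF homeo]
      homeomorphic_space_second_countability[OF homeo] top
    by (intro exI[of _ T']) (auto simp: space_embed_measure)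
qed

lemma cost_embed_measure_le:
  assumes inj: "inj_on j (space M)" and E: "E \<subseteq> space M \<times> space M"
  shows "cost (embed_measure M j) (map_prod j j ` E) \<le> cost M E"
  unfolding cost_def[of M]
proof (rule INF_greatest)
  let ?N = "embed_measure M j"
  define i where "i = the_inv_into (space M) j"
  have i [simp]: "i (j x) = x" if "x \<in> space M" for x
    using that inj by (simp add: i_def the_inv_into_f_f)
  have im: "(map_prod j j ` R) `` {j x} = j ` (R `` {x})"
    if R: "R \<subseteq> space M \<times> space M" and x: "x \<in> space M" for R x
  proof (intro equalityI subsetI)
    fix y assume "y \<in> (map_prod j j ` R) `` {j x}"
    then obtain u v where uv: "(u, v) \<in> R" "j u = j x" "y = j v" by auto
    then have "u = x" using R x inj by (auto dest: inj_onD)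
    then show "y \<in> j ` (R `` {x})" using uv by blast
  next
    fix y assume "y \<in> j ` (R `` {x})"
    then obtain v where "(x, v) \<in> R" "y = j v" by blast
    then show "y \<in> (map_prod j j ` R) `` {j x}" using map_prod_imageI[of x v R j j] by simp
  qed
  fix \<G> assume "\<G> \<in> {\<G>. graphing M E \<G>}"
  then have \<G>: "\<G> \<in> sets (M \<Otimes>\<^sub>M M)" "sym \<G>" "irrefl \<G>" "AE x in M. \<G>\<^sup>* `` {x} = E `` {x}"
    by (auto simp: graphing_def borel_graph_def)
  have sub: "\<G> \<subseteq> space M \<times> space M"
    using sets.sets_into_space[OF \<G>(1)] by (simp add: space_pair_measure)
  define \<G>' where "\<G>' = map_prod j j ` \<G>"
  have i_meas: "i \<in> ?N \<rightarrow>\<^sub>M M"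
    by (rule measurable_embed_measure1) (simp cong: measurable_cong)
  have "(\<lambda>p. (i (fst p), i (snd p))) -` \<G> \<inter> space (?N \<Otimes>\<^sub>M ?N) \<in> sets (?N \<Otimes>\<^sub>M ?N)"
    by (intro measurable_sets[OF _ \<G>(1)] measurable_Pair
        measurable_compose[OF measurable_fst i_meas] measurable_compose[OF measurable_snd i_meas])
  also have "(\<lambda>p. (i (fst p), i (snd p))) -` \<G> \<inter> space (?N \<Otimes>\<^sub>M ?N) = \<G>'"
  proof (intro equalityI subsetI)
    fix p assume "p \<in> (\<lambda>p. (i (fst p), i (snd p))) -` \<G> \<inter> space (?N \<Otimes>\<^sub>M ?N)"
    then obtain u v where "p = (j u, j v)" "u \<in> space M" "v \<in> space M" "(i (fst p), i (snd p)) \<in> \<G>"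
      by (auto simp: space_pair_measure space_embed_measure)
    then show "p \<in> \<G>'" using map_prod_imageI[of u v \<G> j j] by (simp add: \<G>'_def)
  qed (use sub in \<open>auto simp: \<G>'_def space_pair_measure space_embed_measure\<close>)
  finally have meas: "\<G>' \<in> sets (?N \<Otimes>\<^sub>M ?N)" .
  have "sym \<G>'" using \<G>(2) by (auto simp: sym_def \<G>'_def)
  moreover have "irrefl \<G>'"
    using \<G>(3) sub inj by (auto simp: irrefl_def \<G>'_def dest: inj_onD)
  moreover have "AE y in ?N. \<G>'\<^sup>* `` {y} = (map_prod j j ` E) `` {y}"
  proof (rule AE_embed_measure[OF inj])
    have comp: "\<G>'\<^sup>* `` {j x} = j ` (\<G>\<^sup>* `` {x})" if x: "x \<in> space M" for x
    proof (intro equalityI subsetI)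
      fix z assume "z \<in> \<G>'\<^sup>* `` {j x}"
      then have "(j x, z) \<in> \<G>'\<^sup>*" by simp
      then have "\<exists>y\<in>space M. z = j y \<and> (x, y) \<in> \<G>\<^sup>*"
      proof (induction rule: rtrancl_induct)
        case base
        then show ?case using x by blast
      next
        case (step u v)
        then obtain y where y: "y \<in> space M" "u = j y" "(x, y) \<in> \<G>\<^sup>*" by blast
        have "v \<in> \<G>' `` {j y}" using step.hyps(2) y(2) by simp
        then have "v \<in> j ` (\<G> `` {y})"
          unfolding \<G>'_def im[OF sub y(1)] .
        then obtain w where "v = j w" "(y, w) \<in> \<G>" by blast
        then show ?case using y sub by (blast intro: rtrancl_into_rtrancl)
      qed
      then show "z \<in> j ` (\<G>\<^sup>* `` {x})" by blast
    next
      fix z assume "z \<in> j ` (\<G>\<^sup>* `` {x})"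
      then obtain y where y: "z = j y" "(x, y) \<in> \<G>\<^sup>*" by blast
      from y(2) have "(j x, j y) \<in> \<G>'\<^sup>*"
      proof (induction rule: rtrancl_induct)
        case (step u v)
        then have "(j u, j v) \<in> \<G>'" using map_prod_imageI[of u v \<G> j j] by (simp add: \<G>'_def)
        with step show ?case by (blast intro: rtrancl_into_rtrancl)
      qed simp
      then show "z \<in> \<G>'\<^sup>* `` {j x}" using y by simp
    qed
    show "AE x in M. \<G>'\<^sup>* `` {j x} = (map_prod j j ` E) `` {j x}"
      using \<G>(4) by (rule AE_mp, intro AE_I2 impI) (simp add: comp im[OF E])
  qed
  ultimately have "graphing ?N (map_prod j j ` E) \<G>'"
    using meas by (simp add: graphing_def borel_graph_def)
  then have "cost ?N (map_prod j j ` E) \<le> (1/2) * (\<integral>\<^sup>+ y. vertex_degree \<G>' y \<partial>?N)"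
    unfolding cost_def by (intro INF_lower) simp
  also have "\<dots> \<le> (1/2) * (\<integral>\<^sup>+ x. vertex_degree \<G> x \<partial>M)"
  proof (intro mult_left_mono nn_integral_embed_measure_le[OF inj])
    fix x assume x: "x \<in> space M"
    have "inj_on j (\<G> `` {x})" using inj sub by (auto intro: inj_on_subset)
    then show "vertex_degree \<G>' (j x) \<le> vertex_degree \<G> x"
      unfolding vertex_degree_def \<G>'_def im[OF sub x]
      by (simp add: emeasure_count_space card_image finite_image_iff)
  qed simp
  finally show "cost ?N (map_prod j j ` E) \<le> (1/2) * (\<integral>\<^sup>+ x. vertex_degree \<G> x \<partial>M)" .
qed

lemma group_cost_le_cost:
  fixes G :: "('g, 'n) monoid_scheme" and M :: "'x measure"
  assumes M: "standard_prob_space M" and act: "pmp_action G M \<alpha>" and free: "free_action G M \<alpha>"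
  shows "group_cost G \<le> cost M (orbit_rel G M \<alpha>)"
proof -
  interpret prob_space M using M by (simp add: standard_prob_space_def)
  interpret \<alpha>: group_action G "space M" \<alpha> using act by (simp add: pmp_action_def)
  have G: "group G" using \<alpha>.group_hom by (simp add: group_hom_def)
  interpret G: group G by fact
  obtain T where T: "topspace T = space M" "completely_metrizable_space T" "second_countable T"
    using M unfolding standard_prob_space_def standard_borel_def by metis
  have "Hausdorff_space T"
    using T(2) completely_metrizable_imp_metrizable_space metrizable_imp_Hausdorff_space by blast
  then obtain j :: "'x \<Rightarrow> real" where inj: "inj_on j (space M)"
    using second_countable_Hausdorff_embeds_real[OF T(3)] T(1) by metis
  let ?N = "embed_measure M j"
  define i where "i = the_inv_into (space M) j"
  have i [simp]: "i (j x) = x" if "x \<in> space M" for x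
    using that inj by (simp add: i_def the_inv_into_f_f)
  have \<alpha>_closed [simp]: "\<alpha> g x \<in> space M" if "g \<in> carrier G" "x \<in> space M" for g x
    using \<alpha>.element_image that by blast
  have \<alpha>_one: "\<alpha> \<one>\<^bsub>G\<^esub> x = x" if "x \<in> space M" for x
    using that \<alpha>.id_eq_one[symmetric] by simp
  define \<beta> where "\<beta> = (\<lambda>g. restrict (\<lambda>y. j (\<alpha> g (i y))) (j ` space M))"
  have \<beta> [simp]: "\<beta> g (j x) = j (\<alpha> g x)" if "x \<in> space M" for g x
    using that by (simp add: \<beta>_def)
  have j_meas: "j \<in> M \<rightarrow>\<^sub>M ?N" by (rule measurable_embed_measure2'[OF inj])
  have N: "distr M ?N j = ?N" by (rule embed_measure_eq_distr'[OF inj, symmetric])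
  have "prob_space ?N"
    using prob_space_distr[OF j_meas] N by simp
  then have sN: "standard_prob_space ?N"
    using M standard_borel_embed_measure[OF inj] by (simp add: standard_prob_space_def)
  have aN: "pmp_action G ?N \<beta>"
    unfolding pmp_action_def
  proof (intro conjI ballI)
    show "group_action G (space ?N) \<beta>"
      by (rule group_actionI)
        (auto simp: space_embed_measure G \<alpha>_one \<alpha>.composition_rule, simp add: \<beta>_def)
    fix g assume g: "g \<in> carrier G"
    have \<alpha>_meas: "\<alpha> g \<in> M \<rightarrow>\<^sub>M M" and \<alpha>_distr: "distr M M (\<alpha> g) = M"
      using act g by (auto simp: pmp_action_def)
    have "(\<lambda>x. j (\<alpha> g x)) \<in> M \<rightarrow>\<^sub>M ?N"
      by (rule measurable_compose[OF \<alpha>_meas j_meas])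
    then have "(\<lambda>x. \<beta> g (j x)) \<in> M \<rightarrow>\<^sub>M ?N"
      by (simp cong: measurable_cong)
    then show \<beta>_meas: "\<beta> g \<in> ?N \<rightarrow>\<^sub>M ?N" by (rule measurable_embed_measure1)
    have "distr ?N ?N (\<beta> g) = distr (distr M ?N j) ?N (\<beta> g)" by (simp add: N)
    also have "\<dots> = distr M ?N (\<beta> g \<circ> j)" by (rule distr_distr[OF \<beta>_meas j_meas])
    also have "\<dots> = distr M ?N (j \<circ> \<alpha> g)" by (rule distr_cong) auto
    also have "\<dots> = distr (distr M M (\<alpha> g)) ?N j"
      by (rule distr_distr[OF j_meas \<alpha>_meas, symmetric])
    finally show "distr ?N ?N (\<beta> g) = ?N" by (simp add: \<alpha>_distr N)
  qed
  have fN: "free_action G ?N \<beta>"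
    unfolding free_action_def
  proof (rule AE_embed_measure[OF inj])
    show "AE x in M. \<forall>g\<in>carrier G - {\<one>\<^bsub>G\<^esub>}. \<beta> g (j x) \<noteq> j x"
      using free unfolding free_action_def
      by (rule AE_mp, intro AE_I2 impI) (use inj in \<open>auto dest: inj_onD\<close>)
  qed
  have orb: "orbit_rel G ?N \<beta> = map_prod j j ` orbit_rel G M \<alpha>"
  proof (intro equalityI subsetI)
    fix p assume "p \<in> orbit_rel G ?N \<beta>"
    then obtain x g where "x \<in> space M" "g \<in> carrier G" "p = (j x, \<beta> g (j x))"
      by (auto simp: orbit_rel_def orbit_def space_embed_measure)
    moreover then have "(x, \<alpha> g x) \<in> orbit_rel G M \<alpha>"
      by (auto simp: orbit_rel_def orbit_def)
    ultimately show "p \<in> map_prod j j ` orbit_rel G M \<alpha>"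
      using map_prod_imageI[of x "\<alpha> g x" _ j j] by simp
  next
    fix p assume "p \<in> map_prod j j ` orbit_rel G M \<alpha>"
    then obtain x g where p: "x \<in> space M" "g \<in> carrier G" "p = (j x, j (\<alpha> g x))"
      by (auto simp: orbit_rel_def orbit_def)
    then have "p = (j x, \<beta> g (j x))" by simp
    then show "p \<in> orbit_rel G ?N \<beta>"
      using p(1,2) unfolding orbit_rel_def orbit_def space_embed_measure by blast
  qed
  have "group_cost G \<le> cost ?N (orbit_rel G ?N \<beta>)"
    unfolding group_cost_def
    using sN aN fN by (intro INF_lower2[where i = "(?N, \<beta>)"]) auto
  also have "\<dots> \<le> cost M (orbit_rel G M \<alpha>)"
    unfolding orb by (rule cost_embed_measure_le[OF inj]) (auto simp: orbit_rel_def orbit_def)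
  finally show ?thesis .
qed

end

theory Submission
  imports Defs
begin

text \<open>
  Put \<open>p = 1 - \<epsilon>\<^sup>2 / 2\<close> and let \<open>n\<close> be the number of elements of \<open>Q\<close>. The proof works with the Bernoulli
  shift, in which all points of an orbit carry independent labels, uniform on the unit interval.
  It builds a subequivalence relation \<open>F\<close> of the orbit relation such that \<open>x\<close> and \<open>\<gamma>x\<close> are equivalent
  with probability more than \<open>p\<close>, for every \<open>\<gamma>\<close> in \<open>Q\<close>; then property (T) shows that \<open>F\<close> is, on
  a part of the space, of finite index, and a modification of \<open>F\<close> of about the same cost is the
  whole orbit relation.

  \<^emph>\<open>Finite index.\<close> The group acts on the pairs of a point and an \<open>F\<close>-class in its orbit by moving
  the point and keeping the class. On the Hilbert space of square integrable functions of such
  pairs consider the indicator function of the set of pairs whose point lies in their class. It is a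
  unit vector that every element of \<open>Q\<close> moves by less than \<open>\<epsilon>\<close>, because its scalar product with its
  translate is the probability above. A superlevel set of the modulus of an invariant vector is an
  invariant set of pairs of finite positive measure. It yields a set \<open>B\<close>, a union of \<open>F\<close>-classes,
  such that the mean number of \<open>F\<close>-classes of \<open>B\<close> in an orbit is positive and finite
  (\<open>kazhdan_finite_index\<close>).

  \<^emph>\<open>The relation \<open>F\<close>.\<close> Every point \<open>x\<close> sends an arc to the neighbour in the Cayley graph that has the
  largest label, if this label exceeds that of \<open>x\<close>, and otherwise to some point of the orbit with
  a larger label. One arc per point costs \<open>1\<close> (\<open>cost_le_arcs\<close>). By exchangeability of the labels, the edge between
  \<open>x\<close> and \<open>\<gamma>x\<close> is among these arcs with probability at least \<open>2 / (2 n + 1)\<close>, for \<open>\<gamma> \<noteq> 1\<close> in \<open>Q\<close>.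
  Adding arcs from \<open>x\<close> to \<open>\<gamma>x\<close> for a set of points \<open>x\<close> whose measure exceeds \<open>p - 2 / (2 n + 1)\<close>
  at most slightly brings the probability above \<open>p\<close>.

  \<^emph>\<open>From \<open>F\<close> to the orbit relation.\<close> Almost every orbit meets \<open>B\<close> by ergodicity (\<open>ergodic_shift\<close>). A point outside \<open>B\<close>
  can exchange its arc for one that leads to \<open>B\<close>. It remains to join the finitely many classes
  in \<open>B\<close>, which is done by arcs that start at a set of points meeting every class. From every
  point an arc leads to a larger label, so no class has a point of maximal label. Therefore the
  points whose label is within \<open>1 / (j + 1)\<close> of the supremum of their class form such sets, and
  these decrease to a null set as \<open>j\<close> grows; the joining arcs are negligible for large \<open>j\<close>
  (\<open>group_cost_le_of_finite_index\<close>). Hence the cost is at most \<open>1 + n (p - 2 / (2 n + 1))\<close>.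

  \<^emph>\<open>The constant.\<close> For \<open>n \<ge> 2\<close> this is at most \<open>n p + (n - 1) / (2 n - 1)\<close>. That \<open>n \<ge> 2\<close> and that
  \<open>p \<ge> 2 / (2 n + 1)\<close> follow from property (T) for the translation action of the infinite group on itself,
  which has no nonempty finite set that is almost invariant under \<open>Q\<close>
  (\<open>kazhdan_boundary\<close>).
\<close>

section \<open>The Hilbert space of square integrable functions\<close>

definition square_integrable :: "'z measure \<Rightarrow> ('z \<Rightarrow> complex) set" where
  "square_integrable N = {f \<in> borel_measurable N. integrable N (\<lambda>z. (cmod (f z))\<^sup>2)}"

lemma square_integrableD [dest]:
  assumes "f \<in> square_integrable N"
  shows "f \<in> borel_measurable N" "integrable N (\<lambda>z. (cmod (f z))\<^sup>2)"
  using assms by (auto simp: square_integrable_def)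

lemma square_integrable_add:
  assumes f: "f \<in> square_integrable N" and g: "g \<in> square_integrable N"
  shows "(\<lambda>z. f z + g z) \<in> square_integrable N"
proof -
  note [measurable] = square_integrableD(1)[OF f] square_integrableD(1)[OF g]
  have "integrable N (\<lambda>z. 2 * (cmod (f z))\<^sup>2 + 2 * (cmod (g z))\<^sup>2)"
    using square_integrableD(2)[OF f] square_integrableD(2)[OF g] by simp
  moreover have "(cmod (f z + g z))\<^sup>2 \<le> 2 * (cmod (f z))\<^sup>2 + 2 * (cmod (g z))\<^sup>2" for z
  proof -
    have "(cmod (f z + g z))\<^sup>2 \<le> (cmod (f z) + cmod (g z))\<^sup>2"
      by (intro power_mono norm_triangle_ineq) simp
    also have "\<dots> \<le> 2 * (cmod (f z))\<^sup>2 + 2 * (cmod (g z))\<^sup>2"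
      using sum_squares_bound[of "cmod (f z)" "cmod (g z)"] by (simp add: power2_sum)
    finally show ?thesis .
  qed
  ultimately have "integrable N (\<lambda>z. (cmod (f z + g z))\<^sup>2)"
    by - (rule Bochner_Integration.integrable_bound, assumption, auto)
  then show ?thesis by (simp add: square_integrable_def)
qed

lemma square_integrable_cmult:
  assumes f: "f \<in> square_integrable N"
  shows "(\<lambda>z. c * f z) \<in> square_integrable N"
  using square_integrableD[OF f] by (auto simp: square_integrable_def norm_mult power_mult_distrib)

lemma square_integrable_uminus:
  assumes f: "f \<in> square_integrable N"
  shows "(\<lambda>z. - f z) \<in> square_integrable N"
  using square_integrable_cmult[OF f, of "-1"] by simp

lemma square_integrable_diff:
  assumes f: "f \<in> square_integrable N" and g: "g \<in> square_integrable N"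
  shows "(\<lambda>z. f z - g z) \<in> square_integrable N"
  using square_integrable_add[OF f square_integrable_uminus[OF g]] by simp

lemma square_integrable_zero: "(\<lambda>_. 0) \<in> square_integrable N"
  by (simp add: square_integrable_def)

lemma borel_measurable_cnj [measurable (raw)]:
  "f \<in> borel_measurable N \<Longrightarrow> (\<lambda>z. cnj (f z)) \<in> borel_measurable N"
  by (rule measurable_compose[OF _ borel_measurable_continuous_onI]) (simp_all add: continuous_on_cnj)

lemma integrable_mult_cnj:
  assumes f: "f \<in> square_integrable N" and g: "g \<in> square_integrable N"
  shows "integrable N (\<lambda>z. f z * cnj (g z))"
proof -
  note [measurable] = square_integrableD(1)[OF f] square_integrableD(1)[OF g]
  have "integrable N (\<lambda>z. (cmod (f z))\<^sup>2 + (cmod (g z))\<^sup>2)"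
    using square_integrableD(2)[OF f] square_integrableD(2)[OF g] by simp
  moreover have "cmod (f z * cnj (g z)) \<le> (cmod (f z))\<^sup>2 + (cmod (g z))\<^sup>2" for z
    using sum_squares_bound[of "cmod (f z)" "cmod (g z)"] mult_nonneg_nonneg[of "cmod (f z)" "cmod (g z)"]
    by (simp add: norm_mult del: zero_le_mult_iff mult_nonneg_nonneg)
  ultimately show ?thesis
    by - (rule Bochner_Integration.integrable_bound, assumption, auto)
qed

text \<open>
  Riesz--Fischer. Along a subsequence with \<open>\<parallel>s\<^sub>k\<^sub>+\<^sub>1 - s\<^sub>k\<parallel>\<^sup>2 < 4\<^sup>-\<^sup>k\<close> the sum of the functions
  \<open>2\<^sup>k \<bar>s\<^sub>k\<^sub>+\<^sub>1 - s\<^sub>k\<bar>\<^sup>2\<close> has finite integral, so almost everywhere the increments decay geometrically and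
  the subsequence converges. The limit is also the limit in norm by Fatou's lemma.
\<close>

lemma square_integrable_complete:
  assumes s: "\<And>n. s n \<in> square_integrable N"
    and cauchy: "\<And>e. e > 0 \<Longrightarrow> \<exists>n0. \<forall>m\<ge>n0. \<forall>n\<ge>n0. (\<integral>z. (cmod (s m z - s n z))\<^sup>2 \<partial>N) < e"
  obtains f where "f \<in> square_integrable N" "(\<lambda>n. \<integral>z. (cmod (s n z - f z))\<^sup>2 \<partial>N) \<longlonglongrightarrow> 0"
proof -
  have [measurable]: "s n \<in> borel_measurable N" for n using s by auto
  have sd: "integrable N (\<lambda>z. (cmod (s m z - s n z))\<^sup>2)" for m n
    using square_integrable_diff[OF s s] by auto
  have nn: "(\<integral>\<^sup>+z. ennreal ((cmod (s m z - s n z))\<^sup>2) \<partial>N) = ennreal (\<integral>z. (cmod (s m z - s n z))\<^sup>2 \<partial>N)" for m n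
    by (rule nn_integral_eq_integral[OF sd]) auto
  have "\<exists>n0. \<forall>m\<ge>n0. \<forall>n\<ge>n0. (\<integral>z. (cmod (s m z - s n z))\<^sup>2 \<partial>N) < (1/4)^k" for k
    by (rule cauchy) simp
  then obtain n0 where n0: "\<And>k m n. \<lbrakk>m \<ge> n0 k; n \<ge> n0 k\<rbrakk> \<Longrightarrow> (\<integral>z. (cmod (s m z - s n z))\<^sup>2 \<partial>N) < (1/4)^k"
    by metis
  \<comment> \<open>at least \<open>n0 k\<close> at both \<open>k\<close> and \<open>Suc k\<close>, and tending to infinity\<close>
  define r where "r = (\<lambda>k. k + (\<Sum>j\<le>k. n0 j))"
  have r: "n0 k \<le> r k" "n0 k \<le> r (Suc k)" "k \<le> r k" for k
  proof -
    have "n0 k \<le> (\<Sum>j\<le>k. n0 j)" by (rule member_le_sum) auto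
    then show "n0 k \<le> r k" "n0 k \<le> r (Suc k)" "k \<le> r k" by (auto simp: r_def)
  qed
  define d where "d = (\<lambda>k z. 2^k * (cmod (s (r (Suc k)) z - s (r k) z))\<^sup>2)"
  have d_nn: "(\<integral>\<^sup>+z. ennreal (d k z) \<partial>N) \<le> ennreal ((1/2)^k)" for k
  proof -
    have "(\<integral>\<^sup>+z. ennreal (d k z) \<partial>N)
        = ennreal (2^k) * (\<integral>\<^sup>+z. ennreal ((cmod (s (r (Suc k)) z - s (r k) z))\<^sup>2) \<partial>N)"
      unfolding d_def by (subst nn_integral_cmult[symmetric]) (auto simp: ennreal_mult)
    also have "\<dots> \<le> ennreal (2^k) * ennreal ((1/4)^k)"
      unfolding nn using n0[OF r(2) r(1), of k]
      by (intro mult_left_mono ennreal_leI) auto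
    also have "\<dots> = ennreal ((1/2)^k)"
      by (simp add: ennreal_mult[symmetric] power_mult_distrib[symmetric])
    finally show ?thesis .
  qed
  have "(\<integral>\<^sup>+z. (\<Sum>k. ennreal (d k z)) \<partial>N) = (\<Sum>k. \<integral>\<^sup>+z. ennreal (d k z) \<partial>N)"
    by (rule nn_integral_suminf) (simp add: d_def)
  also have "\<dots> \<le> (\<Sum>k. ennreal ((1/2)^k))"
    by (intro suminf_le d_nn) auto
  also have "\<dots> = ennreal (\<Sum>k. (1/2)^k)"
    by (intro suminf_ennreal2 summable_geometric) auto
  finally have "(\<integral>\<^sup>+z. (\<Sum>k. ennreal (d k z)) \<partial>N) \<noteq> \<infinity>"
    by (auto simp: top_unique)
  then have "AE z in N. (\<Sum>k. ennreal (d k z)) \<noteq> \<infinity>"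
    by (intro nn_integral_noteq_infinite) (auto simp: d_def)
  then have conv: "AE z in N. convergent (\<lambda>k. s (r k) z)"
  proof eventually_elim
    case (elim z)
    have "summable (\<lambda>k. d k z)"
      by (rule summable_suminf_not_top) (use elim in \<open>auto simp: d_def\<close>)
    then have "(\<lambda>k. d k z) \<longlonglongrightarrow> 0" by (rule summable_LIMSEQ_zero)
    then have "eventually (\<lambda>k. d k z < 1) sequentially"
      by (rule order_tendstoD) simp
    then have "eventually (\<lambda>k. norm (s (r (Suc k)) z - s (r k) z) \<le> (sqrt (1/2))^k) sequentially"
    proof eventually_elim
      case (elim k)
      have "(cmod (s (r (Suc k)) z - s (r k) z))\<^sup>2 \<le> (1/2)^k"
        using elim by (simp add: d_def field_simps)
      also have "(1/2::real)^k = ((sqrt (1/2))^k)\<^sup>2"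
        by (simp add: power2_eq_square flip: power_mult_distrib)
      finally show ?case by (rule power2_le_imp_le) simp
    qed
    then have "summable (\<lambda>k. s (r (Suc k)) z - s (r k) z)"
      by (rule summable_comparison_test_ev) (auto intro!: summable_geometric simp: real_sqrt_divide)
    then have "convergent (\<lambda>n. \<Sum>k<n. s (r (Suc k)) z - s (r k) z)"
      by (simp add: summable_iff_convergent)
    then show ?case
      using sum_lessThan_telescope[of "\<lambda>k. s (r k) z"] by (simp add: convergent_diff_const_right_iff)
  qed
  define f where "f = (\<lambda>z. lim (\<lambda>k. s (r k) z))"
  have [measurable]: "f \<in> borel_measurable N" unfolding f_def by measurable
  have lim: "AE z in N. (\<lambda>k. s (r k) z) \<longlonglongrightarrow> f z"
    using conv by eventually_elim (simp add: f_def convergent_LIMSEQ_iff)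
  have bound: "\<exists>n1. \<forall>n\<ge>n1. (\<integral>\<^sup>+z. ennreal ((cmod (s n z - f z))\<^sup>2) \<partial>N) \<le> ennreal e" if e: "e > 0" for e
  proof -
    obtain n1 where n1: "\<And>m n. \<lbrakk>m \<ge> n1; n \<ge> n1\<rbrakk> \<Longrightarrow> (\<integral>z. (cmod (s m z - s n z))\<^sup>2 \<partial>N) < e"
      using cauchy[OF e] by auto
    have "(\<integral>\<^sup>+z. ennreal ((cmod (s n z - f z))\<^sup>2) \<partial>N) \<le> ennreal e" if n: "n \<ge> n1" for n
    proof -
      have "(\<integral>\<^sup>+z. ennreal ((cmod (s n z - f z))\<^sup>2) \<partial>N)
          \<le> (\<integral>\<^sup>+z. liminf (\<lambda>k. ennreal ((cmod (s n z - s (r k) z))\<^sup>2)) \<partial>N)"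
      proof (rule nn_integral_mono_AE)
        show "AE z in N. ennreal ((cmod (s n z - f z))\<^sup>2) \<le> liminf (\<lambda>k. ennreal ((cmod (s n z - s (r k) z))\<^sup>2))"
          using lim
        proof eventually_elim
          case (elim z)
          have "(\<lambda>k. ennreal ((cmod (s n z - s (r k) z))\<^sup>2)) \<longlonglongrightarrow> ennreal ((cmod (s n z - f z))\<^sup>2)"
            by (intro tendsto_ennrealI tendsto_intros elim)
          then show ?case by (simp add: lim_imp_Liminf del: ennreal_le_iff tendsto_ennreal_iff)
        qed
      qed
      also have "\<dots> \<le> liminf (\<lambda>k. \<integral>\<^sup>+z. ennreal ((cmod (s n z - s (r k) z))\<^sup>2) \<partial>N)"
        by (rule nn_integral_liminf) simp
      also have "\<dots> \<le> liminf (\<lambda>k. ennreal e)"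
      proof (rule Liminf_mono)
        show "eventually (\<lambda>k. (\<integral>\<^sup>+z. ennreal ((cmod (s n z - s (r k) z))\<^sup>2) \<partial>N) \<le> ennreal e) sequentially"
          unfolding nn using eventually_ge_at_top[of n1]
        proof eventually_elim
          case (elim k)
          then have "n1 \<le> r k" using r(3)[of k] by simp
          from n1[OF n this] show ?case by (intro ennreal_leI) simp
        qed
      qed
      finally show ?thesis by (simp add: Liminf_const)
    qed
    then show ?thesis by blast
  qed
  have f_sq: "f \<in> square_integrable N"
  proof -
    obtain n where n: "(\<integral>\<^sup>+z. ennreal ((cmod (s n z - f z))\<^sup>2) \<partial>N) \<le> ennreal 1"
      using bound[of 1] by auto
    then have "(\<integral>\<^sup>+z. ennreal ((cmod (s n z - f z))\<^sup>2) \<partial>N) < \<infinity>"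
      by (rule order.strict_trans1) simp
    then have "(\<lambda>z. s n z - f z) \<in> square_integrable N"
      by (auto simp: square_integrable_def intro!: integrableI_bounded)
    from square_integrable_diff[OF s[of n] this] show ?thesis by simp
  qed
  have "(\<lambda>n. \<integral>z. (cmod (s n z - f z))\<^sup>2 \<partial>N) \<longlonglongrightarrow> 0"
  proof (rule LIMSEQ_I)
    fix e :: real assume e: "0 < e"
    obtain n1 where n1: "\<And>n. n \<ge> n1 \<Longrightarrow> (\<integral>\<^sup>+z. ennreal ((cmod (s n z - f z))\<^sup>2) \<partial>N) \<le> ennreal (e/2)"
      using bound[of "e/2"] e by auto
    have "norm ((\<integral>z. (cmod (s n z - f z))\<^sup>2 \<partial>N) - 0) < e" if n: "n \<ge> n1" for n
    proof -
      have "integrable N (\<lambda>z. (cmod (s n z - f z))\<^sup>2)"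
        using square_integrable_diff[OF s f_sq] by auto
      then have "ennreal (\<integral>z. (cmod (s n z - f z))\<^sup>2 \<partial>N) \<le> ennreal (e/2)"
        using n1[OF n] by (subst (asm) nn_integral_eq_integral) auto
      then have "(\<integral>z. (cmod (s n z - f z))\<^sup>2 \<partial>N) \<le> e/2"
        using e by (simp add: ennreal_le_iff)
      moreover have "0 \<le> (\<integral>z. (cmod (s n z - f z))\<^sup>2 \<partial>N)" by simp
      ultimately show ?thesis using e by simp
    qed
    then show "\<exists>no. \<forall>n\<ge>no. norm ((\<integral>z. (cmod (s n z - f z))\<^sup>2 \<partial>N) - 0) < e" by blast
  qed
  with f_sq show thesis by (rule that)
qed

text \<open>
  The elements of the Hilbert space are functions rather than classes of functions: one
  representative is chosen from every class modulo equality almost everywhere. Sums and multiples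
  are computed pointwise and then replaced by the chosen representatives.
\<close>

definition L2_rep :: "'z measure \<Rightarrow> ('z \<Rightarrow> complex) \<Rightarrow> 'z \<Rightarrow> complex" where
  "L2_rep N f = (SOME h. h \<in> square_integrable N \<and> (AE z in N. h z = f z))"

definition L2 :: "'z measure \<Rightarrow> ('z \<Rightarrow> complex) inner_module" where
  "L2 N = \<lparr>carrier = L2_rep N ` square_integrable N,
     monoid.mult = (\<lambda>_ _. undefined), one = undefined,
     zero = L2_rep N (\<lambda>_. 0), add = (\<lambda>f g. L2_rep N (\<lambda>z. f z + g z)),
     module.smult = (\<lambda>c f. L2_rep N (\<lambda>z. c * f z)),
     sprod = (\<lambda>f g. \<integral>z. f z * cnj (g z) \<partial>N)\<rparr>"

lemma L2_simps:
  "carrier (L2 N) = L2_rep N ` square_integrable N"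
  "\<zero>\<^bsub>L2 N\<^esub> = L2_rep N (\<lambda>_. 0)"
  "f \<oplus>\<^bsub>L2 N\<^esub> g = L2_rep N (\<lambda>z. f z + g z)"
  "c \<odot>\<^bsub>L2 N\<^esub> f = L2_rep N (\<lambda>z. c * f z)"
  "sprod (L2 N) f g = (\<integral>z. f z * cnj (g z) \<partial>N)"
  by (simp_all add: L2_def)

lemma L2_rep:
  assumes "f \<in> square_integrable N"
  shows "L2_rep N f \<in> square_integrable N" "AE z in N. L2_rep N f z = f z"
proof -
  have "L2_rep N f \<in> square_integrable N \<and> (AE z in N. L2_rep N f z = f z)"
    unfolding L2_rep_def by (rule someI[of _ f]) (use assms in auto)
  then show "L2_rep N f \<in> square_integrable N" "AE z in N. L2_rep N f z = f z" by auto
qed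

lemma L2_rep_cong:
  assumes "AE z in N. f z = g z"
  shows "L2_rep N f = L2_rep N g"
proof -
  have "(AE z in N. h z = f z) \<longleftrightarrow> (AE z in N. h z = g z)" for h
    using assms by (intro iffI; elim AE_mp; intro AE_I2 impI; simp)
  then show ?thesis by (simp add: L2_rep_def)
qed

lemma L2_carrierD:
  assumes "f \<in> carrier (L2 N)"
  shows "f \<in> square_integrable N" "L2_rep N f = f"
proof -
  obtain g where g: "g \<in> square_integrable N" "f = L2_rep N g" using assms by (auto simp: L2_simps)
  then show "f \<in> square_integrable N" using L2_rep by auto
  show "L2_rep N f = f" using L2_rep_cong[OF L2_rep(2)[OF g(1)]] g(2) by simp
qed

lemma L2_carrierI: "f \<in> square_integrable N \<Longrightarrow> L2_rep N f \<in> carrier (L2 N)"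
  by (simp add: L2_simps)

lemma abelian_group_L2: "abelian_group (L2 N)"
proof (rule abelian_groupI)
  fix x y assume xy: "x \<in> carrier (L2 N)" "y \<in> carrier (L2 N)"
  show "x \<oplus>\<^bsub>L2 N\<^esub> y \<in> carrier (L2 N)"
    unfolding L2_simps(3) by (intro L2_carrierI square_integrable_add L2_carrierD(1) xy)
  show "x \<oplus>\<^bsub>L2 N\<^esub> y = y \<oplus>\<^bsub>L2 N\<^esub> x"
    by (simp add: L2_simps add.commute)
next
  fix x y z assume xyz: "x \<in> carrier (L2 N)" "y \<in> carrier (L2 N)" "z \<in> carrier (L2 N)"
  have "AE a in N. L2_rep N (\<lambda>z. x z + y z) a = x a + y a" "AE a in N. L2_rep N (\<lambda>a. y a + z a) a = y a + z a"
    by (intro L2_rep(2) square_integrable_add L2_carrierD(1) xyz)+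
  then have "AE a in N. L2_rep N (\<lambda>a. x a + y a) a + z a = x a + L2_rep N (\<lambda>a. y a + z a) a"
    by eventually_elim simp
  then show "x \<oplus>\<^bsub>L2 N\<^esub> y \<oplus>\<^bsub>L2 N\<^esub> z = x \<oplus>\<^bsub>L2 N\<^esub> (y \<oplus>\<^bsub>L2 N\<^esub> z)"
    unfolding L2_simps(3) by (rule L2_rep_cong)
next
  show "\<zero>\<^bsub>L2 N\<^esub> \<in> carrier (L2 N)"
    unfolding L2_simps(2) by (intro L2_carrierI square_integrable_zero)
next
  fix x assume x: "x \<in> carrier (L2 N)"
  have "AE a in N. L2_rep N (\<lambda>_. 0) a = 0" by (rule L2_rep[OF square_integrable_zero])
  then have "L2_rep N (\<lambda>a. L2_rep N (\<lambda>_. 0) a + x a) = L2_rep N x"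
    by (intro L2_rep_cong) (elim AE_mp, intro AE_I2 impI, simp)
  then show "\<zero>\<^bsub>L2 N\<^esub> \<oplus>\<^bsub>L2 N\<^esub> x = x" using L2_carrierD(2)[OF x] by (simp add: L2_simps)
  have m: "(\<lambda>z. - x z) \<in> square_integrable N" by (intro square_integrable_uminus L2_carrierD(1) x)
  show "\<exists>y\<in>carrier (L2 N). y \<oplus>\<^bsub>L2 N\<^esub> x = \<zero>\<^bsub>L2 N\<^esub>"
  proof (rule bexI)
    show "L2_rep N (\<lambda>z. - x z) \<oplus>\<^bsub>L2 N\<^esub> x = \<zero>\<^bsub>L2 N\<^esub>"
      unfolding L2_simps using L2_rep(2)[OF m] by (intro L2_rep_cong) (elim AE_mp, intro AE_I2 impI, simp)
  qed (rule L2_carrierI[OF m])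
qed

lemma L2_minus:
  assumes x: "x \<in> carrier (L2 N)" and y: "y \<in> carrier (L2 N)"
  shows "x \<ominus>\<^bsub>L2 N\<^esub> y = L2_rep N (\<lambda>z. x z - y z)"
proof -
  interpret abelian_group "L2 N" by (rule abelian_group_L2)
  have m: "(\<lambda>z. - y z) \<in> square_integrable N" by (intro square_integrable_uminus L2_carrierD(1) y)
  have "\<ominus>\<^bsub>L2 N\<^esub> y = L2_rep N (\<lambda>z. - y z)"
  proof (rule minus_equality)
    show "L2_rep N (\<lambda>z. - y z) \<oplus>\<^bsub>L2 N\<^esub> y = \<zero>\<^bsub>L2 N\<^esub>"
      unfolding L2_simps using L2_rep(2)[OF m] by (intro L2_rep_cong) (elim AE_mp, intro AE_I2 impI, simp)
  qed (use y L2_carrierI[OF m] in auto)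
  then have "x \<ominus>\<^bsub>L2 N\<^esub> y = L2_rep N (\<lambda>z. x z + L2_rep N (\<lambda>z. - y z) z)"
    by (simp add: a_minus_def L2_simps)
  also have "\<dots> = L2_rep N (\<lambda>z. x z - y z)"
    using L2_rep(2)[OF m] by (intro L2_rep_cong) (elim AE_mp, intro AE_I2 impI, simp)
  finally show ?thesis .
qed

lemma L2_norm: "(hnorm (L2 N) x) = sqrt (\<integral>z. (cmod (x z))\<^sup>2 \<partial>N)"
proof -
  have "(\<integral>z. x z * cnj (x z) \<partial>N) = (\<integral>z. of_real ((cmod (x z))\<^sup>2) \<partial>N)"
    by (simp add: complex_norm_square[symmetric] del: of_real_power)
  also have "\<dots> = of_real (\<integral>z. (cmod (x z))\<^sup>2 \<partial>N)" by (rule integral_complex_of_real)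
  finally show ?thesis by (simp add: hnorm_def L2_simps)
qed

lemma L2_norm_minus:
  assumes x: "x \<in> carrier (L2 N)" and y: "y \<in> carrier (L2 N)"
  shows "hnorm (L2 N) (x \<ominus>\<^bsub>L2 N\<^esub> y) = sqrt (\<integral>z. (cmod (x z - y z))\<^sup>2 \<partial>N)"
proof -
  have d: "(\<lambda>z. x z - y z) \<in> square_integrable N"
    by (intro square_integrable_diff L2_carrierD(1) x y)
  have [measurable]: "L2_rep N (\<lambda>z. x z - y z) \<in> borel_measurable N"
    "x \<in> borel_measurable N" "y \<in> borel_measurable N"
    using L2_rep(1)[OF d] L2_carrierD(1)[OF x] L2_carrierD(1)[OF y] by auto
  have "(\<integral>z. (cmod (L2_rep N (\<lambda>z. x z - y z) z))\<^sup>2 \<partial>N) = (\<integral>z. (cmod (x z - y z))\<^sup>2 \<partial>N)"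
    using L2_rep(2)[OF d] by (intro integral_cong_AE) (simp_all, elim AE_mp, intro AE_I2 impI, simp)
  then show ?thesis by (simp add: L2_norm L2_minus x y)
qed

lemma complex_hilbert_space_L2: "complex_hilbert_space (L2 N)"
proof -
  interpret abelian_group "L2 N" by (rule abelian_group_L2)
  have mod: "Module.module (ring_of_type_algebra :: complex ring) (L2 N)"
  proof (rule moduleI)
    show "cring (ring_of_type_algebra :: complex ring)"
      by (rule cring_from_type_algebra)
    show "abelian_group (L2 N)" by (rule abelian_group_L2)
  next
    fix a :: complex and x assume x: "x \<in> carrier (L2 N)"
    note sx = L2_carrierD(1)[OF x]
    show "a \<odot>\<^bsub>L2 N\<^esub> x \<in> carrier (L2 N)"
      unfolding L2_simps(4) by (intro L2_carrierI square_integrable_cmult sx)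
    show "\<one>\<^bsub>ring_of_type_algebra\<^esub> \<odot>\<^bsub>L2 N\<^esub> x = x"
      using L2_carrierD(2)[OF x] by (simp add: L2_simps ring_of_type_algebra_def)
    fix b :: complex
    show "(a \<oplus>\<^bsub>ring_of_type_algebra\<^esub> b) \<odot>\<^bsub>L2 N\<^esub> x = a \<odot>\<^bsub>L2 N\<^esub> x \<oplus>\<^bsub>L2 N\<^esub> b \<odot>\<^bsub>L2 N\<^esub> x"
      unfolding L2_simps
      using L2_rep(2)[OF square_integrable_cmult[OF sx, of a]] L2_rep(2)[OF square_integrable_cmult[OF sx, of b]]
      by (intro L2_rep_cong) (elim AE_mp, intro AE_I2 impI, simp add: ring_of_type_algebra_def ring_distribs)
    show "(a \<otimes>\<^bsub>ring_of_type_algebra\<^esub> b) \<odot>\<^bsub>L2 N\<^esub> x = a \<odot>\<^bsub>L2 N\<^esub> (b \<odot>\<^bsub>L2 N\<^esub> x)"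
      unfolding L2_simps
      using L2_rep(2)[OF square_integrable_cmult[OF sx, of b]]
      by (intro L2_rep_cong) (elim AE_mp, intro AE_I2 impI, simp add: ring_of_type_algebra_def)
    fix y assume y: "y \<in> carrier (L2 N)"
    note sy = L2_carrierD(1)[OF y]
    show "a \<odot>\<^bsub>L2 N\<^esub> (x \<oplus>\<^bsub>L2 N\<^esub> y) = a \<odot>\<^bsub>L2 N\<^esub> x \<oplus>\<^bsub>L2 N\<^esub> a \<odot>\<^bsub>L2 N\<^esub> y"
      unfolding L2_simps
      using L2_rep(2)[OF square_integrable_cmult[OF sx, of a]] L2_rep(2)[OF square_integrable_cmult[OF sy, of a]]
        L2_rep(2)[OF square_integrable_add[OF sx sy]]
      by (intro L2_rep_cong) (elim AE_mp, intro AE_I2 impI, simp add: ring_distribs)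
  qed
  show ?thesis
  proof (intro complex_hilbert_space.intro mod complex_hilbert_space_axioms.intro)
    fix x y assume x: "x \<in> carrier (L2 N)" and y: "y \<in> carrier (L2 N)"
    note sx = L2_carrierD(1)[OF x] and sy = L2_carrierD(1)[OF y]
    have [measurable]: "x \<in> borel_measurable N" "y \<in> borel_measurable N" using sx sy by auto
    show "sprod (L2 N) (c \<odot>\<^bsub>L2 N\<^esub> x) y = c * sprod (L2 N) x y" for c
    proof -
      have m: "(\<lambda>z. c * x z) \<in> square_integrable N" by (rule square_integrable_cmult[OF sx])
      have [measurable]: "L2_rep N (\<lambda>z. c * x z) \<in> borel_measurable N" using L2_rep[OF m] by auto
      have "(\<integral>z. L2_rep N (\<lambda>z. c * x z) z * cnj (y z) \<partial>N) = (\<integral>z. c * (x z * cnj (y z)) \<partial>N)"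
        using L2_rep(2)[OF m] by (intro integral_cong_AE) (simp_all, elim AE_mp, intro AE_I2 impI, simp)
      then show ?thesis by (simp add: L2_simps)
    qed
    show "sprod (L2 N) y x = cnj (sprod (L2 N) x y)"
      unfolding L2_simps
      using Bochner_Integration.integral_cnj[of N "\<lambda>z. x z * cnj (y z)"] by (simp add: mult.commute)
    fix z assume z: "z \<in> carrier (L2 N)"
    note sz = L2_carrierD(1)[OF z]
    have [measurable]: "z \<in> borel_measurable N" using sz by auto
    show "sprod (L2 N) (x \<oplus>\<^bsub>L2 N\<^esub> y) z = sprod (L2 N) x z + sprod (L2 N) y z"
    proof -
      have m: "(\<lambda>z. x z + y z) \<in> square_integrable N" by (rule square_integrable_add[OF sx sy])
      have [measurable]: "L2_rep N (\<lambda>z. x z + y z) \<in> borel_measurable N" using L2_rep[OF m] by auto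
      have "(\<integral>a. L2_rep N (\<lambda>z. x z + y z) a * cnj (z a) \<partial>N) = (\<integral>a. x a * cnj (z a) + y a * cnj (z a) \<partial>N)"
        using L2_rep(2)[OF m] by (intro integral_cong_AE) (simp_all, elim AE_mp, intro AE_I2 impI, simp add: ring_distribs)
      also have "\<dots> = (\<integral>a. x a * cnj (z a) \<partial>N) + (\<integral>a. y a * cnj (z a) \<partial>N)"
        by (intro Bochner_Integration.integral_add integrable_mult_cnj sx sy sz)
      finally show ?thesis by (simp add: L2_simps)
    qed
  next
    fix x assume x: "x \<in> carrier (L2 N)"
    note sx = L2_carrierD(1)[OF x]
    have eq: "sprod (L2 N) x x = of_real (\<integral>z. (cmod (x z))\<^sup>2 \<partial>N)"
    proof -
      have "(\<integral>z. x z * cnj (x z) \<partial>N) = (\<integral>z. of_real ((cmod (x z))\<^sup>2) \<partial>N)"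
        by (simp add: complex_norm_square[symmetric] del: of_real_power)
      also have "\<dots> = of_real (\<integral>z. (cmod (x z))\<^sup>2 \<partial>N)" by (rule integral_complex_of_real)
      finally show ?thesis by (simp add: L2_simps)
    qed
    then show "0 \<le> Re (sprod (L2 N) x x)" by simp
    assume "sprod (L2 N) x x = 0"
    then have "(\<integral>z. (cmod (x z))\<^sup>2 \<partial>N) = 0" unfolding eq by simp
    then have "AE z in N. (cmod (x z))\<^sup>2 = 0"
      using square_integrableD(2)[OF sx] by (subst (asm) integral_nonneg_eq_0_iff_AE) auto
    then have "AE z in N. x z = 0" by eventually_elim simp
    then have "L2_rep N x = L2_rep N (\<lambda>_. 0)" by (rule L2_rep_cong)
    then show "x = \<zero>\<^bsub>L2 N\<^esub>" using L2_carrierD(2)[OF x] by (simp add: L2_simps)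
  next
    fix s :: "nat \<Rightarrow> 'a \<Rightarrow> complex"
    assume s: "range s \<subseteq> carrier (L2 N)"
      and cau: "\<forall>e>0. \<exists>n0. \<forall>m\<ge>n0. \<forall>n\<ge>n0. hnorm (L2 N) (s m \<ominus>\<^bsub>L2 N\<^esub> s n) < e"
    have sc: "s n \<in> carrier (L2 N)" for n using s by auto
    have cau2: "\<exists>n0. \<forall>m\<ge>n0. \<forall>n\<ge>n0. (\<integral>z. (cmod (s m z - s n z))\<^sup>2 \<partial>N) < e" if e: "e > 0" for e
    proof -
      obtain n0 where "\<forall>m\<ge>n0. \<forall>n\<ge>n0. hnorm (L2 N) (s m \<ominus>\<^bsub>L2 N\<^esub> s n) < sqrt e"
        using cau[rule_format, of "sqrt e"] e by auto
      then show ?thesis by (auto simp: L2_norm_minus sc)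
    qed
    obtain f where f: "f \<in> square_integrable N" "(\<lambda>n. \<integral>z. (cmod (s n z - f z))\<^sup>2 \<partial>N) \<longlonglongrightarrow> 0"
      by (rule square_integrable_complete[of s N]) (use L2_carrierD(1)[OF sc] cau2 in auto)
    have fc: "L2_rep N f \<in> carrier (L2 N)" by (rule L2_carrierI[OF f(1)])
    have "hnorm (L2 N) (s n \<ominus>\<^bsub>L2 N\<^esub> L2_rep N f) = sqrt (\<integral>z. (cmod (s n z - f z))\<^sup>2 \<partial>N)" for n
    proof -
      have [measurable]: "s n \<in> borel_measurable N" "f \<in> borel_measurable N" "L2_rep N f \<in> borel_measurable N"
        using L2_carrierD(1)[OF sc[of n]] f(1) L2_rep(1)[OF f(1)] by auto
      have "(\<integral>z. (cmod (s n z - L2_rep N f z))\<^sup>2 \<partial>N) = (\<integral>z. (cmod (s n z - f z))\<^sup>2 \<partial>N)"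
        using L2_rep(2)[OF f(1)] by (intro integral_cong_AE) (simp_all, elim AE_mp, intro AE_I2 impI, simp)
      then show ?thesis by (simp add: L2_norm_minus sc fc)
    qed
    moreover have "(\<lambda>n. sqrt (\<integral>z. (cmod (s n z - f z))\<^sup>2 \<partial>N)) \<longlonglongrightarrow> sqrt 0"
      by (rule tendsto_real_sqrt[OF f(2)])
    ultimately have "(\<lambda>n. hnorm (L2 N) (s n \<ominus>\<^bsub>L2 N\<^esub> L2_rep N f)) \<longlonglongrightarrow> 0" by simp
    with fc show "\<exists>x\<in>carrier (L2 N). (\<lambda>n. hnorm (L2 N) (s n \<ominus>\<^bsub>L2 N\<^esub> x)) \<longlonglongrightarrow> 0" by blast
  qed
qed

section \<open>Koopman representations and invariant sets\<close>

locale measure_preserving_action = group_action G "space N" \<beta>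
  for G :: "('g, 'n) monoid_scheme" (structure) and N :: "'z measure" and \<beta> :: "'g \<Rightarrow> 'z \<Rightarrow> 'z" +
  assumes countable_carrier: "countable (carrier G)"
    and measurable_action: "g \<in> carrier G \<Longrightarrow> \<beta> g \<in> N \<rightarrow>\<^sub>M N"
    and distr_action: "g \<in> carrier G \<Longrightarrow> distr N N (\<beta> g) = N"
begin

lemma group_G: "group G"
  using group_hom by (simp add: group_hom_def)

lemma action_closed [simp]: "g \<in> carrier G \<Longrightarrow> z \<in> space N \<Longrightarrow> \<beta> g z \<in> space N"
  using element_image by blast

lemma action_one [simp]: "z \<in> space N \<Longrightarrow> \<beta> \<one> z = z"
  using id_eq_one[symmetric] by simp

lemma action_inv [simp]:
  assumes "g \<in> carrier G" "z \<in> space N"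
  shows "\<beta> g (\<beta> (inv g) z) = z" "\<beta> (inv g) (\<beta> g z) = z"
proof -
  interpret group G by (rule group_G)
  show "\<beta> g (\<beta> (inv g) z) = z" "\<beta> (inv g) (\<beta> g z) = z"
    using assms composition_rule[of z g "inv g"] composition_rule[of z "inv g" g] by auto
qed

lemma AE_action:
  assumes g: "g \<in> carrier G" and P: "AE z in N. P z"
  shows "AE z in N. P (\<beta> g z)"
proof -
  have "AE z in distr N N (\<beta> g). P z" unfolding distr_action[OF g] by (rule P)
  then show ?thesis by (rule AE_distrD[OF measurable_action[OF g]])
qed

lemma emeasure_action:
  assumes g: "g \<in> carrier G" and A: "A \<in> sets N"
  shows "emeasure N (\<beta> g -` A \<inter> space N) = emeasure N A"
  using emeasure_distr[OF measurable_action[OF g] A] by (simp add: distr_action g)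

lemma integral_action:
  fixes f :: "'z \<Rightarrow> 'b :: {banach, second_countable_topology}"
  assumes g: "g \<in> carrier G" and f: "f \<in> borel_measurable N"
  shows "(\<integral>z. f (\<beta> g z) \<partial>N) = (\<integral>z. f z \<partial>N)"
  using integral_distr[OF measurable_action[OF g] f] by (simp add: distr_action g)

lemma square_integrable_action:
  assumes g: "g \<in> carrier G" and f: "f \<in> square_integrable N"
  shows "(\<lambda>z. f (\<beta> g z)) \<in> square_integrable N"
proof -
  note [measurable] = square_integrableD(1)[OF f] measurable_action[OF g]
  have "integrable (distr N N (\<beta> g)) (\<lambda>z. (cmod (f z))\<^sup>2)"
    using f by (auto simp: distr_action g)
  then have "integrable N (\<lambda>z. (cmod (f (\<beta> g z)))\<^sup>2)"
    by (subst (asm) integrable_distr_eq) auto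
  then show ?thesis by (simp add: square_integrable_def)
qed

definition koopman :: "'g \<Rightarrow> ('z \<Rightarrow> complex) \<Rightarrow> 'z \<Rightarrow> complex" where
  "koopman g = restrict (\<lambda>f. L2_rep N (\<lambda>z. f (\<beta> (inv g) z))) (carrier (L2 N))"

lemma koopman:
  assumes g: "g \<in> carrier G" and f: "f \<in> carrier (L2 N)"
  shows "koopman g f \<in> carrier (L2 N)" "AE z in N. koopman g f z = f (\<beta> (inv g) z)"
proof -
  interpret group G by (rule group_G)
  have *: "(\<lambda>z. f (\<beta> (inv g) z)) \<in> square_integrable N"
    by (rule square_integrable_action[OF _ L2_carrierD(1)[OF f]]) (use g in simp)
  show "koopman g f \<in> carrier (L2 N)" "AE z in N. koopman g f z = f (\<beta> (inv g) z)"
    using L2_carrierI[OF *] L2_rep(2)[OF *] f by (simp_all add: koopman_def)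
qed

lemma unitary_rep_koopman: "unitary_rep G (L2 N) koopman"
  unfolding unitary_rep_def
proof (intro conjI ballI allI)
  interpret group G by (rule group_G)
  show "group_action G (carrier (L2 N)) koopman"
  proof (rule group_actionI)
    show "group G" by (rule group_G)
    show "koopman g \<in> extensional (carrier (L2 N))" for g by (simp add: koopman_def)
    show "koopman g f \<in> carrier (L2 N)" if "g \<in> carrier G" "f \<in> carrier (L2 N)" for g f
      using koopman(1) that .
    show "koopman \<one> f = f" if f: "f \<in> carrier (L2 N)" for f
    proof -
      have "L2_rep N (\<lambda>z. f (\<beta> (inv \<one>) z)) = L2_rep N f"
        by (intro L2_rep_cong AE_I2) simp
      then show ?thesis using L2_carrierD(2)[OF f] f by (simp add: koopman_def)
    qed
    fix g h f assume g: "g \<in> carrier G" and h: "h \<in> carrier G" and f: "f \<in> carrier (L2 N)"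
    have "AE z in N. koopman h f (\<beta> (inv g) z) = f (\<beta> (inv h) (\<beta> (inv g) z))"
      using AE_action[OF _ koopman(2)[OF h f], of "inv g"] g by simp
    then have "L2_rep N (\<lambda>z. koopman h f (\<beta> (inv g) z)) = L2_rep N (\<lambda>z. f (\<beta> (inv (g \<otimes> h)) z))"
      using g h by (intro L2_rep_cong) (elim AE_mp, intro AE_I2 impI, simp add: inv_mult_group composition_rule)
    then show "koopman (g \<otimes> h) f = koopman g (koopman h f)"
      using f koopman(1)[OF h f] by (simp add: koopman_def)
  qed
  fix g x y assume g: "g \<in> carrier G" and x: "x \<in> carrier (L2 N)" and y: "y \<in> carrier (L2 N)"
  note sx = L2_carrierD(1)[OF x] and sy = L2_carrierD(1)[OF y]
  have ig: "inv g \<in> carrier G" using g by simp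
  note [measurable] = square_integrableD(1)[OF sx] square_integrableD(1)[OF sy]
    square_integrableD(1)[OF L2_carrierD(1)[OF koopman(1)[OF g x]]]
    square_integrableD(1)[OF L2_carrierD(1)[OF koopman(1)[OF g y]]]
    measurable_action[OF ig]
  have s: "(\<lambda>z. x z + y z) \<in> square_integrable N" by (rule square_integrable_add[OF sx sy])
  have "AE z in N. L2_rep N (\<lambda>z. x z + y z) (\<beta> (inv g) z) = x (\<beta> (inv g) z) + y (\<beta> (inv g) z)"
    by (rule AE_action[OF ig L2_rep(2)[OF s]])
  then have "L2_rep N (\<lambda>z. L2_rep N (\<lambda>z. x z + y z) (\<beta> (inv g) z)) = L2_rep N (\<lambda>z. koopman g x z + koopman g y z)"
    using koopman(2)[OF g x] koopman(2)[OF g y]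
    by (intro L2_rep_cong) (elim AE_mp, intro AE_I2 impI, simp)
  then show "koopman g (x \<oplus>\<^bsub>L2 N\<^esub> y) = koopman g x \<oplus>\<^bsub>L2 N\<^esub> koopman g y"
    using L2_carrierI[OF s] by (simp add: koopman_def L2_simps x y)
  show "koopman g (c \<odot>\<^bsub>L2 N\<^esub> x) = c \<odot>\<^bsub>L2 N\<^esub> koopman g x" for c
  proof -
    have c: "(\<lambda>z. c * x z) \<in> square_integrable N" by (rule square_integrable_cmult[OF sx])
    have "AE z in N. L2_rep N (\<lambda>z. c * x z) (\<beta> (inv g) z) = c * x (\<beta> (inv g) z)"
      by (rule AE_action[OF ig L2_rep(2)[OF c]])
    then have "L2_rep N (\<lambda>z. L2_rep N (\<lambda>z. c * x z) (\<beta> (inv g) z)) = L2_rep N (\<lambda>z. c * koopman g x z)"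
      using koopman(2)[OF g x] by (intro L2_rep_cong) (elim AE_mp, intro AE_I2 impI, simp)
    then show ?thesis
      using L2_carrierI[OF c] by (simp add: koopman_def L2_simps x)
  qed
  have "(\<integral>z. koopman g x z * cnj (koopman g y z) \<partial>N)
      = (\<integral>z. x (\<beta> (inv g) z) * cnj (y (\<beta> (inv g) z)) \<partial>N)"
    using koopman(2)[OF g x] koopman(2)[OF g y]
    by (intro integral_cong_AE) (simp_all, elim AE_mp, intro AE_I2 impI, simp)
  also have "\<dots> = (\<integral>z. x z * cnj (y z) \<partial>N)"
    by (rule integral_action[OF ig]) simp
  finally show "sprod (L2 N) (koopman g x) (koopman g y) = sprod (L2 N) x y"
    by (simp add: L2_simps)
qed

text \<open>
  The indicator function of \<open>A\<close> is moved by less than \<open>\<epsilon>\<close> times its norm, as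
  \<open>\<parallel>\<gamma> 1\<^sub>A - 1\<^sub>A\<parallel>\<^sup>2 = 2 (\<mu>(A) - \<mu>(A \<inter> \<gamma> A))\<close>. The set \<open>D\<close> is a superlevel set of the squared modulus of
  an invariant vector. It has finite measure by Markov's inequality. Invariant vectors are
  invariant only almost everywhere; requiring the level to be exceeded on the whole orbit makes
  \<open>D\<close> invariant everywhere, which costs a null set as the group is countable.
\<close>

theorem kazhdan_invariant_set:
  assumes kp: "kazhdan_pair G Q \<epsilon>"
    and A: "A \<in> sets N" "emeasure N A < \<infinity>" "0 < measure N A"
    and almost: "\<And>g. g \<in> Q \<Longrightarrow> (1 - \<epsilon>\<^sup>2 / 2) * measure N A < measure N (A \<inter> (\<beta> (inv g) -` A \<inter> space N))"
  obtains D where "D \<in> sets N" "0 < emeasure N D" "emeasure N D < \<infinity>"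
    "\<And>g z. \<lbrakk>g \<in> carrier G; z \<in> space N\<rbrakk> \<Longrightarrow> \<beta> g z \<in> D \<longleftrightarrow> z \<in> D"
proof -
  interpret group G by (rule group_G)
  have Q: "Q \<subseteq> carrier G" "0 < \<epsilon>" using kp by (auto simp: kazhdan_pair_def)
  define a where "a = (indicator A :: 'z \<Rightarrow> complex)"
  have [measurable]: "A \<in> sets N" by (rule A)
  have sa: "a \<in> square_integrable N"
  proof -
    have "(\<lambda>z. (cmod (a z))\<^sup>2) = indicator A" by (auto simp: a_def indicator_def)
    then show ?thesis using A by (auto simp: square_integrable_def a_def)
  qed
  define \<xi> where "\<xi> = L2_rep N a"
  have \<xi>: "\<xi> \<in> carrier (L2 N)" "AE z in N. \<xi> z = a z"
    using L2_carrierI[OF sa] L2_rep(2)[OF sa] by (auto simp: \<xi>_def)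
  note [measurable] = square_integrableD(1)[OF L2_carrierD(1)[OF \<xi>(1)]] square_integrableD(1)[OF sa]
  have norm_\<xi>: "hnorm (L2 N) \<xi> = sqrt (measure N A)"
  proof -
    have "(\<integral>z. (cmod (\<xi> z))\<^sup>2 \<partial>N) = (\<integral>z. indicator A z \<partial>N)"
      using \<xi>(2) by (intro integral_cong_AE) (simp_all, elim AE_mp, intro AE_I2 impI, simp add: a_def indicator_def)
    then show ?thesis by (simp add: L2_norm Int_absorb2 sets.sets_into_space[OF A(1)])
  qed
  have "\<exists>\<eta>\<in>carrier (L2 N). \<eta> \<noteq> \<zero>\<^bsub>L2 N\<^esub> \<and> (\<forall>g\<in>carrier G. koopman g \<eta> = \<eta>)"
  proof (rule kazhdan_pair_all_hilbert_spaces[OF group_G kp complex_hilbert_space_L2 unitary_rep_koopman,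
        unfolded almost_invariant_imp_invariant_def, rule_format])
    show "\<exists>\<xi>\<in>carrier (L2 N). \<forall>g\<in>Q. hnorm (L2 N) (koopman g \<xi> \<ominus>\<^bsub>L2 N\<^esub> \<xi>) < \<epsilon> * hnorm (L2 N) \<xi>"
    proof (intro bexI[OF _ \<xi>(1)] ballI)
      fix g assume gQ: "g \<in> Q"
      then have g: "g \<in> carrier G" and ig: "inv g \<in> carrier G" using Q by auto
      note [measurable] = square_integrableD(1)[OF L2_carrierD(1)[OF koopman(1)[OF g \<xi>(1)]]] measurable_action[OF ig]
      define A' where "A' = \<beta> (inv g) -` A \<inter> space N"
      have A': "A' \<in> sets N" "emeasure N A' = emeasure N A"
        using measurable_sets[OF measurable_action[OF ig] A(1)] emeasure_action[OF ig A(1)] by (auto simp: A'_def)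
      have fin: "integrable N (indicator A :: 'z \<Rightarrow> real)" "integrable N (indicator A' :: 'z \<Rightarrow> real)"
        "integrable N (indicator (A \<inter> A') :: 'z \<Rightarrow> real)"
        using A A' emeasure_mono[of "A \<inter> A'" A N] by (auto intro: integrable_real_indicator order.strict_trans1)
      have "(\<integral>z. (cmod (koopman g \<xi> z - \<xi> z))\<^sup>2 \<partial>N)
          = (\<integral>z. indicator A z + indicator A' z - 2 * indicator (A \<inter> A') z \<partial>N)"
      proof (rule integral_cong_AE)
        show "AE z in N. (cmod (koopman g \<xi> z - \<xi> z))\<^sup>2 = indicator A z + indicator A' z - 2 * indicator (A \<inter> A') z"
          using koopman(2)[OF g \<xi>(1)] \<xi>(2) AE_action[OF ig \<xi>(2)] AE_space
          by eventually_elim (auto simp: a_def A'_def indicator_def)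
      qed (use A' in auto)
      also have "\<dots> = measure N A + measure N A' - 2 * measure N (A \<inter> A')"
        using fin A A' by (simp add: Int_absorb2 sets.sets_into_space)
      also have "\<dots> = 2 * (measure N A - measure N (A \<inter> A'))"
        using A'(2) by (simp add: measure_def)
      also have "\<dots> < \<epsilon>\<^sup>2 * measure N A"
        using almost[OF gQ] by (simp add: A'_def algebra_simps)
      finally have "hnorm (L2 N) (koopman g \<xi> \<ominus>\<^bsub>L2 N\<^esub> \<xi>) < sqrt (\<epsilon>\<^sup>2 * measure N A)"
        by (simp add: L2_norm_minus koopman(1) g \<xi>)
      then show "hnorm (L2 N) (koopman g \<xi> \<ominus>\<^bsub>L2 N\<^esub> \<xi>) < \<epsilon> * hnorm (L2 N) \<xi>"
        using Q(2) by (simp add: norm_\<xi> real_sqrt_mult)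
    qed
  qed
  then obtain \<eta> where \<eta>: "\<eta> \<in> carrier (L2 N)" "\<eta> \<noteq> \<zero>\<^bsub>L2 N\<^esub>" "\<And>g. g \<in> carrier G \<Longrightarrow> koopman g \<eta> = \<eta>"
    by blast
  define h where "h = (\<lambda>z. (cmod (\<eta> z))\<^sup>2)"
  have h_int: "integrable N h" using L2_carrierD(1)[OF \<eta>(1)] by (auto simp: h_def)
  have [measurable]: "h \<in> borel_measurable N" using h_int by auto
  have h_inv: "AE z in N. \<forall>g\<in>carrier G. h (\<beta> g z) = h z"
  proof (subst AE_ball_countable[OF countable_carrier], intro ballI)
    fix g assume g: "g \<in> carrier G"
    show "AE z in N. h (\<beta> g z) = h z"
      using koopman(2)[of "inv g", OF _ \<eta>(1)] g \<eta>(3)[of "inv g"] by (auto simp: h_def elim!: AE_mp)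
  qed
  have "\<not> (AE z in N. h z = 0)"
  proof
    assume "AE z in N. h z = 0"
    then have "AE z in N. \<eta> z = 0" by eventually_elim (simp add: h_def)
    then have "L2_rep N \<eta> = L2_rep N (\<lambda>_. 0)" by (rule L2_rep_cong)
    then show False
      using L2_carrierD(2)[OF \<eta>(1)] \<eta>(2) by (simp add: L2_simps)
  qed
  have "\<exists>n::nat. \<not> (AE z in N. h z \<le> 1 / real (Suc n))"
  proof (rule ccontr)
    assume "\<nexists>n::nat. \<not> (AE z in N. h z \<le> 1 / real (Suc n))"
    then have "AE z in N. \<forall>n::nat. h z \<le> 1 / real (Suc n)" by (simp add: AE_all_countable)
    then have "AE z in N. h z = 0"
    proof eventually_elim
      case (elim z)
      have "h z \<le> 0"
      proof (rule ccontr)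
        assume "\<not> h z \<le> 0"
        then obtain n where "1 / real (Suc n) < h z" using nat_approx_posE[of "h z"] by auto
        with elim show False by (meson not_le)
      qed
      then show ?case by (simp add: h_def)
    qed
    with \<open>\<not> (AE z in N. h z = 0)\<close> show False by blast
  qed
  then obtain c where c: "0 < c" "\<not> (AE z in N. h z \<le> c)"
    by (metis of_nat_0_less_iff zero_less_Suc zero_less_divide_1_iff)
  define D where "D = {z \<in> space N. \<forall>g\<in>carrier G. c < h (\<beta> g z)}"
  have D_meas: "D \<in> sets N"
  proof -
    have "{z \<in> space N. c < h (\<beta> g z)} \<in> sets N" if "g \<in> carrier G" for g
      using measurable_action[OF that] by measurable
    then show ?thesis unfolding D_def
      by (intro sets.sets_Collect_countable_All'[OF _ countable_carrier])
  qed
  have D_eq: "AE z in N. z \<in> D \<longleftrightarrow> c < h z"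
    using h_inv AE_space by eventually_elim (use one_closed in \<open>auto simp: D_def\<close>)
  have "emeasure N D > 0"
  proof (rule ccontr)
    assume "\<not> emeasure N D > 0"
    then have "AE z in N. z \<notin> D" using D_meas by (intro AE_not_in) (auto simp: null_sets_def)
    with D_eq have "AE z in N. h z \<le> c" by eventually_elim auto
    with c show False by blast
  qed
  moreover have "emeasure N D < \<infinity>"
  proof -
    have "emeasure N D = emeasure N {z \<in> space N. c < h z}"
      using D_eq D_meas by (intro emeasure_eq_AE) (auto elim!: AE_mp)
    also have "\<dots> \<le> emeasure N {z \<in> space N. 1 \<le> ennreal (1/c) * ennreal (h z)}"
    proof (rule emeasure_mono)
      show "{z \<in> space N. c < h z} \<subseteq> {z \<in> space N. 1 \<le> ennreal (1/c) * ennreal (h z)}"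
      proof safe
        fix z assume "c < h z"
        then have "ennreal 1 \<le> ennreal (1/c * h z)" using c by (intro ennreal_leI) (simp add: field_simps)
        moreover have "ennreal (1/c * h z) = ennreal (1/c) * ennreal (h z)"
          using c by (intro ennreal_mult') simp
        ultimately show "1 \<le> ennreal (1/c) * ennreal (h z)" by (simp only: ennreal_1)
      qed
    qed measurable
    also have "\<dots> \<le> ennreal (1/c) * (\<integral>\<^sup>+z. ennreal (h z) * indicator (space N) z \<partial>N)"
      using nn_integral_Markov_inequality[of "\<lambda>z. ennreal (h z)" "space N" N "ennreal (1/c)"] by simp
    also have "\<dots> = ennreal (1/c) * ennreal (\<integral>z. h z \<partial>N)"
      by (subst nn_integral_eq_integral[OF h_int, symmetric])
        (auto simp: h_def intro!: arg_cong2[where f = times] nn_integral_cong)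
    also have "\<dots> < \<infinity>" by (simp add: ennreal_mult_less_top)
    finally show ?thesis .
  qed
  moreover have "\<beta> g z \<in> D \<longleftrightarrow> z \<in> D" if g: "g \<in> carrier G" and z: "z \<in> space N" for g z
  proof -
    have "(\<forall>k\<in>carrier G. c < h (\<beta> k (\<beta> g z))) \<longleftrightarrow> (\<forall>k\<in>carrier G. c < h (\<beta> k z))"
    proof
      assume *: "\<forall>k\<in>carrier G. c < h (\<beta> k (\<beta> g z))"
      show "\<forall>k\<in>carrier G. c < h (\<beta> k z)"
      proof
        fix k assume k: "k \<in> carrier G"
        then have "c < h (\<beta> (k \<otimes> inv g) (\<beta> g z))" using * g by auto
        then show "c < h (\<beta> k z)" using g k z by (simp add: composition_rule)
      qed
    next
      assume *: "\<forall>k\<in>carrier G. c < h (\<beta> k z)"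
      show "\<forall>k\<in>carrier G. c < h (\<beta> k (\<beta> g z))"
      proof
        fix k assume k: "k \<in> carrier G"
        then have "c < h (\<beta> (k \<otimes> g) z)" using * g by auto
        then show "c < h (\<beta> k (\<beta> g z))" using g k z by (simp add: composition_rule)
      qed
    qed
    then show ?thesis using g z by (simp add: D_def)
  qed
  ultimately show thesis using D_meas that by blast
qed

end

section \<open>Equivariant random equivalence relations of finite index\<close>

lemma emeasure_count_space_subset:
  "A \<subseteq> B \<Longrightarrow> emeasure (count_space B) A = emeasure (count_space UNIV) A"
  by (simp add: emeasure_count_space)

text \<open>
  A subequivalence relation of the orbit relation, pulled back along the orbit maps: \<open>(g, h) \<in> F x\<close>
  means that \<open>g x\<close> and \<open>h x\<close> are equivalent. The point \<open>g x\<close> of the orbit of \<open>k x\<close> is reached by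
  \<open>g k\<^sup>-\<^sup>1\<close>, whence the form of equivariance. Pulling the relation back to the group avoids choosing,
  in a measurable way, a group element that leads from one point of the orbit to another.
\<close>

locale random_equivalence = measure_preserving_action G M \<alpha> + prob_space M
  for G :: "('g, 'n) monoid_scheme" (structure) and M :: "'x measure" and \<alpha> :: "'g \<Rightarrow> 'x \<Rightarrow> 'x" +
  fixes F :: "'x \<Rightarrow> 'g rel"
  assumes F_equiv: "x \<in> space M \<Longrightarrow> equiv (carrier G) (F x)"
    and F_measurable: "\<lbrakk>g \<in> carrier G; h \<in> carrier G\<rbrakk> \<Longrightarrow> {x \<in> space M. (g, h) \<in> F x} \<in> sets M"
    and F_equivariant: "\<lbrakk>k \<in> carrier G; g \<in> carrier G; h \<in> carrier G; x \<in> space M\<rbrakk>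
      \<Longrightarrow> (g, h) \<in> F (\<alpha> k x) \<longleftrightarrow> (g \<otimes> k, h \<otimes> k) \<in> F x"
begin

sublocale group G by (rule group_G)

lemma F_carrier:
  assumes "x \<in> space M" "(g, h) \<in> F x"
  shows "g \<in> carrier G \<and> h \<in> carrier G"
  using equiv_type[OF F_equiv[OF assms(1)]] assms(2) by blast

lemma F_refl: "x \<in> space M \<Longrightarrow> g \<in> carrier G \<Longrightarrow> (g, g) \<in> F x"
  by (meson F_equiv equivE refl_onD)

lemma F_sym: "x \<in> space M \<Longrightarrow> (g, h) \<in> F x \<Longrightarrow> (h, g) \<in> F x"
  by (meson F_equiv equivE symD)

lemma F_trans: "x \<in> space M \<Longrightarrow> (g, h) \<in> F x \<Longrightarrow> (h, k) \<in> F x \<Longrightarrow> (g, k) \<in> F x"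
  by (meson F_equiv equivE transD)

text \<open>
  One element of each class, the first in an enumeration of the group. Sums over classes are
  written as sums over these elements.
\<close>

definition reps :: "'x \<Rightarrow> 'g set" where
  "reps x = {g \<in> carrier G. \<forall>h\<in>carrier G. (g, h) \<in> F x \<longrightarrow> to_nat_on (carrier G) g \<le> to_nat_on (carrier G) h}"

lemma reps_carrier: "g \<in> reps x \<Longrightarrow> g \<in> carrier G"
  by (simp add: reps_def)

lemma ex1_rep:
  assumes x: "x \<in> space M" and g: "g \<in> carrier G"
  shows "\<exists>!k. k \<in> reps x \<and> (g, k) \<in> F x"
proof (rule ex_ex1I)
  define n where "n = (LEAST n. \<exists>k. (g, k) \<in> F x \<and> to_nat_on (carrier G) k = n)"
  have "\<exists>n k. (g, k) \<in> F x \<and> to_nat_on (carrier G) k = n" using F_refl[OF x g] by blast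
  from LeastI_ex[OF this] obtain k where k: "(g, k) \<in> F x" "to_nat_on (carrier G) k = n"
    unfolding n_def by blast
  have "k \<in> reps x"
    unfolding reps_def
  proof (intro CollectI conjI ballI impI)
    show "k \<in> carrier G" using F_carrier[OF x k(1)] by simp
    fix h assume "(k, h) \<in> F x"
    then have "(g, h) \<in> F x" using F_trans[OF x k(1)] by blast
    then show "to_nat_on (carrier G) k \<le> to_nat_on (carrier G) h"
      unfolding k(2) n_def by (intro Least_le) blast
  qed
  with k show "\<exists>k. k \<in> reps x \<and> (g, k) \<in> F x" by blast
next
  fix k l assume k: "k \<in> reps x \<and> (g, k) \<in> F x" and l: "l \<in> reps x \<and> (g, l) \<in> F x"
  then have "(k, l) \<in> F x" using F_trans[OF x F_sym[OF x, of g k]] by simp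
  moreover from this have "(l, k) \<in> F x" by (rule F_sym[OF x])
  ultimately have "to_nat_on (carrier G) k = to_nat_on (carrier G) l"
    using k l by (intro antisym) (simp_all add: reps_def)
  then show "k = l"
    using inj_onD[OF inj_on_to_nat_on[OF countable_carrier]] k l reps_carrier by metis
qed

definition rep :: "'x \<Rightarrow> 'g \<Rightarrow> 'g" where
  "rep x g = (THE k. k \<in> reps x \<and> (g, k) \<in> F x)"

lemma rep:
  assumes "x \<in> space M" "g \<in> carrier G"
  shows "rep x g \<in> reps x" "(g, rep x g) \<in> F x"
  using theI'[OF ex1_rep[OF assms]] by (simp_all add: rep_def)

lemma rep_unique:
  assumes "x \<in> space M" "(g, k) \<in> F x" "k \<in> reps x"
  shows "rep x g = k"
  unfolding rep_def using F_carrier[OF assms(1,2)] assms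
  by (intro the1_equality ex1_rep) simp_all

lemma reps_measurable:
  assumes g: "g \<in> carrier G"
  shows "{x \<in> space M. g \<in> reps x} \<in> sets M"
proof -
  have "{x \<in> space M. \<forall>h\<in>carrier G. (g, h) \<in> F x \<longrightarrow> to_nat_on (carrier G) g \<le> to_nat_on (carrier G) h} \<in> sets M"
    using g F_measurable countable_carrier
    by (intro sets.sets_Collect_countable_All' sets.sets_Collect_imp sets.sets_Collect_const) auto
  then show ?thesis using g by (simp add: reps_def)
qed

text \<open>
  The pairs of a point \<open>x\<close> and a class of \<open>F x\<close> are not formed explicitly. A set of such pairs is
  encoded as a set of pairs \<open>(x, g)\<close> that depends only on the class of \<open>g\<close>, and its measure is the
  mean number of classes of \<open>F x\<close> in it. This gives the measure space \<open>class_space\<close> below, in which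
  each class is counted through its element in \<open>reps\<close>.
\<close>

definition orbit_space :: "('x \<times> 'g) measure" where
  "orbit_space = M \<Otimes>\<^sub>M count_space (carrier G)"

lemma space_orbit_space: "space orbit_space = space M \<times> carrier G"
  by (simp add: orbit_space_def space_pair_measure)

lemma sets_orbit_space_Collect:
  assumes "\<And>g. g \<in> carrier G \<Longrightarrow> {x \<in> space M. P x g} \<in> sets M"
  shows "{(x, g). x \<in> space M \<and> g \<in> carrier G \<and> P x g} \<in> sets orbit_space"
proof -
  have "(\<Union>g\<in>carrier G. {x \<in> space M. P x g} \<times> {g}) \<in> sets orbit_space"
    unfolding orbit_space_def using countable_carrier assms
    by (intro sets.countable_UN' pair_measureI) auto
  also have "(\<Union>g\<in>carrier G. {x \<in> space M. P x g} \<times> {g}) = {(x, g). x \<in> space M \<and> g \<in> carrier G \<and> P x g}"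
    by auto
  finally show ?thesis .
qed

definition class_sets :: "('x \<times> 'g) set set" where
  "class_sets = {D \<in> sets orbit_space. \<forall>x\<in>space M. \<forall>g h. (g, h) \<in> F x \<longrightarrow> ((x, g) \<in> D \<longleftrightarrow> (x, h) \<in> D)}"

lemma class_setsI:
  assumes "\<And>g. g \<in> carrier G \<Longrightarrow> {x \<in> space M. P x g} \<in> sets M"
    and "\<And>x g h. \<lbrakk>x \<in> space M; (g, h) \<in> F x\<rbrakk> \<Longrightarrow> P x g \<longleftrightarrow> P x h"
  shows "{(x, g). x \<in> space M \<and> g \<in> carrier G \<and> P x g} \<in> class_sets"
  unfolding class_sets_def
proof (intro CollectI conjI ballI allI impI)
  fix x g h assume x: "x \<in> space M" and gh: "(g, h) \<in> F x"
  then show "(x, g) \<in> {(x, g). x \<in> space M \<and> g \<in> carrier G \<and> P x g}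
      \<longleftrightarrow> (x, h) \<in> {(x, g). x \<in> space M \<and> g \<in> carrier G \<and> P x g}"
    using F_carrier[OF x gh] assms(2)[OF x gh] by simp
qed (rule sets_orbit_space_Collect[OF assms(1)])

lemma sigma_algebra_class_sets: "sigma_algebra (space orbit_space) class_sets"
  unfolding sigma_algebra_iff2
proof (intro conjI ballI allI impI)
  show "class_sets \<subseteq> Pow (space orbit_space)"
    using sets.sets_into_space by (auto simp: class_sets_def)
  show "{} \<in> class_sets" by (simp add: class_sets_def)
  show "space orbit_space - D \<in> class_sets" if "D \<in> class_sets" for D
  proof -
    have "space orbit_space - D \<in> sets orbit_space"
      using that by (intro sets.compl_sets) (simp add: class_sets_def)
    then show ?thesis
      using that by (auto simp: class_sets_def space_orbit_space dest: F_carrier)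
  qed
  show "(\<Union>i. A i) \<in> class_sets" if A: "range A \<subseteq> class_sets" for A :: "nat \<Rightarrow> ('x \<times> 'g) set"
  proof -
    have Ai: "A i \<in> class_sets" for i using A by auto
    then have "A i \<in> sets orbit_space" for i by (simp add: class_sets_def)
    then have "(\<Union>i. A i) \<in> sets orbit_space" by blast
    moreover have "(x, g) \<in> A i \<longleftrightarrow> (x, h) \<in> A i" if "x \<in> space M" "(g, h) \<in> F x" for i x g h
      using Ai[of i] that by (simp add: class_sets_def)
    ultimately show ?thesis by (simp add: class_sets_def)
  qed
qed

definition class_space :: "('x \<times> 'g) measure" where
  "class_space = restr_to_subalg
     (density orbit_space (indicator {(x, g). x \<in> space M \<and> g \<in> carrier G \<and> g \<in> reps x}))
     (sigma (space orbit_space) class_sets)"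

lemma subalgebra_class_sets: "subalgebra (density orbit_space f) (sigma (space orbit_space) class_sets)"
proof -
  have "sets (sigma (space orbit_space) class_sets) = class_sets"
    by (rule sigma_algebra.sets_measure_of_eq[OF sigma_algebra_class_sets])
  moreover have "class_sets \<subseteq> sets orbit_space" by (auto simp: class_sets_def)
  ultimately show ?thesis by (simp add: subalgebra_def space_measure_of_conv)
qed

lemma space_class_space: "space class_space = space M \<times> carrier G"
  by (simp add: class_space_def space_restr_to_subalg space_orbit_space)

lemma sets_class_space: "sets class_space = class_sets"
  unfolding class_space_def sets_restr_to_subalg[OF subalgebra_class_sets]
  by (rule sigma_algebra.sets_measure_of_eq[OF sigma_algebra_class_sets])

lemma emeasure_class_space:
  assumes D: "D \<in> class_sets"
  shows "emeasure class_space D = (\<integral>\<^sup>+x. emeasure (count_space UNIV) {g \<in> reps x. (x, g) \<in> D} \<partial>M)"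
proof -
  define R where "R = {(x, g). x \<in> space M \<and> g \<in> carrier G \<and> g \<in> reps x}"
  have R: "R \<in> sets (M \<Otimes>\<^sub>M count_space (carrier G))"
    using sets_orbit_space_Collect[OF reps_measurable] by (simp add: R_def orbit_space_def)
  have D': "D \<in> sets (M \<Otimes>\<^sub>M count_space (carrier G))"
    using D by (simp add: class_sets_def orbit_space_def)
  note [measurable] = R D'
  interpret C: sigma_finite_measure "count_space (carrier G)"
    by (rule sigma_finite_measure_count_space_countable[OF countable_carrier])
  have "emeasure class_space D = emeasure (density orbit_space (indicator R)) D"
    unfolding class_space_def R_def
    by (rule emeasure_restr_to_subalg[OF subalgebra_class_sets])
      (use D sigma_algebra.sets_measure_of_eq[OF sigma_algebra_class_sets] in simp)
  also have "\<dots> = (\<integral>\<^sup>+z. indicator R z * indicator D z \<partial>orbit_space)"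
    by (rule emeasure_density) (simp_all add: orbit_space_def)
  also have "\<dots> = (\<integral>\<^sup>+x. \<integral>\<^sup>+g. indicator R (x, g) * indicator D (x, g) \<partial>count_space (carrier G) \<partial>M)"
    unfolding orbit_space_def by (rule C.nn_integral_fst[symmetric]) simp
  also have "\<dots> = (\<integral>\<^sup>+x. emeasure (count_space UNIV) {g \<in> reps x. (x, g) \<in> D} \<partial>M)"
  proof (rule nn_integral_cong)
    fix x assume x: "x \<in> space M"
    have "(\<integral>\<^sup>+g. indicator R (x, g) * indicator D (x, g) \<partial>count_space (carrier G))
        = (\<integral>\<^sup>+g. indicator {g \<in> reps x. (x, g) \<in> D} g \<partial>count_space (carrier G))"
      using x by (intro nn_integral_cong) (auto simp: R_def indicator_def)
    also have "\<dots> = emeasure (count_space (carrier G)) {g \<in> reps x. (x, g) \<in> D}"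
      by (rule nn_integral_indicator) (auto dest: reps_carrier)
    also have "\<dots> = emeasure (count_space UNIV) {g \<in> reps x. (x, g) \<in> D}"
      by (intro emeasure_count_space_subset) (auto dest: reps_carrier)
    finally show "(\<integral>\<^sup>+g. indicator R (x, g) * indicator D (x, g) \<partial>count_space (carrier G))
        = emeasure (count_space UNIV) {g \<in> reps x. (x, g) \<in> D}" .
  qed
  finally show ?thesis .
qed

lemma class_setsD:
  assumes "D \<in> class_sets" "x \<in> space M"
  shows "(g, h) \<in> F x \<Longrightarrow> (x, g) \<in> D \<longleftrightarrow> (x, h) \<in> D"
    and "g \<in> carrier G \<Longrightarrow> {x \<in> space M. (x, g) \<in> D} \<in> sets M"
proof -
  show "(g, h) \<in> F x \<Longrightarrow> (x, g) \<in> D \<longleftrightarrow> (x, h) \<in> D"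
    using assms by (auto simp: class_sets_def)
  assume g: "g \<in> carrier G"
  have "D \<in> sets (M \<Otimes>\<^sub>M count_space (carrier G))"
    using assms by (simp add: class_sets_def orbit_space_def)
  then have "(\<lambda>x. (x, g)) -` D \<inter> space M \<in> sets M"
    using g by (intro measurable_sets[OF measurable_Pair2'[of g "count_space (carrier G)"]]) auto
  also have "(\<lambda>x. (x, g)) -` D \<inter> space M = {x \<in> space M. (x, g) \<in> D}" by auto
  finally show "{x \<in> space M. (x, g) \<in> D} \<in> sets M" .
qed

text \<open>
  The point \<open>g x\<close> is equal to \<open>(g k\<^sup>-\<^sup>1) (k x)\<close>, so that this action moves \<open>x\<close> to \<open>k x\<close> and keeps the
  class.
\<close>

definition class_action :: "'g \<Rightarrow> 'x \<times> 'g \<Rightarrow> 'x \<times> 'g" where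
  "class_action k = restrict (\<lambda>(x, g). (\<alpha> k x, g \<otimes> inv k)) (space M \<times> carrier G)"

lemma class_action_simp [simp]:
  "x \<in> space M \<Longrightarrow> g \<in> carrier G \<Longrightarrow> class_action k (x, g) = (\<alpha> k x, g \<otimes> inv k)"
  by (simp add: class_action_def)

lemma F_shift:
  assumes "k \<in> carrier G" "g \<in> carrier G" "h \<in> carrier G" "x \<in> space M"
  shows "(g \<otimes> inv k, h \<otimes> inv k) \<in> F (\<alpha> k x) \<longleftrightarrow> (g, h) \<in> F x"
  using F_equivariant[of k "g \<otimes> inv k" "h \<otimes> inv k" x] assms by (simp add: m_assoc)

lemma class_action_vimage:
  assumes k: "k \<in> carrier G" and D: "D \<in> class_sets"
  shows "class_action k -` D \<inter> (space M \<times> carrier G) \<in> class_sets"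
proof -
  have "{(x, g). x \<in> space M \<and> g \<in> carrier G \<and> (\<alpha> k x, g \<otimes> inv k) \<in> D} \<in> class_sets"
  proof (rule class_setsI)
    fix g assume g: "g \<in> carrier G"
    have "{x \<in> space M. (x, g \<otimes> inv k) \<in> D} \<in> sets M"
    proof (cases "space M = {}")
      case False
      then show ?thesis using class_setsD(2)[OF D] g k by auto
    qed simp
    from measurable_sets[OF measurable_action[OF k] this]
    show "{x \<in> space M. (\<alpha> k x, g \<otimes> inv k) \<in> D} \<in> sets M"
      using k by (simp add: vimage_def Int_def conj_commute cong: conj_cong)
  next
    fix x g h assume x: "x \<in> space M" and gh: "(g, h) \<in> F x"
    show "(\<alpha> k x, g \<otimes> inv k) \<in> D \<longleftrightarrow> (\<alpha> k x, h \<otimes> inv k) \<in> D"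
      using F_carrier[OF x gh] k x gh by (intro class_setsD(1)[OF D]) (auto simp: F_shift)
  qed
  also have "{(x, g). x \<in> space M \<and> g \<in> carrier G \<and> (\<alpha> k x, g \<otimes> inv k) \<in> D}
      = class_action k -` D \<inter> (space M \<times> carrier G)" by auto
  finally show ?thesis .
qed

text \<open>
  The classes of \<open>F x\<close> and of \<open>F (k x)\<close> correspond to one another by right translation. Their
  chosen elements do not, hence the detour through \<open>rep\<close> in the bijection.
\<close>

lemma count_classes_shift:
  assumes k: "k \<in> carrier G" and D: "D \<in> class_sets" and x: "x \<in> space M"
  shows "emeasure (count_space UNIV) {g \<in> reps x. (\<alpha> k x, g \<otimes> inv k) \<in> D}
    = emeasure (count_space UNIV) {h \<in> reps (\<alpha> k x). (\<alpha> k x, h) \<in> D}" (is "emeasure _ ?A = emeasure _ ?B")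
proof -
  have kx: "\<alpha> k x \<in> space M" using k x by simp
  have "bij_betw (\<lambda>g. rep (\<alpha> k x) (g \<otimes> inv k)) ?A ?B"
  proof (rule bij_betw_byWitness[where f' = "\<lambda>h. rep x (h \<otimes> k)"])
    show "\<forall>g\<in>?A. rep x (rep (\<alpha> k x) (g \<otimes> inv k) \<otimes> k) = g"
    proof
      fix g assume "g \<in> ?A"
      then have g: "g \<in> reps x" "g \<in> carrier G" by (auto dest: reps_carrier)
      have r: "rep (\<alpha> k x) (g \<otimes> inv k) \<in> carrier G"
        "(g \<otimes> inv k, rep (\<alpha> k x) (g \<otimes> inv k)) \<in> F (\<alpha> k x)"
        using rep[OF kx, of "g \<otimes> inv k"] g k by (auto dest: reps_carrier)
      then have "(g, rep (\<alpha> k x) (g \<otimes> inv k) \<otimes> k) \<in> F x"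
        using F_equivariant[of k "g \<otimes> inv k" _ x] g k x by (simp add: m_assoc)
      then show "rep x (rep (\<alpha> k x) (g \<otimes> inv k) \<otimes> k) = g"
        using F_sym[OF x] g by (intro rep_unique[OF x]) auto
    qed
    show "\<forall>h\<in>?B. rep (\<alpha> k x) (rep x (h \<otimes> k) \<otimes> inv k) = h"
    proof
      fix h assume "h \<in> ?B"
      then have h: "h \<in> reps (\<alpha> k x)" "h \<in> carrier G" by (auto dest: reps_carrier)
      have r: "rep x (h \<otimes> k) \<in> carrier G" "(h \<otimes> k, rep x (h \<otimes> k)) \<in> F x"
        using rep[OF x, of "h \<otimes> k"] h k by (auto dest: reps_carrier)
      then have "(h, rep x (h \<otimes> k) \<otimes> inv k) \<in> F (\<alpha> k x)"
        using F_equivariant[of k h "rep x (h \<otimes> k) \<otimes> inv k" x] h k x by (simp add: m_assoc)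
      then show "rep (\<alpha> k x) (rep x (h \<otimes> k) \<otimes> inv k) = h"
        using F_sym[OF kx] h by (intro rep_unique[OF kx]) auto
    qed
    show "(\<lambda>g. rep (\<alpha> k x) (g \<otimes> inv k)) ` ?A \<subseteq> ?B"
    proof
      fix h assume "h \<in> (\<lambda>g. rep (\<alpha> k x) (g \<otimes> inv k)) ` ?A"
      then obtain g where g: "g \<in> ?A" "h = rep (\<alpha> k x) (g \<otimes> inv k)" by blast
      then have "g \<in> carrier G" by (auto dest: reps_carrier)
      then have "h \<in> reps (\<alpha> k x)" "(g \<otimes> inv k, h) \<in> F (\<alpha> k x)"
        using rep[OF kx, of "g \<otimes> inv k"] k g(2) by auto
      then show "h \<in> ?B" using class_setsD(1)[OF D kx] g(1) by auto
    qed
    show "(\<lambda>h. rep x (h \<otimes> k)) ` ?B \<subseteq> ?A"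
    proof
      fix g assume "g \<in> (\<lambda>h. rep x (h \<otimes> k)) ` ?B"
      then obtain h where h: "h \<in> ?B" "g = rep x (h \<otimes> k)" by blast
      then have hc: "h \<in> carrier G" by (auto dest: reps_carrier)
      then have g: "g \<in> reps x" "(h \<otimes> k, g) \<in> F x"
        using rep[OF x, of "h \<otimes> k"] k h(2) by auto
      then have "(h, g \<otimes> inv k) \<in> F (\<alpha> k x)"
        using F_equivariant[of k h "g \<otimes> inv k" x] hc k x reps_carrier[OF g(1)] by (simp add: m_assoc)
      then show "g \<in> ?A" using class_setsD(1)[OF D kx] g(1) h(1) by auto
    qed
  qed
  then have "(\<integral>\<^sup>+g. 1 \<partial>count_space ?A) = (\<integral>\<^sup>+g. 1 \<partial>count_space ?B)"
    by (rule nn_integral_bij_count_space)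
  moreover have "emeasure (count_space S) S = emeasure (count_space UNIV) S" for S :: "'g set"
    by (rule emeasure_count_space_subset) auto
  ultimately show ?thesis by simp
qed

lemma count_classes_measurable:
  assumes D: "D \<in> class_sets"
  shows "(\<lambda>x. emeasure (count_space UNIV) {g \<in> reps x. (x, g) \<in> D}) \<in> borel_measurable M"
proof -
  define S where "S = {(x, g). x \<in> space M \<and> g \<in> carrier G \<and> (g \<in> reps x \<and> (x, g) \<in> D)}"
  have "{x \<in> space M. g \<in> reps x \<and> (x, g) \<in> D} \<in> sets M" if "g \<in> carrier G" for g
    using reps_measurable[OF that] class_setsD(2)[OF D _ that]
    by (cases "space M = {}") (auto intro: sets.sets_Collect_conj)
  then have [measurable]: "S \<in> sets (M \<Otimes>\<^sub>M count_space (carrier G))"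
    using sets_orbit_space_Collect[of "\<lambda>x g. g \<in> reps x \<and> (x, g) \<in> D"] by (simp add: S_def orbit_space_def)
  interpret C: sigma_finite_measure "count_space (carrier G)"
    by (rule sigma_finite_measure_count_space_countable[OF countable_carrier])
  have "(\<lambda>x. \<integral>\<^sup>+g. indicator S (x, g) \<partial>count_space (carrier G)) \<in> borel_measurable M"
    by (rule C.borel_measurable_nn_integral) simp
  moreover have "(\<integral>\<^sup>+g. indicator S (x, g) \<partial>count_space (carrier G))
      = emeasure (count_space UNIV) {g \<in> reps x. (x, g) \<in> D}" if x: "x \<in> space M" for x
  proof -
    have "(\<integral>\<^sup>+g. indicator S (x, g) \<partial>count_space (carrier G))
        = (\<integral>\<^sup>+g. indicator {g \<in> reps x. (x, g) \<in> D} g \<partial>count_space (carrier G))"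
      using x by (intro nn_integral_cong) (auto simp: S_def indicator_def)
    also have "\<dots> = emeasure (count_space (carrier G)) {g \<in> reps x. (x, g) \<in> D}"
      by (rule nn_integral_indicator) (auto dest: reps_carrier)
    also have "\<dots> = emeasure (count_space UNIV) {g \<in> reps x. (x, g) \<in> D}"
      by (intro emeasure_count_space_subset) (auto dest: reps_carrier)
    finally show ?thesis .
  qed
  ultimately show ?thesis by (simp cong: measurable_cong)
qed

sublocale classes: measure_preserving_action G class_space class_action
proof (intro measure_preserving_action.intro measure_preserving_action_axioms.intro countable_carrier)
  have "group_action G (space M \<times> carrier G) class_action"
    by (rule group_actionI)
      (auto simp: class_action_def group_G composition_rule m_assoc inv_mult_group)
  then show "group_action G (space class_space) class_action" by (simp add: space_class_space)
  fix k assume k: "k \<in> carrier G"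
  show meas: "class_action k \<in> class_space \<rightarrow>\<^sub>M class_space"
  proof (rule measurableI)
    show "class_action k z \<in> space class_space" if "z \<in> space class_space" for z
      using that k by (auto simp: space_class_space)
    show "class_action k -` D \<inter> space class_space \<in> sets class_space" if "D \<in> sets class_space" for D
      using class_action_vimage[OF k] that by (simp add: sets_class_space space_class_space)
  qed
  show "distr class_space class_space (class_action k) = class_space"
  proof (rule measure_eqI)
    fix D assume "D \<in> sets (distr class_space class_space (class_action k))"
    then have D: "D \<in> class_sets" by (simp add: sets_class_space)
    have "emeasure (distr class_space class_space (class_action k)) D
        = emeasure class_space (class_action k -` D \<inter> (space M \<times> carrier G))"
      using D by (simp add: emeasure_distr[OF meas] sets_class_space space_class_space)
    also have "\<dots> = (\<integral>\<^sup>+x. emeasure (count_space UNIV) {g \<in> reps x. (\<alpha> k x, g \<otimes> inv k) \<in> D} \<partial>M)"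
      unfolding emeasure_class_space[OF class_action_vimage[OF k D]]
      by (intro nn_integral_cong arg_cong2[where f = emeasure] refl) (auto dest: reps_carrier)
    also have "\<dots> = (\<integral>\<^sup>+x. emeasure (count_space UNIV) {h \<in> reps (\<alpha> k x). (\<alpha> k x, h) \<in> D} \<partial>M)"
      by (intro nn_integral_cong count_classes_shift k D)
    also have "\<dots> = (\<integral>\<^sup>+x. emeasure (count_space UNIV) {h \<in> reps x. (x, h) \<in> D} \<partial>distr M M (\<alpha> k))"
      by (rule nn_integral_distr[symmetric, OF measurable_action[OF k]])
        (simp add: distr_action[OF k] count_classes_measurable[OF D])
    also have "\<dots> = emeasure class_space D"
      by (simp add: distr_action[OF k] emeasure_class_space[OF D])
    finally show "emeasure (distr class_space class_space (class_action k)) D = emeasure class_space D" .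
  qed simp
qed

text \<open>
  The class of \<open>1\<close> has exactly one element in \<open>reps x\<close>.
\<close>

lemma emeasure_class_of_one:
  assumes P: "{x \<in> space M. P x} \<in> sets M"
  shows "{(x, g). x \<in> space M \<and> g \<in> carrier G \<and> (\<one>, g) \<in> F x \<and> P x} \<in> class_sets" (is "?D \<in> _")
    and "emeasure class_space {(x, g). x \<in> space M \<and> g \<in> carrier G \<and> (\<one>, g) \<in> F x \<and> P x}
      = emeasure M {x \<in> space M. P x}"
proof -
  show D: "?D \<in> class_sets"
  proof (rule class_setsI)
    show "{x \<in> space M. (\<one>, g) \<in> F x \<and> P x} \<in> sets M" if "g \<in> carrier G" for g
      by (intro sets.sets_Collect_conj F_measurable P that one_closed)
    show "(\<one>, g) \<in> F x \<and> P x \<longleftrightarrow> (\<one>, h) \<in> F x \<and> P x" if "x \<in> space M" "(g, h) \<in> F x" for x g h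
      using F_trans[OF that(1), of "\<one>"] F_sym[OF that] that(2) by blast
  qed
  have "emeasure class_space ?D = (\<integral>\<^sup>+x. indicator {x \<in> space M. P x} x \<partial>M)"
    unfolding emeasure_class_space[OF D]
  proof (rule nn_integral_cong)
    fix x assume x: "x \<in> space M"
    have "g \<in> reps x \<and> g \<in> carrier G \<and> (\<one>, g) \<in> F x \<longleftrightarrow> g = rep x \<one>" for g
      using rep_unique[OF x, of "\<one>" g] rep[OF x one_closed] reps_carrier[of "rep x \<one>" x]
      by metis
    then have "{g \<in> reps x. (x, g) \<in> ?D} = (if P x then {rep x \<one>} else {})"
      using x by (simp add: set_eq_iff)
    then show "emeasure (count_space UNIV) {g \<in> reps x. (x, g) \<in> ?D} = indicator {x \<in> space M. P x} x"
      using x by (simp add: emeasure_count_space)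
  qed
  then show "emeasure class_space ?D = emeasure M {x \<in> space M. P x}" using P by simp
qed

text \<open>
  The set of pairs of a point and its own class has measure \<open>1\<close>, and its intersection with its
  translate by \<open>g\<close> has the measure of \<open>{x. (1, g) \<in> F x}\<close>. Hence there is an invariant set \<open>D\<close> of pairs
  of finite positive measure. By invariance \<open>(x, g) \<in> D\<close> iff \<open>(g x, 1) \<in> D\<close>, so that \<open>D\<close> is
  determined by the set \<open>B\<close> of points whose own class is selected by \<open>D\<close>.
\<close>

theorem kazhdan_finite_index:
  assumes kp: "kazhdan_pair G Q \<epsilon>"
    and almost: "\<And>g. g \<in> Q \<Longrightarrow> 1 - \<epsilon>\<^sup>2 / 2 < measure M {x \<in> space M. (\<one>, g) \<in> F x}"
  obtains B where "B \<in> sets M"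
    "\<And>x g h. \<lbrakk>x \<in> space M; (g, h) \<in> F x\<rbrakk> \<Longrightarrow> \<alpha> g x \<in> B \<longleftrightarrow> \<alpha> h x \<in> B"
    "0 < (\<integral>\<^sup>+x. emeasure (count_space UNIV) {g \<in> reps x. \<alpha> g x \<in> B} \<partial>M)"
    "(\<integral>\<^sup>+x. emeasure (count_space UNIV) {g \<in> reps x. \<alpha> g x \<in> B} \<partial>M) < \<infinity>"
proof -
  have Q: "Q \<subseteq> carrier G" using kp by (simp add: kazhdan_pair_def)
  define A where "A = {(x, g). x \<in> space M \<and> g \<in> carrier G \<and> (\<one>, g) \<in> F x}"
  have A: "A \<in> class_sets" "emeasure class_space A = 1"
    using emeasure_class_of_one[of "\<lambda>_. True"] by (simp_all add: A_def emeasure_space_1)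
  have "\<exists>D. D \<in> sets class_space \<and> 0 < emeasure class_space D \<and> emeasure class_space D < \<infinity> \<and>
    (\<forall>g\<in>carrier G. \<forall>z\<in>space class_space. class_action g z \<in> D \<longleftrightarrow> z \<in> D)"
  proof (rule classes.kazhdan_invariant_set[OF kp, of A])
    show "A \<in> sets class_space" "emeasure class_space A < \<infinity>" "0 < measure class_space A"
      using A by (simp_all add: sets_class_space measure_def)
    fix k assume kQ: "k \<in> Q"
    then have k: "k \<in> carrier G" using Q by blast
    have P: "{x \<in> space M. (\<one>, inv k) \<in> F x} \<in> sets M"
      by (intro F_measurable) (use k in auto)
    have "A \<inter> (class_action (inv k) -` A \<inter> space class_space)
        = {(x, g). x \<in> space M \<and> g \<in> carrier G \<and> (\<one>, g) \<in> F x \<and> (\<one>, inv k) \<in> F x}"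
    proof -
      have "(\<one>, g \<otimes> k) \<in> F (\<alpha> (inv k) x) \<longleftrightarrow> (\<one>, inv k) \<in> F x"
        if x: "x \<in> space M" and g: "g \<in> carrier G" "(\<one>, g) \<in> F x" for x g
      proof -
        have "(\<one>, g \<otimes> k) \<in> F (\<alpha> (inv k) x) \<longleftrightarrow> (inv k, g) \<in> F x"
          using x g k F_equivariant[of "inv k" "\<one>" "g \<otimes> k" x] by (simp add: m_assoc)
        also have "\<dots> \<longleftrightarrow> (\<one>, inv k) \<in> F x"
          using F_trans[OF x g(2), of "inv k"] F_sym[OF x, of "inv k" g]
            F_trans[OF x F_sym[OF x, of "\<one>" "inv k"] g(2)] by blast
        finally show ?thesis .
      qed
      then show ?thesis
        using k by (auto simp: A_def space_class_space)
    qed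
    then have "emeasure class_space (A \<inter> (class_action (inv k) -` A \<inter> space class_space))
        = emeasure M {x \<in> space M. (\<one>, inv k) \<in> F x}"
      using emeasure_class_of_one(2)[OF P] by simp
    also have "\<dots> = emeasure M (\<alpha> k -` {x \<in> space M. (\<one>, inv k) \<in> F x} \<inter> space M)"
      by (rule emeasure_action[OF k P, symmetric])
    also have "\<alpha> k -` {x \<in> space M. (\<one>, inv k) \<in> F x} \<inter> space M = {x \<in> space M. (\<one>, k) \<in> F x}"
    proof -
      have "(\<one>, inv k) \<in> F (\<alpha> k x) \<longleftrightarrow> (\<one>, k) \<in> F x" if "x \<in> space M" for x
        using that k F_equivariant[of k "\<one>" "inv k" x] F_sym[OF that] by auto
      then show ?thesis using k by auto
    qed
    finally show "(1 - \<epsilon>\<^sup>2 / 2) * measure class_space A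
        < measure class_space (A \<inter> (class_action (inv k) -` A \<inter> space class_space))"
      using almost[OF kQ] A(2) by (simp add: measure_def)
  qed blast
  then obtain D where D: "D \<in> class_sets" "0 < emeasure class_space D" "emeasure class_space D < \<infinity>"
    and D_inv: "\<And>g z. \<lbrakk>g \<in> carrier G; z \<in> space class_space\<rbrakk> \<Longrightarrow> class_action g z \<in> D \<longleftrightarrow> z \<in> D"
    by (auto simp: sets_class_space)
  define B where "B = {x \<in> space M. (x, \<one>) \<in> D}"
  have B: "\<alpha> g x \<in> B \<longleftrightarrow> (x, g) \<in> D" if "x \<in> space M" "g \<in> carrier G" for x g
    using D_inv[of g "(x, g)"] that by (simp add: B_def space_class_space)
  have D_B: "emeasure class_space D = (\<integral>\<^sup>+x. emeasure (count_space UNIV) {g \<in> reps x. \<alpha> g x \<in> B} \<partial>M)"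
    unfolding emeasure_class_space[OF D(1)]
    by (intro nn_integral_cong arg_cong2[where f = emeasure] refl) (auto simp: B dest: reps_carrier)
  show thesis
  proof (rule that)
    show "B \<in> sets M"
      unfolding B_def using class_setsD(2)[OF D(1) _ one_closed] by (cases "space M = {}") auto
    show "\<alpha> g x \<in> B \<longleftrightarrow> \<alpha> h x \<in> B" if "x \<in> space M" "(g, h) \<in> F x" for x g h
      using class_setsD(1)[OF D(1) that] F_carrier[OF that] that(1) by (simp add: B)
  qed (use D D_B in auto)
qed

end

section \<open>Bounding the cost by equivariant arcs\<close>

context measure_preserving_action
begin

text \<open>
  A family of sets \<open>A g\<close> stands for the graph with an arc from \<open>y\<close> to \<open>g y\<close> for all \<open>y\<close> in \<open>A g\<close>. Its
  restriction to the orbit of \<open>x\<close> is pulled back to a graph on the group.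
\<close>

definition arc_rel :: "('g \<Rightarrow> 'z set) \<Rightarrow> 'z \<Rightarrow> 'g rel" where
  "arc_rel A x = {(g, h). g \<in> carrier G \<and> h \<in> carrier G \<and>
     (\<beta> g x \<in> A (h \<otimes> inv g) \<or> \<beta> h x \<in> A (g \<otimes> inv h))}"

definition arc_conn :: "('g \<Rightarrow> 'z set) \<Rightarrow> 'z \<Rightarrow> 'g rel" where
  "arc_conn A x = (arc_rel A x)\<^sup>* \<inter> carrier G \<times> carrier G"

lemma sym_arc_rel: "sym (arc_rel A x)"
  by (auto simp: arc_rel_def sym_def)

lemma equiv_arc_conn: "equiv (carrier G) (arc_conn A x)"
proof (rule equivI)
  show "sym (arc_conn A x)"
    using sym_rtrancl[OF sym_arc_rel[of A x]] by (auto simp: arc_conn_def sym_def)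
qed (auto simp: arc_conn_def refl_on_def trans_def)

lemma arc_connI: "(g, h) \<in> arc_rel A x \<Longrightarrow> (g, h) \<in> arc_conn A x"
  by (auto simp: arc_conn_def arc_rel_def)

lemma arc_rel_equivariant:
  assumes "k \<in> carrier G" "g \<in> carrier G" "h \<in> carrier G" "x \<in> space N"
  shows "(g, h) \<in> arc_rel A (\<beta> k x) \<longleftrightarrow> (g \<otimes> k, h \<otimes> k) \<in> arc_rel A x"
proof -
  interpret group G by (rule group_G)
  have "(u \<otimes> k) \<otimes> inv (v \<otimes> k) = u \<otimes> inv v"
    if "u \<in> carrier G" "v \<in> carrier G" for u v
  proof -
    have "(u \<otimes> k) \<otimes> inv (v \<otimes> k) = u \<otimes> ((k \<otimes> inv k) \<otimes> inv v)"
      using that assms(1) by (simp only: inv_mult_group m_assoc m_closed inv_closed)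
    then show ?thesis using that assms(1) by simp
  qed
  then show ?thesis using assms by (simp add: arc_rel_def composition_rule)
qed

lemma arc_conn_equivariant:
  assumes k: "k \<in> carrier G" and gh: "g \<in> carrier G" "h \<in> carrier G" and x: "x \<in> space N"
  shows "(g, h) \<in> arc_conn A (\<beta> k x) \<longleftrightarrow> (g \<otimes> k, h \<otimes> k) \<in> arc_conn A x"
proof -
  interpret group G by (rule group_G)
  have *: "(g \<otimes> k, h \<otimes> k) \<in> (arc_rel A x)\<^sup>*"
    if "(g, h) \<in> (arc_rel A (\<beta> k x))\<^sup>*" "g \<in> carrier G" "k \<in> carrier G" "x \<in> space N" for g h k x
    using that(1)
  proof (induction rule: rtrancl_induct)
    case (step u v)
    have "u \<in> carrier G" "v \<in> carrier G" using step(2) by (auto simp: arc_rel_def)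
    then have "(u \<otimes> k, v \<otimes> k) \<in> arc_rel A x"
      using step(2) that arc_rel_equivariant by simp
    with step(3) show ?case by (rule rtrancl_into_rtrancl)
  qed simp
  show ?thesis
  proof
    assume "(g, h) \<in> arc_conn A (\<beta> k x)"
    then show "(g \<otimes> k, h \<otimes> k) \<in> arc_conn A x"
      using *[of g h k x] assms by (simp add: arc_conn_def)
  next
    assume "(g \<otimes> k, h \<otimes> k) \<in> arc_conn A x"
    then have "(g \<otimes> k, h \<otimes> k) \<in> (arc_rel A (\<beta> (inv k) (\<beta> k x)))\<^sup>*"
      using k x by (simp add: arc_conn_def)
    from *[OF this] have "(g \<otimes> k \<otimes> inv k, h \<otimes> k \<otimes> inv k) \<in> (arc_rel A (\<beta> k x))\<^sup>*"
      using assms by simp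
    then show "(g, h) \<in> arc_conn A (\<beta> k x)"
      using assms by (simp add: arc_conn_def m_assoc)
  qed
qed

lemma arc_conn_measurable:
  assumes A: "\<And>g. g \<in> carrier G \<Longrightarrow> A g \<in> sets N" and gh: "g \<in> carrier G" "h \<in> carrier G"
  shows "{x \<in> space N. (g, h) \<in> arc_conn A x} \<in> sets N"
proof -
  interpret group G by (rule group_G)
  have vim: "{x \<in> space N. \<beta> u x \<in> A v} \<in> sets N" if "u \<in> carrier G" "v \<in> carrier G" for u v
  proof -
    have "\<beta> u -` A v \<inter> space N \<in> sets N" by (rule measurable_sets[OF measurable_action A]) (use that in auto)
    also have "\<beta> u -` A v \<inter> space N = {x \<in> space N. \<beta> u x \<in> A v}" by auto
    finally show ?thesis .
  qed
  have one: "{x \<in> space N. (u, v) \<in> arc_rel A x} \<in> sets N" if "u \<in> carrier G" "v \<in> carrier G" for u v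
    using that unfolding arc_rel_def by (simp add: sets.sets_Collect_disj vim)
  have pow: "{x \<in> space N. (g, v) \<in> arc_rel A x ^^ n} \<in> sets N" if "v \<in> carrier G" for v n
    using that
  proof (induction n arbitrary: v)
    case 0
    then show ?case by simp
  next
    case (Suc n)
    have "{x \<in> space N. \<exists>u\<in>carrier G. (g, u) \<in> arc_rel A x ^^ n \<and> (u, v) \<in> arc_rel A x} \<in> sets N"
      by (intro sets.sets_Collect_countable_Ex' countable_carrier sets.sets_Collect_conj Suc one)
    also have "{x \<in> space N. \<exists>u\<in>carrier G. (g, u) \<in> arc_rel A x ^^ n \<and> (u, v) \<in> arc_rel A x}
        = {x \<in> space N. (g, v) \<in> arc_rel A x ^^ Suc n}"
      by (auto simp: relcomp_unfold arc_rel_def)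
    finally show ?case .
  qed
  have "{x \<in> space N. \<exists>n. (g, h) \<in> arc_rel A x ^^ n} \<in> sets N"
    by (intro sets.sets_Collect_countable_Ex pow gh)
  then show ?thesis using gh by (simp add: arc_conn_def rtrancl_power)
qed

lemma emeasure_count_space_Collect:
  "emeasure (count_space UNIV) {g \<in> carrier G. x \<in> A g} = (\<integral>\<^sup>+g. indicator (A g) x \<partial>count_space (carrier G))"
proof -
  have "(\<integral>\<^sup>+g. indicator (A g) x \<partial>count_space (carrier G))
      = (\<integral>\<^sup>+g. indicator {g \<in> carrier G. x \<in> A g} g \<partial>count_space (carrier G))"
    by (intro nn_integral_cong) (auto simp: indicator_def)
  also have "\<dots> = emeasure (count_space (carrier G)) {g \<in> carrier G. x \<in> A g}"
    by (rule nn_integral_indicator) auto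
  also have "\<dots> = emeasure (count_space UNIV) {g \<in> carrier G. x \<in> A g}"
    by (intro emeasure_count_space_subset) auto
  finally show ?thesis by simp
qed

end

lemma emeasure_count_space_image_le:
  "emeasure (count_space UNIV) (f ` S) \<le> emeasure (count_space UNIV) S"
  by (cases "finite S") (simp_all add: emeasure_count_space card_image_le)

text \<open>
  The complement of the diagonal is a countable union of rectangles of disjoint basic open sets.
\<close>

lemma standard_borel_diagonal:
  assumes "standard_borel M"
  shows "{(x, y). x \<in> space M \<and> y \<in> space M \<and> x = y} \<in> sets (M \<Otimes>\<^sub>M M)"
proof -
  obtain T where T: "topspace T = space M" "completely_metrizable_space T" "second_countable T"
    "sets M = sigma_sets (space M) {U. openin T U}"
    using assms unfolding standard_borel_def by metis
  have haus: "Hausdorff_space T"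
    using T(2) completely_metrizable_imp_metrizable_space metrizable_imp_Hausdorff_space by blast
  obtain \<B> where \<B>: "countable \<B>" "\<And>V. V \<in> \<B> \<Longrightarrow> openin T V"
    "\<And>U x. \<lbrakk>openin T U; x \<in> U\<rbrakk> \<Longrightarrow> \<exists>V\<in>\<B>. x \<in> V \<and> V \<subseteq> U"
    using T(3) unfolding second_countable_def by metis
  define P where "P = {(U, V). U \<in> \<B> \<and> V \<in> \<B> \<and> U \<inter> V = {}}"
  have "P \<subseteq> \<B> \<times> \<B>" by (auto simp: P_def)
  then have "countable P" using \<B>(1) by (meson countable_SIGMA countable_subset)
  have open_sets: "V \<in> sets M" if "V \<in> \<B>" for V using \<B>(2)[OF that] T(4) by auto
  have "(\<Union>(U, V)\<in>P. U \<times> V) \<in> sets (M \<Otimes>\<^sub>M M)"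
    using \<open>countable P\<close> open_sets by (intro sets.countable_UN') (auto simp: P_def)
  then have "space (M \<Otimes>\<^sub>M M) - (\<Union>(U, V)\<in>P. U \<times> V) \<in> sets (M \<Otimes>\<^sub>M M)" by (rule sets.compl_sets)
  also have "space (M \<Otimes>\<^sub>M M) - (\<Union>(U, V)\<in>P. U \<times> V) = {(x, y). x \<in> space M \<and> y \<in> space M \<and> x = y}"
  proof -
    have "\<exists>(U, V)\<in>P. x \<in> U \<and> y \<in> V" if xy: "x \<in> space M" "y \<in> space M" "x \<noteq> y" for x y
    proof -
      obtain U V where UV: "openin T U" "openin T V" "x \<in> U" "y \<in> V" "disjnt U V"
        using haus xy T(1) unfolding Hausdorff_space_def by metis
      obtain U' where U': "U' \<in> \<B>" "x \<in> U'" "U' \<subseteq> U" using \<B>(3)[OF UV(1,3)] by blast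
      obtain V' where V': "V' \<in> \<B>" "y \<in> V'" "V' \<subseteq> V" using \<B>(3)[OF UV(2,4)] by blast
      have "(U', V') \<in> P" using U' V' UV(5) by (auto simp: P_def disjnt_def)
      then show ?thesis using U' V' by blast
    qed
    then show ?thesis by (auto simp: space_pair_measure P_def) blast+
  qed
  finally show ?thesis .
qed

context measure_preserving_action
begin

text \<open>
  The degree of a vertex is at most the number of arcs leaving it plus the number of arcs entering
  it. As the action preserves the measure, both have the same mean, namely the sum of the
  measures of the sets \<open>A g\<close>, which compensates the factor \<open>1/2\<close> in the definition of cost.
\<close>

theorem cost_le_arcs:
  assumes diag: "{(x, y). x \<in> space N \<and> y \<in> space N \<and> x = y} \<in> sets (N \<Otimes>\<^sub>M N)"
    and A: "\<And>g. g \<in> carrier G \<Longrightarrow> A g \<in> sets N"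
    and conn: "AE x in N. \<forall>g\<in>carrier G. (\<one>, g) \<in> arc_conn A x"
  shows "cost N (orbit_rel G N \<beta>) \<le> (\<integral>\<^sup>+g. emeasure N (A g) \<partial>count_space (carrier G))"
proof -
  interpret group G by (rule group_G)
  define \<G> where "\<G> = {(x, y). x \<in> space N \<and> y \<in> space N \<and> x \<noteq> y \<and>
    (\<exists>g\<in>carrier G. x \<in> A g \<and> y = \<beta> g x \<or> y \<in> A g \<and> x = \<beta> g y)}"
  have graph: "{p \<in> space (N \<Otimes>\<^sub>M N). fst p \<in> A g \<and> snd p = \<beta> g (fst p)} \<in> sets (N \<Otimes>\<^sub>M N)"
    "{p \<in> space (N \<Otimes>\<^sub>M N). snd p \<in> A g \<and> fst p = \<beta> g (snd p)} \<in> sets (N \<Otimes>\<^sub>M N)"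
    if g: "g \<in> carrier G" for g
  proof -
    let ?D = "{(x, y). x \<in> space N \<and> y \<in> space N \<and> x = y}"
    note [measurable] = measurable_action[OF g] A[OF g]
    have "(\<lambda>p. (\<beta> g (fst p), snd p)) \<in> N \<Otimes>\<^sub>M N \<rightarrow>\<^sub>M N \<Otimes>\<^sub>M N"
      "(\<lambda>p. (fst p, \<beta> g (snd p))) \<in> N \<Otimes>\<^sub>M N \<rightarrow>\<^sub>M N \<Otimes>\<^sub>M N" by measurable
    from this[THEN measurable_sets, OF diag]
    have "(\<lambda>p. (\<beta> g (fst p), snd p)) -` ?D \<inter> space (N \<Otimes>\<^sub>M N) \<in> sets (N \<Otimes>\<^sub>M N)"
      "(\<lambda>p. (fst p, \<beta> g (snd p))) -` ?D \<inter> space (N \<Otimes>\<^sub>M N) \<in> sets (N \<Otimes>\<^sub>M N)" .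
    moreover have "{p \<in> space (N \<Otimes>\<^sub>M N). fst p \<in> A g} \<in> sets (N \<Otimes>\<^sub>M N)"
      "{p \<in> space (N \<Otimes>\<^sub>M N). snd p \<in> A g} \<in> sets (N \<Otimes>\<^sub>M N)" by measurable
    ultimately have
      "{p \<in> space (N \<Otimes>\<^sub>M N). fst p \<in> A g} \<inter> ((\<lambda>p. (\<beta> g (fst p), snd p)) -` ?D \<inter> space (N \<Otimes>\<^sub>M N)) \<in> sets (N \<Otimes>\<^sub>M N)"
      "{p \<in> space (N \<Otimes>\<^sub>M N). snd p \<in> A g} \<inter> ((\<lambda>p. (fst p, \<beta> g (snd p))) -` ?D \<inter> space (N \<Otimes>\<^sub>M N)) \<in> sets (N \<Otimes>\<^sub>M N)"
      by (auto intro: sets.Int)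
    moreover have
      "{p \<in> space (N \<Otimes>\<^sub>M N). fst p \<in> A g} \<inter> ((\<lambda>p. (\<beta> g (fst p), snd p)) -` ?D \<inter> space (N \<Otimes>\<^sub>M N))
        = {p \<in> space (N \<Otimes>\<^sub>M N). fst p \<in> A g \<and> snd p = \<beta> g (fst p)}"
      "{p \<in> space (N \<Otimes>\<^sub>M N). snd p \<in> A g} \<inter> ((\<lambda>p. (fst p, \<beta> g (snd p))) -` ?D \<inter> space (N \<Otimes>\<^sub>M N))
        = {p \<in> space (N \<Otimes>\<^sub>M N). snd p \<in> A g \<and> fst p = \<beta> g (snd p)}"
      by (auto simp: space_pair_measure)
    ultimately show "{p \<in> space (N \<Otimes>\<^sub>M N). fst p \<in> A g \<and> snd p = \<beta> g (fst p)} \<in> sets (N \<Otimes>\<^sub>M N)"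
      "{p \<in> space (N \<Otimes>\<^sub>M N). snd p \<in> A g \<and> fst p = \<beta> g (snd p)} \<in> sets (N \<Otimes>\<^sub>M N)" by simp_all
  qed
  have G_meas: "\<G> \<in> sets (N \<Otimes>\<^sub>M N)"
  proof -
    have "{p \<in> space (N \<Otimes>\<^sub>M N). \<exists>g\<in>carrier G. fst p \<in> A g \<and> snd p = \<beta> g (fst p) \<or> snd p \<in> A g \<and> fst p = \<beta> g (snd p)}
        - {(x, y). x \<in> space N \<and> y \<in> space N \<and> x = y} \<in> sets (N \<Otimes>\<^sub>M N)"
      by (intro sets.Diff diag sets.sets_Collect_countable_Ex' countable_carrier sets.sets_Collect_disj graph)
    also have "{p \<in> space (N \<Otimes>\<^sub>M N). \<exists>g\<in>carrier G. fst p \<in> A g \<and> snd p = \<beta> g (fst p) \<or> snd p \<in> A g \<and> fst p = \<beta> g (snd p)}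
        - {(x, y). x \<in> space N \<and> y \<in> space N \<and> x = y} = \<G>"
      by (auto simp: \<G>_def space_pair_measure)
    finally show ?thesis .
  qed
  have graphing: "graphing N (orbit_rel G N \<beta>) \<G>"
    unfolding graphing_def borel_graph_def
  proof (intro conjI G_meas)
    show "sym \<G>" by (auto simp: sym_def \<G>_def)
    show "irrefl \<G>" by (auto simp: irrefl_def \<G>_def)
    show "AE x in N. \<G>\<^sup>* `` {x} = orbit_rel G N \<beta> `` {x}"
      using conn AE_space
    proof eventually_elim
      case (elim x)
      note x = elim(2)
      have "\<exists>g\<in>carrier G. y = \<beta> g x" if "(x, y) \<in> \<G>\<^sup>*" for y
        using that
      proof (induction rule: rtrancl_induct)
        case base
        then show ?case using x by (intro bexI[of _ "\<one>"]) auto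
      next
        case (step y z)
        then obtain h where h: "h \<in> carrier G" "y = \<beta> h x" by blast
        from step(2) obtain g where "g \<in> carrier G" "z \<in> space N" "z = \<beta> g y \<or> y = \<beta> g z"
          by (auto simp: \<G>_def)
        then consider "z = \<beta> (g \<otimes> h) x" "g \<in> carrier G" | "z = \<beta> (inv g \<otimes> h) x" "g \<in> carrier G"
          using h x by (auto simp: composition_rule)
        then show ?case using h by cases auto
      qed
      moreover have "(x, \<beta> g x) \<in> \<G>\<^sup>*" if "(\<one>, g) \<in> (arc_rel A x)\<^sup>*" for g
        using that
      proof (induction rule: rtrancl_induct)
        case base
        then show ?case using x by simp
      next
        case (step u v)
        have uv: "u \<in> carrier G" "v \<in> carrier G" using step(2) by (auto simp: arc_rel_def)
        have "\<beta> v x = \<beta> (v \<otimes> inv u) (\<beta> u x)" "\<beta> u x = \<beta> (u \<otimes> inv v) (\<beta> v x)"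
          using uv x by (simp_all add: composition_rule)
        then have "\<beta> u x = \<beta> v x \<or> (\<beta> u x, \<beta> v x) \<in> \<G>"
          using step(2) uv x unfolding arc_rel_def \<G>_def by simp (metis inv_closed m_closed)
        with step(3) show ?case by (auto intro: rtrancl_into_rtrancl)
      qed
      ultimately show ?case
        using elim(1) x by (auto simp: orbit_rel_def orbit_def arc_conn_def)
    qed
  qed
  have deg: "vertex_degree \<G> x \<le> (\<integral>\<^sup>+g. indicator (A g) x + indicator (\<beta> (inv g) -` A g \<inter> space N) x \<partial>count_space (carrier G))"
    if x: "x \<in> space N" for x
  proof -
    let ?out = "{g \<in> carrier G. x \<in> A g}"
    let ?in = "{g \<in> carrier G. x \<in> \<beta> (inv g) -` A g \<inter> space N}"
    have "\<G> `` {x} \<subseteq> (\<lambda>g. \<beta> g x) ` ?out \<union> (\<lambda>g. \<beta> (inv g) x) ` ?in"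
    proof
      fix y assume "y \<in> \<G> `` {x}"
      then obtain g where g: "g \<in> carrier G" "y \<in> space N" "x \<in> A g \<and> y = \<beta> g x \<or> y \<in> A g \<and> x = \<beta> g y"
        by (auto simp: \<G>_def)
      then show "y \<in> (\<lambda>g. \<beta> g x) ` ?out \<union> (\<lambda>g. \<beta> (inv g) x) ` ?in"
      proof (elim disjE conjE)
        assume y: "y \<in> A g" "x = \<beta> g y"
        then have "\<beta> (inv g) x = y" using g by simp
        then show ?thesis using g y x by (intro UnI2 image_eqI[of _ _ g]) auto
      qed auto
    qed
    then have "vertex_degree \<G> x \<le> emeasure (count_space UNIV) ((\<lambda>g. \<beta> g x) ` ?out \<union> (\<lambda>g. \<beta> (inv g) x) ` ?in)"
      unfolding vertex_degree_def by (intro emeasure_mono) auto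
    also have "\<dots> \<le> emeasure (count_space UNIV) ((\<lambda>g. \<beta> g x) ` ?out) + emeasure (count_space UNIV) ((\<lambda>g. \<beta> (inv g) x) ` ?in)"
      by (intro emeasure_subadditive) auto
    also have "\<dots> \<le> emeasure (count_space UNIV) ?out + emeasure (count_space UNIV) ?in"
      by (intro add_mono emeasure_count_space_image_le)
    also have "\<dots> = (\<integral>\<^sup>+g. indicator (A g) x \<partial>count_space (carrier G))
        + (\<integral>\<^sup>+g. indicator (\<beta> (inv g) -` A g \<inter> space N) x \<partial>count_space (carrier G))"
      unfolding emeasure_count_space_Collect ..
    also have "\<dots> = (\<integral>\<^sup>+g. indicator (A g) x + indicator (\<beta> (inv g) -` A g \<inter> space N) x \<partial>count_space (carrier G))"
      by (rule nn_integral_add[symmetric]) auto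
    finally show ?thesis .
  qed
  have "(\<integral>\<^sup>+x. vertex_degree \<G> x \<partial>N)
      \<le> (\<integral>\<^sup>+x. \<integral>\<^sup>+g. indicator (A g) x + indicator (\<beta> (inv g) -` A g \<inter> space N) x \<partial>count_space (carrier G) \<partial>N)"
    by (intro nn_integral_mono deg)
  also have "\<dots> = (\<integral>\<^sup>+g. \<integral>\<^sup>+x. indicator (A g) x + indicator (\<beta> (inv g) -` A g \<inter> space N) x \<partial>N \<partial>count_space (carrier G))"
  proof (rule nn_integral_count_space_nn_integral[OF countable_carrier])
    fix g assume g: "g \<in> carrier G"
    then have "\<beta> (inv g) -` A g \<inter> space N \<in> sets N"
      by (intro measurable_sets[OF measurable_action A]) auto
    then show "(\<lambda>x. (indicator (A g) x :: ennreal) + indicator (\<beta> (inv g) -` A g \<inter> space N) x) \<in> borel_measurable N"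
      using A[OF g] by (intro borel_measurable_add borel_measurable_indicator)
  qed
  also have "\<dots> = (\<integral>\<^sup>+g. 2 * emeasure N (A g) \<partial>count_space (carrier G))"
  proof (rule nn_integral_cong)
    fix g assume "g \<in> space (count_space (carrier G))"
    then have g: "g \<in> carrier G" by simp
    then have m: "\<beta> (inv g) -` A g \<inter> space N \<in> sets N"
      by (intro measurable_sets[OF measurable_action A]) auto
    have "(\<integral>\<^sup>+x. indicator (A g) x + indicator (\<beta> (inv g) -` A g \<inter> space N) x \<partial>N)
        = emeasure N (A g) + emeasure N (\<beta> (inv g) -` A g \<inter> space N)"
      using m A[OF g] by (subst nn_integral_add) (auto intro: borel_measurable_indicator)
    also have "\<dots> = 2 * emeasure N (A g)"
      using emeasure_action[OF _ A[OF g], of "inv g"] g by (simp add: mult_2)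
    finally show "(\<integral>\<^sup>+x. indicator (A g) x + indicator (\<beta> (inv g) -` A g \<inter> space N) x \<partial>N) = 2 * emeasure N (A g)" .
  qed
  also have "\<dots> = 2 * (\<integral>\<^sup>+g. emeasure N (A g) \<partial>count_space (carrier G))"
    by (rule nn_integral_cmult) simp
  finally have le: "(\<integral>\<^sup>+x. vertex_degree \<G> x \<partial>N) \<le> 2 * (\<integral>\<^sup>+g. emeasure N (A g) \<partial>count_space (carrier G))" .
  have "cost N (orbit_rel G N \<beta>) \<le> (1/2) * (\<integral>\<^sup>+x. vertex_degree \<G> x \<partial>N)"
    unfolding cost_def using graphing by (intro INF_lower) simp
  also have "\<dots> \<le> (1/2) * (2 * (\<integral>\<^sup>+g. emeasure N (A g) \<partial>count_space (carrier G)))"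
    by (intro mult_left_mono le) simp
  also have "\<dots> = (\<integral>\<^sup>+g. emeasure N (A g) \<partial>count_space (carrier G))"
    by (simp add: mult.assoc[symmetric] ennreal_divide_times ennreal_divide_self)
  finally show ?thesis .
qed

end

section \<open>Independent uniform labels and the Bernoulli shift\<close>

definition uniform01 :: "real measure" where
  "uniform01 = uniform_measure lborel {0..1}"

text \<open>
  The law of independent uniform labels. They are indexed by natural numbers instead of group
  elements, so that the space of labellings is a type with its product topology; the group is
  enumerated below.
\<close>

definition iid :: "(nat \<Rightarrow> real) measure" where
  "iid = PiM UNIV (\<lambda>_. uniform01)"

lemma prob_space_uniform01: "prob_space uniform01"
  unfolding uniform01_def by (rule prob_space_uniform_measure) simp_all

lemma space_uniform01 [simp]: "space uniform01 = UNIV"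
  and sets_uniform01 [simp, measurable_cong]: "sets uniform01 = sets borel"
  by (simp_all add: uniform01_def)

lemma space_iid [simp]: "space iid = UNIV"
  by (simp add: iid_def space_PiM)

interpretation iid: product_prob_space "\<lambda>_::nat. uniform01" UNIV
  unfolding product_prob_space_def product_prob_space_axioms_def product_sigma_finite_def
  using prob_space_uniform01 prob_space_imp_sigma_finite by blast

interpretation labels: prob_space iid
  unfolding iid_def by (rule prob_space_PiM) (rule prob_space_uniform01)

lemma sets_iid: "sets iid = sets borel"
  unfolding iid_def sets_PiM_equal_borel[symmetric]
  by (rule sets_PiM_cong) simp_all

lemma measurable_label [measurable]: "(\<lambda>x. x i) \<in> borel_measurable iid"
  unfolding iid_def
  using measurable_component_singleton[of i UNIV "\<lambda>_. uniform01"]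
  by (simp cong: measurable_cong_sets)

lemma standard_borel_iid: "standard_borel iid"
  unfolding standard_borel_def
proof (intro exI conjI)
  show "topspace euclidean = space iid" by simp
  show "completely_metrizable_space (euclidean :: (nat \<Rightarrow> real) topology)"
    by (rule completely_metrizable_space_euclidean)
  show "second_countable (euclidean :: (nat \<Rightarrow> real) topology)"
  proof -
    obtain \<B> :: "(nat \<Rightarrow> real) set set" where \<B>: "countable \<B>" "topological_basis \<B>"
      using ex_countable_basis by auto
    have "\<exists>V\<in>\<B>. x \<in> V \<and> V \<subseteq> U" if "open U" "x \<in> U" for U x
      using topological_basisE[OF \<B>(2) that] by metis
    then show ?thesis
      unfolding second_countable_def using \<B>(1) topological_basis_open[OF \<B>(2)]
      by (intro exI[of _ \<B>]) simp
  qed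
  show "sets iid = sigma_sets (space iid) {U. openin euclidean U}"
    by (simp add: sets_iid borel_def)
qed

lemma prod_emb_uniform01:
  "prod_emb UNIV (\<lambda>_. uniform01) J (\<Pi>\<^sub>E j\<in>J. E j) = {x. \<forall>j\<in>J. x j \<in> E j}"
  by (auto simp: prod_emb_def space_PiM PiE_iff)

lemma emeasure_cylinder:
  assumes "finite J" "\<And>j. j \<in> J \<Longrightarrow> E j \<in> sets borel"
  shows "emeasure iid {x. \<forall>j\<in>J. x j \<in> E j} = (\<Prod>j\<in>J. emeasure uniform01 (E j))"
  unfolding iid_def prod_emb_uniform01[symmetric]
  by (rule emeasure_PiM_emb) (use assms prob_space_uniform01 in auto)

lemma measure_label_le:
  assumes "0 \<le> t" "t \<le> 1"
  shows "measure iid {x. x i \<le> t} = t"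
proof -
  have "emeasure iid {x. x i \<le> t} = emeasure uniform01 {..t}"
    using emeasure_cylinder[of "{i}" "\<lambda>_. {..t}"] by simp
  also have "\<dots> = ennreal t"
  proof -
    have "{0..1} \<inter> {..t} = {0..t}" using assms by auto
    then show ?thesis using assms by (simp add: uniform01_def divide_ennreal_def)
  qed
  finally show ?thesis using assms by (simp add: measure_def)
qed

lemma AE_labels_distinct:
  assumes ij: "i \<noteq> j"
  shows "AE x in iid. x i \<noteq> x j"
proof -
  interpret U: prob_space uniform01 by (rule prob_space_uniform01)
  interpret UU: pair_sigma_finite uniform01 uniform01 ..
  have [measurable]: "(\<lambda>x. (x i, x j)) \<in> iid \<rightarrow>\<^sub>M uniform01 \<Otimes>\<^sub>M uniform01"
    by (intro measurable_Pair) (simp_all cong: measurable_cong_sets)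
  have "uniform01 \<Otimes>\<^sub>M uniform01 = distr iid (uniform01 \<Otimes>\<^sub>M uniform01) (\<lambda>x. (x i, x j))"
  proof (rule pair_measure_eqI)
    fix A B :: "real set" assume "A \<in> sets uniform01" "B \<in> sets uniform01"
    then have A: "A \<in> sets borel" and B: "B \<in> sets borel" by simp_all
    have "emeasure (distr iid (uniform01 \<Otimes>\<^sub>M uniform01) (\<lambda>x. (x i, x j))) (A \<times> B)
        = emeasure iid ((\<lambda>x. (x i, x j)) -` (A \<times> B) \<inter> space iid)"
      using A B by (intro emeasure_distr) auto
    also have "(\<lambda>x. (x i, x j)) -` (A \<times> B) \<inter> space iid
        = {x. \<forall>k\<in>{i, j}. x k \<in> (if k = i then A else B)}" using ij by auto
    also have "emeasure iid \<dots> = emeasure uniform01 A * emeasure uniform01 B"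
      using A B ij by (subst emeasure_cylinder) auto
    finally show "emeasure uniform01 A * emeasure uniform01 B
        = emeasure (distr iid (uniform01 \<Otimes>\<^sub>M uniform01) (\<lambda>x. (x i, x j))) (A \<times> B)" ..
  qed (auto intro: prob_space_imp_sigma_finite prob_space_uniform01)
  then have eq: "distr iid (uniform01 \<Otimes>\<^sub>M uniform01) (\<lambda>x. (x i, x j)) = uniform01 \<Otimes>\<^sub>M uniform01" ..
  have "AE a in uniform01. AE b in uniform01. a \<noteq> b"
  proof (rule AE_I2)
    fix a :: real
    have "emeasure uniform01 {a} = 0"
    proof -
      have "emeasure lborel ({0..1} \<inter> {a}) \<le> emeasure lborel {a}" by (intro emeasure_mono) auto
      then show ?thesis by (simp add: uniform01_def)
    qed
    then show "AE b in uniform01. a \<noteq> b" by (intro AE_I[of _ _ "{a}"]) auto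
  qed
  moreover have neq: "{p \<in> space (uniform01 \<Otimes>\<^sub>M uniform01). fst p \<noteq> snd p} \<in> sets (uniform01 \<Otimes>\<^sub>M uniform01)"
    by measurable
  ultimately have "AE p in uniform01 \<Otimes>\<^sub>M uniform01. fst p \<noteq> snd p"
    by (intro UU.AE_pair_measure[OF neq]) simp
  then have "AE p in distr iid (uniform01 \<Otimes>\<^sub>M uniform01) (\<lambda>x. (x i, x j)). fst p \<noteq> snd p"
    unfolding eq .
  then have "AE x in iid. fst (x i, x j) \<noteq> snd (x i, x j)"
    by (rule AE_distrD[rotated]) measurable
  then show ?thesis by simp
qed

lemma distr_reindex_labels:
  assumes "inj \<sigma>"
  shows "distr iid iid (\<lambda>x n. x (\<sigma> n)) = iid"
  using distr_PiM_reindex[of UNIV "\<lambda>_. uniform01" \<sigma> UNIV] assms prob_space_uniform01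
  by (simp add: iid_def restrict_def)

lemma measurable_reindex_labels: "(\<lambda>x n. x (\<sigma> n)) \<in> iid \<rightarrow>\<^sub>M iid"
proof -
  have "(\<lambda>x. \<lambda>n\<in>UNIV. x (\<sigma> n)) \<in> iid \<rightarrow>\<^sub>M PiM UNIV (\<lambda>_. uniform01)"
    by (rule measurable_restrict) (simp cong: measurable_cong_sets)
  then show ?thesis by (simp add: iid_def restrict_def)
qed

text \<open>
  The event that \<open>i\<close> has the largest label in \<open>T\<close>. By exchanging two labels its probability does
  not depend on \<open>i\<close>. This gives both \<open>1 / card T\<close> for finite \<open>T\<close> and, as infinitely many
  disjoint events cannot have the same positive probability, the absence of a largest label
  for infinite \<open>T\<close>.
\<close>

definition max_at :: "nat set \<Rightarrow> nat \<Rightarrow> (nat \<Rightarrow> real) set" where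
  "max_at T i = {x. \<forall>k\<in>T - {i}. x k < x i}"

lemma max_at_measurable [measurable]: "max_at T i \<in> sets iid"
proof -
  have "{x \<in> space iid. \<forall>k\<in>T - {i}. x k < x i} \<in> sets iid"
    by (intro sets.sets_Collect_countable_All' countableI_type) measurable
  then show ?thesis by (simp add: max_at_def)
qed

lemma measure_max_at_eq:
  assumes i: "i \<in> T" and j: "j \<in> T"
  shows "measure iid (max_at T i) = measure iid (max_at T j)"
proof -
  define \<sigma> where "\<sigma> = Transposition.transpose i j"
  have \<sigma>: "inj \<sigma>" unfolding \<sigma>_def by (metis injI transpose_involutory)
  have "measure iid (max_at T j)
      = measure (distr iid iid (\<lambda>x n. x (\<sigma> n))) (max_at T j)"
    by (simp add: distr_reindex_labels[OF \<sigma>])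
  also have "\<dots> = measure iid ((\<lambda>x n. x (\<sigma> n)) -` max_at T j \<inter> space iid)"
    by (rule measure_distr[OF measurable_reindex_labels]) simp
  also have "(\<lambda>x n. x (\<sigma> n)) -` max_at T j \<inter> space iid = max_at T i"
  proof -
    have "\<sigma> ` (T - {j}) = T - {i}"
      using i j by (auto simp: \<sigma>_def Transposition.transpose_def image_iff)
    moreover have "(\<forall>k\<in>T - {j}. x (\<sigma> k) < x i) \<longleftrightarrow> (\<forall>k\<in>\<sigma> ` (T - {j}). x k < x i)" for x :: "nat \<Rightarrow> real"
      by simp
    moreover have "\<sigma> j = i" by (simp add: \<sigma>_def)
    ultimately show ?thesis by (simp add: max_at_def)
  qed
  finally show ?thesis ..
qed

lemma disjoint_max_at: "disjoint_family_on (max_at T) T"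
  unfolding disjoint_family_on_def max_at_def by (auto dest: order.asym)

lemma measure_max_at_finite:
  assumes T: "finite T" and i: "i \<in> T"
  shows "measure iid (max_at T i) = 1 / card T"
proof -
  have "AE x in iid. \<forall>i\<in>T. \<forall>j\<in>T - {i}. x i \<noteq> x j"
    using T by (intro AE_finite_allI) (auto intro: AE_labels_distinct)
  then have "AE x in iid. x \<in> (\<Union>i\<in>T. max_at T i)"
  proof eventually_elim
    case (elim x)
    have "Max (x ` T) \<in> x ` T" using T i by (intro Max_in) auto
    then obtain m where m: "m \<in> T" "x m = Max (x ` T)" by (metis imageE)
    have "x k < x m" if "k \<in> T - {m}" for k
      using elim m that T Max_ge[of "x ` T" "x k"] by (metis DiffD1 finite_imageI image_eqI order_le_imp_less_or_eq)
    then show ?case using m(1) by (intro UN_I[of m]) (auto simp: max_at_def)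
  qed
  then have "measure iid (\<Union>i\<in>T. max_at T i) = 1"
    by (subst labels.prob_eq_1) (use T in auto)
  then have "1 = measure iid (\<Union>i\<in>T. max_at T i)" ..
  also have "\<dots> = (\<Sum>j\<in>T. measure iid (max_at T j))"
    by (intro labels.finite_measure_finite_Union T disjoint_max_at) auto
  also have "\<dots> = card T * measure iid (max_at T i)"
    using sum.cong[OF refl measure_max_at_eq[OF _ i], of T] by simp
  finally have "1 = card T * measure iid (max_at T i)" .
  moreover have "card T \<noteq> 0" using T i by auto
  ultimately show ?thesis by (simp add: field_simps)
qed

lemma AE_no_max_label: "AE x in iid. \<forall>i. \<exists>j. x i < x j"
proof -
  have "measure iid (max_at UNIV i) = 0" for i
  proof (rule ccontr)
    define p where "p = measure iid (max_at UNIV i)"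
    assume "measure iid (max_at UNIV i) \<noteq> 0"
    then have "0 < p" unfolding p_def by (simp add: zero_less_measure_iff)
    then obtain n :: nat where n: "1 < n * p" using reals_Archimedean3 by blast
    have "n * p = (\<Sum>j<n. measure iid (max_at UNIV j))"
      using sum.cong[OF refl measure_max_at_eq[of _ UNIV i], of "{..<n}"] by (simp add: p_def)
    also have "\<dots> = measure iid (\<Union>j\<in>{..<n}. max_at UNIV j)"
      by (rule labels.finite_measure_finite_Union[symmetric])
        (use disjoint_max_at[of UNIV] in \<open>auto intro: disjoint_family_on_mono\<close>)
    also have "\<dots> \<le> 1" by simp
    finally show False using n by simp
  qed
  then have "max_at UNIV i \<in> null_sets iid" for i
    by (simp add: null_sets_def labels.emeasure_eq_measure)
  then have "AE x in iid. \<forall>i. x \<notin> max_at UNIV i"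
    by (simp add: AE_all_countable AE_not_in)
  moreover have "AE x in iid. \<forall>i j. i \<noteq> j \<longrightarrow> x i \<noteq> x j"
    unfolding AE_all_countable
  proof (intro allI)
    show "AE x in iid. i \<noteq> j \<longrightarrow> x i \<noteq> x j" for i j
      using AE_labels_distinct[of i j] by (cases "i = j") auto
  qed
  ultimately show ?thesis
  proof eventually_elim
    case (elim x)
    show ?case
    proof
      fix i
      obtain k where "k \<noteq> i" "\<not> x k < x i" using elim(1) by (auto simp: max_at_def)
      then show "\<exists>j. x i < x j" using elim(2) by (metis linorder_neqE)
    qed
  qed
qed

locale countable_infinite_group = Group.group G for G :: "('g, 'n) monoid_scheme" (structure) +
  assumes countable_carrier: "countable (carrier G)" and infinite_carrier: "infinite (carrier G)"
begin

definition elt :: "nat \<Rightarrow> 'g" where "elt = from_nat_into (carrier G)"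

definition idx :: "'g \<Rightarrow> nat" where "idx = to_nat_on (carrier G)"

lemma elt_carrier [simp]: "elt i \<in> carrier G"
  unfolding elt_def using infinite_carrier by (intro from_nat_into) auto

lemma idx_elt [simp]: "idx (elt i) = i"
  unfolding elt_def idx_def using countable_carrier infinite_carrier by simp

lemma elt_idx [simp]: "g \<in> carrier G \<Longrightarrow> elt (idx g) = g"
  unfolding elt_def idx_def using countable_carrier by simp

lemma idx_eq_iff: "g \<in> carrier G \<Longrightarrow> h \<in> carrier G \<Longrightarrow> idx g = idx h \<longleftrightarrow> g = h"
  by (metis elt_idx)

text \<open>
  The label of the point \<open>g x\<close> of the orbit of \<open>x\<close> is the value of \<open>x\<close> at (the index of) \<open>g\<close>; see
  \<open>label_shift\<close> below. For this the group acts on labellings by right translation of the argument.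
\<close>

definition shift :: "'g \<Rightarrow> (nat \<Rightarrow> real) \<Rightarrow> nat \<Rightarrow> real" where
  "shift g x i = x (idx (elt i \<otimes> g))"

lemma inj_shift_index: "g \<in> carrier G \<Longrightarrow> inj (\<lambda>i. idx (elt i \<otimes> g))"
  by (intro injI) (metis elt_carrier idx_elt idx_eq_iff m_closed r_cancel)

lemma measurable_shift: "shift g \<in> iid \<rightarrow>\<^sub>M iid"
  using measurable_reindex_labels[of "\<lambda>i. idx (elt i \<otimes> g)"] by (simp add: shift_def[abs_def])

lemma distr_shift: "g \<in> carrier G \<Longrightarrow> distr iid iid (shift g) = iid"
  using distr_reindex_labels[OF inj_shift_index, of g] by (simp add: shift_def[abs_def])

lemma pmp_action_shift: "pmp_action G iid shift"
  unfolding pmp_action_def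
proof (intro conjI ballI measurable_shift distr_shift)
  show "group_action G (space iid) shift"
  proof (rule group_actionI)
    show "group G" ..
  qed (auto simp: shift_def fun_eq_iff m_assoc)
qed

definition label :: "(nat \<Rightarrow> real) \<Rightarrow> real" where
  "label x = x (idx \<one>)"

lemma label_shift: "g \<in> carrier G \<Longrightarrow> label (shift g x) = x (idx g)"
  by (simp add: label_def shift_def)

lemma free_action_shift: "free_action G iid shift"
  unfolding free_action_def
proof (rule AE_ball_countable[THEN iffD2])
  show "countable (carrier G - {\<one>})" using countable_carrier by simp
  show "\<forall>g\<in>carrier G - {\<one>}. AE x in iid. shift g x \<noteq> x"
  proof
    fix g assume g: "g \<in> carrier G - {\<one>}"
    then have "idx g \<noteq> idx \<one>" by (auto simp: idx_eq_iff)
    from AE_labels_distinct[OF this] show "AE x in iid. shift g x \<noteq> x"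
    proof eventually_elim
      case (elim x)
      then have "label (shift g x) \<noteq> label x" using g by (simp add: label_shift) (simp add: label_def)
      then show ?case by metis
    qed
  qed
qed

text \<open>
  For a cylinder \<open>A\<close> the two events depend on disjoint sets of coordinates, and hence are independent,
  for all but finitely many \<open>n\<close>. The general case follows since the sets \<open>A\<close> with this
  property form a Dynkin system; countable disjoint unions are handled by Tannery's theorem.
\<close>

lemma mixing_cylinder:
  assumes A: "A \<in> sets iid"
    and J: "finite J" "\<And>j. j \<in> J \<Longrightarrow> E j \<in> sets borel"
    and C: "C = {x. \<forall>j\<in>J. x j \<in> E j}"
  shows "(\<lambda>n. measure iid (A \<inter> shift (elt n) -` C)) \<longlonglongrightarrow> measure iid A * measure iid C"
proof -
  let ?S = "\<lambda>n. shift (elt n) -` C"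
  have C_meas: "C \<in> sets iid"
    using sets_PiM_I[of J UNIV E "\<lambda>_. uniform01"] J by (simp add: iid_def C prod_emb_uniform01)
  have S_meas: "?S n \<in> sets iid" for n
    using measurable_sets[OF measurable_shift C_meas] by simp
  have S_measure: "measure iid (?S n) = measure iid C" for n
    using measure_distr[OF measurable_shift C_meas, of "elt n"] by (simp add: distr_shift)
  have "A \<in> sigma_sets (\<Pi>\<^sub>E i\<in>UNIV. space uniform01) (prod_algebra UNIV (\<lambda>_. uniform01))"
    using A by (simp add: iid_def sets_PiM)
  with Int_stable_prod_algebra prod_algebra_sets_into_space show ?thesis
  proof (induction rule: sigma_sets_induct_disjoint)
    case (basic A)
    then obtain K F where A': "A = prod_emb UNIV (\<lambda>_. uniform01) K (\<Pi>\<^sub>E k\<in>K. F k)"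
      and K': "finite K" "\<And>i. i \<in> K \<Longrightarrow> F i \<in> sets uniform01"
      by (rule prod_algebraE) (rule that, assumption+)
    have A: "A = {x. \<forall>k\<in>K. x k \<in> F k}" using A' by (simp add: prod_emb_uniform01)
    have K: "finite K" "\<And>i. i \<in> K \<Longrightarrow> F i \<in> sets borel" using K' by simp_all
    have bad: "finite {n. \<exists>j\<in>J. \<exists>k\<in>K. idx (elt j \<otimes> elt n) = k}"
    proof -
      have "{n. \<exists>j\<in>J. \<exists>k\<in>K. idx (elt j \<otimes> elt n) = k} \<subseteq> (\<lambda>(j, k). idx (inv (elt j) \<otimes> elt k)) ` (J \<times> K)"
      proof
        fix n assume "n \<in> {n. \<exists>j\<in>J. \<exists>k\<in>K. idx (elt j \<otimes> elt n) = k}"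
        then obtain j k where jk: "j \<in> J" "k \<in> K" "idx (elt j \<otimes> elt n) = k" by blast
        then have "elt k = elt j \<otimes> elt n" by auto
        then have "inv (elt j) \<otimes> elt k = elt n" by (simp add: m_assoc[symmetric])
        then have "n = idx (inv (elt j) \<otimes> elt k)" by simp
        with jk show "n \<in> (\<lambda>(j, k). idx (inv (elt j) \<otimes> elt k)) ` (J \<times> K)" by auto
      qed
      then show ?thesis by (rule finite_subset) (use J K in auto)
    qed
    have indep: "measure iid (A \<inter> ?S n) = measure iid A * measure iid C"
      if n: "\<not> (\<exists>j\<in>J. \<exists>k\<in>K. idx (elt j \<otimes> elt n) = k)" for n
    proof -
      define \<sigma> where "\<sigma> = (\<lambda>j. idx (elt j \<otimes> elt n))"
      have inj: "inj \<sigma>" unfolding \<sigma>_def by (rule inj_shift_index) simp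
      have disj: "K \<inter> \<sigma> ` J = {}" using n by (auto simp: \<sigma>_def)
      \<comment> \<open>the conditions of \<open>A\<close> on \<open>K\<close> and the translated conditions of \<open>C\<close> on the disjoint set \<open>\<sigma> ` J\<close>\<close>
      define H where "H = (\<lambda>i. if i \<in> K then F i else E (the_inv \<sigma> i))"
      have H: "H k = F k" if "k \<in> K" for k using that by (simp add: H_def)
      have H': "H (\<sigma> j) = E j" if "j \<in> J" for j
        using that disj by (auto simp: H_def the_inv_f_f[OF inj])
      have eq: "A \<inter> ?S n = {x. \<forall>i\<in>K \<union> \<sigma> ` J. x i \<in> H i}"
      proof -
        have "?S n = {x. \<forall>j\<in>J. x (\<sigma> j) \<in> E j}" by (simp add: C shift_def \<sigma>_def vimage_def)
        moreover have "(\<forall>i\<in>K \<union> \<sigma> ` J. x i \<in> H i) \<longleftrightarrow> (\<forall>k\<in>K. x k \<in> F k) \<and> (\<forall>j\<in>J. x (\<sigma> j) \<in> E j)" for x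
          by (simp add: ball_Un H H')
        ultimately show ?thesis by (simp add: A set_eq_iff)
      qed
      have "emeasure iid (A \<inter> ?S n) = (\<Prod>i\<in>K \<union> \<sigma> ` J. emeasure uniform01 (H i))"
        unfolding eq by (rule emeasure_cylinder) (use J K H H' in auto)
      also have "\<dots> = (\<Prod>i\<in>K. emeasure uniform01 (H i)) * (\<Prod>i\<in>\<sigma> ` J. emeasure uniform01 (H i))"
        by (rule prod.union_disjoint) (use J K disj in auto)
      also have "(\<Prod>i\<in>\<sigma> ` J. emeasure uniform01 (H i)) = (\<Prod>j\<in>J. emeasure uniform01 (E j))"
        using inj H' by (subst prod.reindex) (auto intro: inj_on_subset)
      also have "\<dots> = emeasure iid C" unfolding C by (rule emeasure_cylinder[symmetric]) (use J in auto)
      also have "(\<Prod>i\<in>K. emeasure uniform01 (H i)) = (\<Prod>i\<in>K. emeasure uniform01 (F i))"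
        using H by simp
      also have "\<dots> = emeasure iid A" unfolding A by (rule emeasure_cylinder[symmetric]) (use K in auto)
      finally show ?thesis by (simp add: measure_def enn2real_mult)
    qed
    have "eventually (\<lambda>n. measure iid (A \<inter> ?S n) = measure iid A * measure iid C) sequentially"
      using bad unfolding cofinite_eq_sequentially[symmetric] eventually_cofinite
      by (rule finite_subset[rotated]) (use indep in auto)
    then show ?case by (rule tendsto_eventually)
  next
    case empty
    show ?case by simp
  next
    case (compl A)
    then have A: "A \<in> sets iid" by (simp add: iid_def sets_PiM)
    have "measure iid ((UNIV - A) \<inter> ?S n) = measure iid C - measure iid (A \<inter> ?S n)" for n
    proof -
      have "(UNIV - A) \<inter> ?S n = ?S n - A \<inter> ?S n" by auto
      then show ?thesis
        using A S_meas by (simp add: labels.finite_measure_Diff S_measure)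
    qed
    moreover have "measure iid (UNIV - A) = 1 - measure iid A"
      using labels.prob_compl[OF A] by simp
    moreover have "(\<lambda>n. measure iid C - measure iid (A \<inter> ?S n))
        \<longlonglongrightarrow> measure iid C - measure iid A * measure iid C"
      by (intro tendsto_intros compl.IH)
    ultimately have "(\<lambda>n. measure iid ((UNIV - A) \<inter> ?S n))
        \<longlonglongrightarrow> measure iid (UNIV - A) * measure iid C"
      by (simp add: left_diff_distrib)
    then show ?case by simp
  next
    case (union A)
    then have A: "range A \<subseteq> sets iid" by (simp add: iid_def sets_PiM)
    have sum_A: "(\<lambda>k. measure iid (A k)) sums measure iid (\<Union>k. A k)"
      by (rule labels.finite_measure_UNION[OF A union(1)])
    have sum_AS: "(\<lambda>k. measure iid (A k \<inter> ?S n)) sums measure iid ((\<Union>k. A k) \<inter> ?S n)" for n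
    proof -
      have "disjoint_family (\<lambda>k. A k \<inter> ?S n)"
        using union(1) unfolding disjoint_family_on_def by blast
      then have "(\<lambda>k. measure iid (A k \<inter> ?S n)) sums measure iid (\<Union>k. A k \<inter> ?S n)"
        using A S_meas by (intro labels.finite_measure_UNION) auto
      then show ?thesis by (simp add: Int_UN_distrib2)
    qed
    have "(\<lambda>n. \<Sum>k. measure iid (A k \<inter> ?S n)) \<longlonglongrightarrow> (\<Sum>k. measure iid (A k) * measure iid C)"
    proof (rule tannerys_theorem[THEN conjunct2, THEN conjunct2])
      show "eventually (\<lambda>(k, n). norm (measure iid (A k \<inter> ?S n)) \<le> measure iid (A k)) (at_top \<times>\<^sub>F sequentially)"
        using A S_meas by (intro always_eventually) (auto intro!: labels.finite_measure_mono)
      show "summable (\<lambda>k. measure iid (A k))" using sum_A by (rule sums_summable)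
    qed (use union.IH in auto)
    moreover have "(\<Sum>k. measure iid (A k) * measure iid C) = measure iid (\<Union>k. A k) * measure iid C"
      using sums_mult2[OF sum_A, of "measure iid C"] by (rule sums_unique[symmetric])
    ultimately show ?case using sums_unique[OF sum_AS] by simp
  qed
qed

text \<open>
  For invariant \<open>A\<close> the measure of \<open>A \<inter> g\<^sup>-\<^sup>1 C\<close> does not depend on \<open>g\<close>, so mixing makes \<open>A\<close>
  independent of every cylinder \<open>C\<close>. Therefore the measure conditioned on \<open>A\<close> agrees with the product
  measure on cylinders, and thus everywhere; in particular on \<open>A\<close> itself.
\<close>

theorem ergodic_shift:
  assumes A: "A \<in> sets iid" and inv: "\<And>g. g \<in> carrier G \<Longrightarrow> shift g -` A = A"
    and pos: "0 < measure iid A"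
  shows "measure iid A = 1"
proof -
  define P where "P = uniform_measure iid A"
  have eA: "emeasure iid A \<noteq> 0" using pos by (simp add: measure_def zero_less_iff_neq_zero enn2real_positive_iff)
  have P_eq: "P = iid"
    unfolding iid_def
  proof (rule iid.PiM_eq)
    show "sets P = sets (PiM UNIV (\<lambda>_. uniform01))" by (simp add: P_def iid_def)
    fix J :: "nat set" and E :: "nat \<Rightarrow> real set"
    assume J: "finite J" "J \<subseteq> UNIV" "\<And>j. j \<in> J \<Longrightarrow> E j \<in> sets uniform01"
    define C where "C = {x. \<forall>j\<in>J. x j \<in> E j}"
    have C_meas: "C \<in> sets iid"
      using sets_PiM_I[of J UNIV E "\<lambda>_. uniform01"] J by (simp add: iid_def C_def prod_emb_uniform01)
    have "measure iid (A \<inter> shift (elt n) -` C) = measure iid (A \<inter> C)" for n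
    proof -
      have "measure iid (A \<inter> C) = measure iid (shift (elt n) -` (A \<inter> C))"
        using measure_distr[OF measurable_shift, of "A \<inter> C" "elt n"] A C_meas by (simp add: distr_shift)
      then show ?thesis by (simp add: inv vimage_Int)
    qed
    moreover have "(\<lambda>n. measure iid (A \<inter> shift (elt n) -` C)) \<longlonglongrightarrow> measure iid A * measure iid C"
      by (rule mixing_cylinder[OF A _ _ C_def]) (use J in auto)
    ultimately have "measure iid (A \<inter> C) = measure iid A * measure iid C"
      by (simp add: LIMSEQ_const_iff)
    then have "measure P C = measure iid C"
      using pos A C_meas eA by (simp add: P_def)
    moreover have "prob_space P" unfolding P_def by (rule prob_space_uniform_measure) (use eA in auto)
    ultimately have "emeasure P C = emeasure iid C"
      by (simp add: labels.emeasure_eq_measure finite_measure.emeasure_eq_measure prob_space.finite_measure)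
    also have "\<dots> = (\<Prod>j\<in>J. emeasure uniform01 (E j))"
      unfolding C_def by (rule emeasure_cylinder) (use J in auto)
    finally show "emeasure P (prod_emb UNIV (\<lambda>_. uniform01) J (Pi\<^sub>E J E)) = (\<Prod>j\<in>J. emeasure uniform01 (E j))"
      by (simp add: C_def prod_emb_uniform01)
  qed
  have "measure P A = 1"
    using A eA pos by (simp add: P_def)
  then show ?thesis by (simp add: P_eq)
qed

end

section \<open>Finite sets almost invariant under translation\<close>

lemma (in Group.group) translation_action:
  assumes "countable (carrier G)"
  shows "measure_preserving_action G (count_space (carrier G)) (\<lambda>g. restrict (\<lambda>h. g \<otimes> h) (carrier G))"
proof (intro measure_preserving_action.intro measure_preserving_action_axioms.intro assms)
  show "group_action G (space (count_space (carrier G))) (\<lambda>g. restrict (\<lambda>h. g \<otimes> h) (carrier G))"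
    by (rule group_actionI) (auto simp: m_assoc is_group)
  fix g assume g: "g \<in> carrier G"
  show "restrict (\<lambda>h. g \<otimes> h) (carrier G) \<in> count_space (carrier G) \<rightarrow>\<^sub>M count_space (carrier G)"
    using g by auto
  have "bij_betw (restrict (\<lambda>h. g \<otimes> h) (carrier G)) (carrier G) (carrier G)"
    by (rule bij_betw_byWitness[where f' = "\<lambda>h. inv g \<otimes> h"]) (use g in \<open>auto simp: m_assoc[symmetric]\<close>)
  then show "distr (count_space (carrier G)) (count_space (carrier G)) (restrict (\<lambda>h. g \<otimes> h) (carrier G)) = count_space (carrier G)"
    by (rule distr_bij_count_space)
qed

context countable_infinite_group
begin

text \<open>
  Otherwise property (T), applied to the translation action with counting measure, would yield a
  nonempty finite invariant subset of the infinite group.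
\<close>

lemma kazhdan_boundary:
  assumes kp: "kazhdan_pair G Q \<epsilon>" and T: "finite T" "T \<noteq> {}" "T \<subseteq> carrier G"
  shows "\<exists>g\<in>Q. real (card (T \<inter> {h \<in> carrier G. inv g \<otimes> h \<in> T})) \<le> (1 - \<epsilon>\<^sup>2 / 2) * real (card T)"
proof (rule ccontr)
  assume neg: "\<not> ?thesis"
  have Q: "Q \<subseteq> carrier G" using kp by (simp add: kazhdan_pair_def)
  interpret L: measure_preserving_action G "count_space (carrier G)" "\<lambda>g. restrict (\<lambda>h. g \<otimes> h) (carrier G)"
    by (rule translation_action[OF countable_carrier])
  have vim: "T \<inter> (restrict (\<lambda>h. inv g \<otimes> h) (carrier G) -` T \<inter> carrier G) = T \<inter> {h \<in> carrier G. inv g \<otimes> h \<in> T}" for g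
    by auto
  show False
  proof (rule L.kazhdan_invariant_set[OF kp, of T])
    show "T \<in> sets (count_space (carrier G))" using T by simp
    show "emeasure (count_space (carrier G)) T < \<infinity>"
      using T by (simp add: emeasure_count_space_finite ennreal_of_nat_eq_real_of_nat)
    show "0 < measure (count_space (carrier G)) T"
      using T by (simp add: measure_count_space card_gt_0_iff)
    show "(1 - \<epsilon>\<^sup>2 / 2) * measure (count_space (carrier G)) T
        < measure (count_space (carrier G))
            (T \<inter> (restrict (\<lambda>h. inv g \<otimes> h) (carrier G) -` T \<inter> space (count_space (carrier G))))"
      if g: "g \<in> Q" for g
    proof -
      have "T \<inter> {h \<in> carrier G. inv g \<otimes> h \<in> T} \<subseteq> carrier G" by auto
      then show ?thesis using neg g T by (simp add: vim measure_count_space not_le)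
    qed
    fix D assume D: "D \<in> sets (count_space (carrier G))" "0 < emeasure (count_space (carrier G)) D"
      "emeasure (count_space (carrier G)) D < \<infinity>"
      and inv: "\<And>g z. \<lbrakk>g \<in> carrier G; z \<in> space (count_space (carrier G))\<rbrakk>
        \<Longrightarrow> restrict (\<lambda>h. g \<otimes> h) (carrier G) z \<in> D \<longleftrightarrow> z \<in> D"
    have D_sub: "D \<subseteq> carrier G" using D(1) by simp
    have "D \<noteq> {}" using D(2) by auto
    then obtain z where z: "z \<in> D" "z \<in> carrier G" using D_sub by auto
    have "h \<in> D" if h: "h \<in> carrier G" for h
      using inv[of "h \<otimes> inv z" z] z h by (simp add: m_assoc)
    then have "carrier G \<subseteq> D" by (rule subsetI)
    then have "infinite D" by (rule infinite_super[OF _ infinite_carrier])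
    then show False using D(3) D_sub by (simp add: emeasure_count_space)
  qed
qed

definition nbrs :: "'g set \<Rightarrow> 'g set" where
  "nbrs Q = (Q \<union> (\<lambda>g. inv g) ` Q) - {\<one>}"

lemma nbrs:
  assumes Q: "Q \<subseteq> carrier G" "finite Q"
  shows "nbrs Q \<subseteq> carrier G" "finite (nbrs Q)" "\<one> \<notin> nbrs Q" "card (insert \<one> (nbrs Q)) \<le> 2 * card Q + 1"
proof -
  show "nbrs Q \<subseteq> carrier G" "finite (nbrs Q)" "\<one> \<notin> nbrs Q" using Q by (auto simp: nbrs_def)
  have "card (nbrs Q) \<le> card (Q \<union> (\<lambda>g. inv g) ` Q)" using Q by (intro card_mono) (auto simp: nbrs_def)
  also have "\<dots> \<le> card Q + card ((\<lambda>g. inv g) ` Q)" by (rule card_Un_le)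
  also have "\<dots> \<le> 2 * card Q" using card_image_le[OF Q(2), of "\<lambda>g. inv g"] by simp
  finally show "card (insert \<one> (nbrs Q)) \<le> 2 * card Q + 1"
    using \<open>finite (nbrs Q)\<close> \<open>\<one> \<notin> nbrs Q\<close> by simp
qed

text \<open>
  Take the ball \<open>T\<close> of radius \<open>1\<close> in the Cayley graph. For \<open>g\<close> in \<open>Q\<close> with \<open>g \<noteq> 1\<close> both \<open>1\<close> and \<open>g\<close> lie in
  \<open>T \<inter> g T\<close>.
\<close>

lemma kazhdan_constant_bound:
  assumes kp: "kazhdan_pair G Q \<epsilon>"
  shows "2 / (2 * real (card Q) + 1) \<le> 1 - \<epsilon>\<^sup>2 / 2"
proof -
  have Q: "Q \<subseteq> carrier G" "finite Q" "0 < \<epsilon>" using kp by (auto simp: kazhdan_pair_def)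
  define T where "T = insert \<one> (nbrs Q)"
  have T: "finite T" "T \<noteq> {}" "T \<subseteq> carrier G" "card T \<le> 2 * card Q + 1"
    using nbrs[OF Q(1,2)] by (auto simp: T_def)
  obtain g where g: "g \<in> Q" "real (card (T \<inter> {h \<in> carrier G. inv g \<otimes> h \<in> T})) \<le> (1 - \<epsilon>\<^sup>2 / 2) * real (card T)"
    using kazhdan_boundary[OF kp T(1-3)] by blast
  have gc: "g \<in> carrier G" using g Q by auto
  have "g \<noteq> \<one>"
  proof
    assume "g = \<one>"
    moreover have "T \<inter> {h \<in> carrier G. inv \<one> \<otimes> h \<in> T} = T" using T(3) by auto
    ultimately have "real (card T) \<le> (1 - \<epsilon>\<^sup>2 / 2) * real (card T)" using g(2) by simp
    moreover have "0 < \<epsilon>\<^sup>2 * real (card T)" using Q(3) T by (simp add: card_gt_0_iff)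
    ultimately show False by (simp add: algebra_simps)
  qed
  then have "{\<one>, g} \<subseteq> T \<inter> {h \<in> carrier G. inv g \<otimes> h \<in> T}"
    using g(1) gc by (auto simp: T_def nbrs_def)
  then have "card {\<one>, g} \<le> card (T \<inter> {h \<in> carrier G. inv g \<otimes> h \<in> T})"
    using T by (intro card_mono) auto
  then have *: "2 \<le> (1 - \<epsilon>\<^sup>2 / 2) * real (card T)" using g(2) \<open>g \<noteq> \<one>\<close> by simp
  then have "0 < (1 - \<epsilon>\<^sup>2 / 2) * real (card T)" by linarith
  then have "0 < 1 - \<epsilon>\<^sup>2 / 2" using zero_less_mult_pos2[of "1 - \<epsilon>\<^sup>2 / 2" "real (card T)"] T by (simp add: card_gt_0_iff)
  then have "(1 - \<epsilon>\<^sup>2 / 2) * real (card T) \<le> (1 - \<epsilon>\<^sup>2 / 2) * (2 * real (card Q) + 1)"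
    using T(4) by (intro mult_left_mono) auto
  with * have "2 \<le> (1 - \<epsilon>\<^sup>2 / 2) * (2 * real (card Q) + 1)" by linarith
  then show ?thesis by (simp add: field_simps)
qed

text \<open>
  An infinite group with one generator is infinite cyclic, and the intervals \<open>{1, a, \<dots>, a\<^sup>k\<^sup>-\<^sup>1}\<close>
  are moved too little by \<open>a\<close>.
\<close>

lemma kazhdan_card_ge_2:
  assumes kp: "kazhdan_pair G Q \<epsilon>"
  shows "2 \<le> card Q"
proof (rule ccontr)
  have Q: "Q \<subseteq> carrier G" "finite Q" "0 < \<epsilon>" "generate G Q = carrier G" using kp by (auto simp: kazhdan_pair_def)
  assume "\<not> 2 \<le> card Q"
  then consider "card Q = 0" | "card Q = 1" by linarith
  then show False
  proof cases
    case 1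
    then have "carrier G = {\<one>}" using Q generate_empty by simp
    then show False using infinite_carrier by simp
  next
    case 2
    then obtain a where a: "Q = {a}" by (auto simp: card_1_singleton_iff)
    have ac: "a \<in> carrier G" using Q a by simp
    have "ord a = 0"
    proof (rule ccontr)
      assume "ord a \<noteq> 0"
      then have "finite (generate G {a})"
        using finite_cyclic_subgroup[OF ac] pow_ord_eq_1[OF ac] ac
        by (metis carrier_subgroup_generated Int_insert_right_if1 Int_empty_right)
      then show False using infinite_carrier Q a by simp
    qed
    then have inj: "inj (\<lambda>i::nat. a [^] i)"
    proof (intro injI)
      fix i j :: nat assume eq: "a [^] i = a [^] j"
      then have "a [^] (i - j) = \<one>" "a [^] (j - i) = \<one>"
        using ac pow_eq_div2[of a i j] pow_eq_div2[of a j i] by simp_all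
      then show "i = j" using ac \<open>ord a = 0\<close> by (simp add: pow_eq_id)
    qed
    obtain k :: nat where k: "1 / (\<epsilon>\<^sup>2 / 2) < real k" using reals_Archimedean2 by blast
    have kpos: "0 < k"
      using k Q(3) by (cases "k = 0") (auto simp: field_simps)
    define T where "T = (\<lambda>i::nat. a [^] i) ` {..<k}"
    have card_T: "card T = k" using inj by (simp add: T_def card_image inj_on_subset)
    have T: "finite T" "T \<noteq> {}" "T \<subseteq> carrier G" using ac kpos by (auto simp: T_def)
    have bd: "real (card (T \<inter> {h \<in> carrier G. inv a \<otimes> h \<in> T})) \<le> (1 - \<epsilon>\<^sup>2 / 2) * real k"
      using kazhdan_boundary[OF kp T] by (simp add: a card_T)
    have "(\<lambda>i::nat. a [^] i) ` {1..<k} \<subseteq> T \<inter> {h \<in> carrier G. inv a \<otimes> h \<in> T}"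
    proof
      fix h assume "h \<in> (\<lambda>i::nat. a [^] i) ` {1..<k}"
      then obtain j where j: "1 \<le> j" "j < k" "h = a [^] j" by auto
      define i where "i = j - 1"
      have i: "Suc i < k" "h = a [^] Suc i" using j by (simp_all add: i_def)
      have "h = a \<otimes> a [^] i" using i(2) ac nat_pow_Suc2 by simp
      then have "inv a \<otimes> h = a [^] i" using ac by (simp add: m_assoc[symmetric])
      then show "h \<in> T \<inter> {h \<in> carrier G. inv a \<otimes> h \<in> T}"
        using j i(1) ac by (auto simp: T_def)
    qed
    then have "card ((\<lambda>i::nat. a [^] i) ` {1..<k}) \<le> card (T \<inter> {h \<in> carrier G. inv a \<otimes> h \<in> T})"
      using T by (intro card_mono) auto
    moreover have "card ((\<lambda>i::nat. a [^] i) ` {1..<k}) = k - 1"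
      using inj by (simp add: card_image inj_on_subset)
    ultimately have "real k - 1 \<le> (1 - \<epsilon>\<^sup>2 / 2) * real k" using bd kpos by linarith
    then show False using k Q(3) by (simp add: field_simps)
  qed
qed

section \<open>Arcs along which the labels increase\<close>

definition first :: "('g \<Rightarrow> bool) \<Rightarrow> 'g" where
  "first P = elt (LEAST n. P (elt n))"

lemma first_carrier [simp]: "first P \<in> carrier G"
  by (simp add: first_def)

lemma first_satisfies:
  assumes "g \<in> carrier G" "P g"
  shows "P (first P)"
  unfolding first_def by (rule LeastI[of "\<lambda>n. P (elt n)" "idx g"]) (use assms in simp)

lemma first_unique:
  assumes "g \<in> carrier G" "P g" "\<And>h. P h \<Longrightarrow> h = g"
  shows "first P = g"
  using first_satisfies[of g P] assms by blast

lemma first_measurable: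
  assumes "\<And>h. h \<in> carrier G \<Longrightarrow> {x \<in> space M. P x h} \<in> sets M" and g: "g \<in> carrier G"
  shows "{x \<in> space M. first (P x) = g} \<in> sets M"
proof -
  have "(\<lambda>x. LEAST n. P x (elt n)) \<in> M \<rightarrow>\<^sub>M count_space UNIV"
    by (rule measurable_Least) (use assms(1) in \<open>simp add: pred_def\<close>)
  then have "(\<lambda>x. LEAST n. P x (elt n)) -` {idx g} \<inter> space M \<in> sets M"
    by (rule measurable_sets) simp
  also have "(\<lambda>x. LEAST n. P x (elt n)) -` {idx g} \<inter> space M = {x \<in> space M. first (P x) = g}"
    using g by (auto simp: first_def)
  finally show ?thesis .
qed

lemma sum_level_sets:
  assumes k: "\<And>x. x \<in> space M \<Longrightarrow> k x \<in> carrier G"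
    and m: "\<And>g. g \<in> carrier G \<Longrightarrow> {x \<in> space M. k x = g} \<in> sets M"
  shows "(\<integral>\<^sup>+g. emeasure M {x \<in> space M. k x = g} \<partial>count_space (carrier G)) = emeasure M (space M)"
proof -
  have "emeasure M (\<Union>g\<in>carrier G. {x \<in> space M. k x = g})
      = (\<integral>\<^sup>+g. emeasure M {x \<in> space M. k x = g} \<partial>count_space (carrier G))"
    by (rule emeasure_UN_countable) (use m countable_carrier in \<open>auto simp: disjoint_family_on_def\<close>)
  moreover have "(\<Union>g\<in>carrier G. {x \<in> space M. k x = g}) = space M" using k by auto
  ultimately show ?thesis by simp
qed

text \<open>
  The points of the ball of radius \<open>1\<close> about \<open>x\<close> in the Cayley graph have the labels of \<open>x\<close> at the
  indices of \<open>1\<close> and of \<open>nbrs Q\<close>; the event is that \<open>s x\<close> has the largest of them.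
\<close>

definition is_peak :: "'g set \<Rightarrow> 'g \<Rightarrow> (nat \<Rightarrow> real) set" where
  "is_peak Q s = max_at (idx ` insert \<one> (nbrs Q)) (idx s)"

text \<open>
  The second alternative applies when \<open>x\<close> itself has the largest label in its ball. The value is
  the first group element that is suitable, so that it depends measurably on \<open>x\<close>.
\<close>

definition nxt :: "'g set \<Rightarrow> (nat \<Rightarrow> real) \<Rightarrow> 'g" where
  "nxt Q x = first (\<lambda>g. g \<in> nbrs Q \<and> x \<in> is_peak Q g \<or>
     (\<forall>s\<in>nbrs Q. x \<notin> is_peak Q s) \<and> label x < label (shift g x))"

lemma is_peak_measurable [measurable]: "is_peak Q s \<in> sets iid"
  by (simp add: is_peak_def)

lemma measurable_label_fn [measurable]: "label \<in> borel_measurable iid"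
  unfolding label_def[abs_def] by measurable

lemma nxt_measurable:
  assumes Q: "Q \<subseteq> carrier G" "finite Q" and g: "g \<in> carrier G"
  shows "{x. nxt Q x = g} \<in> sets iid"
proof -
  have "{x \<in> space iid. nxt Q x = g} \<in> sets iid"
    unfolding nxt_def
  proof (rule first_measurable[OF _ g])
    fix h
    note [measurable] = measurable_shift[of h]
    have p1: "{x \<in> space iid. \<forall>s\<in>nbrs Q. x \<notin> is_peak Q s} \<in> sets iid"
    proof (rule sets.sets_Collect_countable_All')
      show "{x \<in> space iid. x \<notin> is_peak Q s} \<in> sets iid" for s by measurable
    qed (use nbrs(2)[OF Q] in \<open>simp add: countable_finite\<close>)
    have p2: "{x \<in> space iid. label x < label (shift h x)} \<in> sets iid" by measurable
    have p3: "{x \<in> space iid. h \<in> nbrs Q \<and> x \<in> is_peak Q h} \<in> sets iid"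
      by (intro sets.sets_Collect_conj sets.sets_Collect_const) measurable
    show "{x \<in> space iid. h \<in> nbrs Q \<and> x \<in> is_peak Q h \<or>
        (\<forall>s\<in>nbrs Q. x \<notin> is_peak Q s) \<and> label x < label (shift h x)} \<in> sets iid"
      by (rule sets.sets_Collect_disj[OF sets.sets_Collect_conj[OF p2 p1] p3])
  qed
  then show ?thesis by simp
qed

lemma is_peak_label:
  assumes Q: "Q \<subseteq> carrier G" "finite Q" and s: "s \<in> nbrs Q" and x: "x \<in> is_peak Q s"
  shows "label x < label (shift s x)"
proof -
  have "s \<in> carrier G" "s \<noteq> \<one>" using nbrs[OF Q] s by auto
  then have "x (idx \<one>) < x (idx s)"
    using x idx_eq_iff[of \<one> s] by (auto simp: is_peak_def max_at_def)
  then show ?thesis using \<open>s \<in> carrier G\<close> by (simp only: label_shift label_def[of x])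
qed

lemma nxt_increases:
  assumes Q: "Q \<subseteq> carrier G" "finite Q" and x: "\<exists>j. x (idx \<one>) < x j"
  shows "label x < label (shift (nxt Q x) x)"
proof -
  let ?P = "\<lambda>g. g \<in> nbrs Q \<and> x \<in> is_peak Q g \<or>
     (\<forall>s\<in>nbrs Q. x \<notin> is_peak Q s) \<and> label x < label (shift g x)"
  obtain j where j: "x (idx \<one>) < x j" using x by blast
  have "label x < label (shift (elt j) x)" using j by (simp only: label_shift elt_carrier idx_elt label_def[of x])
  then have "\<exists>g\<in>carrier G. ?P g" using nbrs(1)[OF Q] elt_carrier by blast
  then obtain g where "g \<in> carrier G" "?P g" by blast
  then have "?P (nxt Q x)" unfolding nxt_def by (rule first_satisfies)
  then show ?thesis using is_peak_label[OF Q] by blast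
qed

lemma nxt_peak:
  assumes Q: "Q \<subseteq> carrier G" "finite Q" and s: "s \<in> nbrs Q" and x: "x \<in> is_peak Q s"
  shows "nxt Q x = s"
  unfolding nxt_def
proof (rule first_unique)
  show sc: "s \<in> carrier G" using nbrs[OF Q] s by auto
  fix g assume "g \<in> nbrs Q \<and> x \<in> is_peak Q g \<or>
     (\<forall>s\<in>nbrs Q. x \<notin> is_peak Q s) \<and> label x < label (shift g x)"
  then have g: "g \<in> nbrs Q" "x \<in> is_peak Q g" using s x by auto
  have "idx g = idx s"
  proof (rule ccontr)
    assume "idx g \<noteq> idx s"
    then have "is_peak Q g \<inter> is_peak Q s = {}"
      using disjoint_max_at[of "idx ` insert \<one> (nbrs Q)"] g(1) s
      unfolding is_peak_def disjoint_family_on_def by blast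
    then show False using g(2) x by blast
  qed
  then show "g = s" using idx_eq_iff[of g s] nbrs(1)[OF Q] g(1) sc by auto
qed (use s x in auto)

definition edge_event :: "'g set \<Rightarrow> 'g \<Rightarrow> (nat \<Rightarrow> real) set" where
  "edge_event Q g = is_peak Q g \<union> shift g -` is_peak Q (inv g)"

lemma edge_event_measurable [measurable]: "edge_event Q g \<in> sets iid"
proof -
  have "shift g -` is_peak Q (inv g) \<inter> space iid \<in> sets iid"
    by (rule measurable_sets[OF measurable_shift]) measurable
  then show ?thesis by (simp add: edge_event_def)
qed

text \<open>
  The events that \<open>x\<close> chooses \<open>g x\<close> and that \<open>g x\<close> chooses \<open>x\<close> have the probability with which a given one of
  at most \<open>2 card Q + 1\<close> labels is the largest. They exclude each other, since a point is
  never chosen by a point with a larger label.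
\<close>

lemma measure_edge_event:
  assumes Q: "Q \<subseteq> carrier G" "finite Q" and g: "g \<in> Q" "g \<noteq> \<one>"
  shows "2 / (2 * real (card Q) + 1) \<le> measure iid (edge_event Q g)"
proof -
  let ?T = "insert \<one> (nbrs Q)"
  have gc: "g \<in> carrier G" using g Q by auto
  have inv_ne: "inv g \<noteq> \<one>" using g gc by (metis inv_inv inv_one)
  have gS: "g \<in> nbrs Q" and igS: "inv g \<in> nbrs Q" using g inv_ne by (auto simp: nbrs_def)
  have sub: "?T \<subseteq> carrier G" using nbrs[OF Q] by auto
  then have "card (idx ` ?T) = card ?T"
    by (intro card_image inj_onI) (use idx_eq_iff in blast)
  then have card: "0 < card (idx ` ?T)" "card (idx ` ?T) \<le> 2 * card Q + 1"
    using nbrs[OF Q] by (auto simp: card_gt_0_iff)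
  have peak: "measure iid (is_peak Q s) = 1 / card (idx ` ?T)" if "s \<in> nbrs Q" for s
    unfolding is_peak_def by (rule measure_max_at_finite) (use that nbrs(2)[OF Q] in auto)
  have pre: "shift g -` is_peak Q (inv g) \<in> sets iid"
    "measure iid (shift g -` is_peak Q (inv g)) = measure iid (is_peak Q (inv g))"
    using measurable_sets[OF measurable_shift, of "is_peak Q (inv g)" g]
      measure_distr[OF measurable_shift, of "is_peak Q (inv g)" g] by (simp_all add: distr_shift[OF gc])
  have "is_peak Q g \<inter> shift g -` is_peak Q (inv g) = {}"
  proof (rule ccontr)
    assume "is_peak Q g \<inter> shift g -` is_peak Q (inv g) \<noteq> {}"
    then obtain x where x: "x \<in> is_peak Q g" "shift g x \<in> is_peak Q (inv g)" by blast
    have "label (shift (inv g) (shift g x)) = label x"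
      using gc by (simp add: label_shift) (simp add: shift_def label_def)
    then show False using is_peak_label[OF Q gS x(1)] is_peak_label[OF Q igS x(2)] by simp
  qed
  then have "measure iid (edge_event Q g) = 2 / card (idx ` ?T)"
    unfolding edge_event_def using pre(1) peak[OF gS] peak[OF igS] pre(2)
    by (subst labels.finite_measure_Union) auto
  moreover have "2 / (2 * real (card Q) + 1) \<le> 2 / real (card (idx ` ?T))"
    using card by (intro divide_left_mono) auto
  ultimately show ?thesis by simp
qed

text \<open>
  Outside \<open>E\<close>, the set \<open>W\<close> is cut out by an upper bound for the label of \<open>x\<close>. Raising this bound in steps
  of less than \<open>\<delta>\<close> increases the measure of the union by less than \<open>\<delta>\<close> at a time.
\<close>

lemma complementary_set_of_measure:
  assumes E: "E \<in> sets iid" and p: "p < 1" and \<delta>: "0 < \<delta>"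
  obtains W where "W \<in> sets iid" "p < measure iid (E \<union> W)"
    "measure iid W \<le> max 0 (p + \<delta> - measure iid E)"
proof -
  obtain K :: nat where K: "1 / real (Suc K) < \<delta>" using nat_approx_posE[OF \<delta>] by blast
  define L where "L = (\<lambda>k::nat. {x. label x \<le> real k / real (Suc K)})"
  have L_meas [measurable]: "L k \<in> sets iid" for k
  proof -
    have "{x \<in> space iid. label x \<le> real k / real (Suc K)} \<in> sets iid" by measurable
    then show ?thesis by (simp add: L_def)
  qed
  have L: "measure iid (L k) = real k / real (Suc K)" if "k \<le> Suc K" for k
    unfolding L_def label_def by (rule measure_label_le) (use that in auto)
  have mono: "L k \<subseteq> L (Suc k)" for k
    by (auto simp: L_def elim!: order_trans intro!: divide_right_mono)
  have "p < measure iid (E \<union> L (Suc K))"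
  proof -
    have "measure iid (L (Suc K)) \<le> measure iid (E \<union> L (Suc K))"
      by (intro labels.finite_measure_mono) (use E in auto)
    then show ?thesis using L[of "Suc K"] p by simp
  qed
  then have ex: "\<exists>k. p < measure iid (E \<union> L k)" by blast
  define k where "k = (LEAST k. p < measure iid (E \<union> L k))"
  have k: "p < measure iid (E \<union> L k)" unfolding k_def by (rule LeastI_ex[OF ex])
  have k_le: "k \<le> Suc K" unfolding k_def by (rule Least_le) fact
  have "measure iid (L k - E) \<le> max 0 (p + \<delta> - measure iid E)"
  proof (cases k)
    case 0
    have "measure iid (L k - E) \<le> measure iid (L k)"
      by (intro labels.finite_measure_mono) auto
    then show ?thesis using L[of 0] 0 by simp
  next
    case (Suc j)
    have j: "measure iid (E \<union> L j) \<le> p"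
      using not_less_Least[of j "\<lambda>k. p < measure iid (E \<union> L k)"] Suc k_def by auto
    have "measure iid (L k - L j) = measure iid (L k) - measure iid (L j)"
      by (rule labels.finite_measure_Diff) (use mono Suc in auto)
    also have "\<dots> = 1 / real (Suc K)"
      using L[of k] L[of j] k_le Suc by (simp add: field_simps)
    finally have step: "measure iid (L k - L j) = 1 / real (Suc K)" .
    have "measure iid E + measure iid (L k - E) = measure iid (E \<union> (L k - E))"
      by (rule labels.finite_measure_Union[symmetric]) (use E in auto)
    also have "\<dots> \<le> measure iid ((E \<union> L j) \<union> (L k - L j))"
      by (intro labels.finite_measure_mono) (use E in auto)
    also have "\<dots> \<le> measure iid (E \<union> L j) + measure iid (L k - L j)"
      by (rule measure_Un_le) (use E in auto)
    also have "\<dots> \<le> p + \<delta>" using j step K by simp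
    finally show ?thesis by simp
  qed
  moreover have "E \<union> (L k - E) = E \<union> L k" by auto
  ultimately show thesis using k E by (intro that[of "L k - E"]) auto
qed

end

section \<open>Connecting a relation of finite index\<close>

lemma (in measure_preserving_action) random_equivalence_arc_conn:
  assumes "prob_space N" "\<And>g. g \<in> carrier G \<Longrightarrow> A g \<in> sets N"
  shows "random_equivalence G N \<beta> (arc_conn A)"
  by (intro random_equivalence.intro random_equivalence_axioms.intro measure_preserving_action_axioms assms(1)
      equiv_arc_conn arc_conn_measurable[OF assms(2)] arc_conn_equivariant)

context countable_infinite_group
begin

sublocale act: measure_preserving_action G iid shift
  using pmp_action_shift countable_carrier
  by (intro measure_preserving_action.intro measure_preserving_action_axioms.intro) (auto simp: pmp_action_def)

text \<open>
  The identity is excluded, since it would only add loops; every point is equivalent to itself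
  anyway.
\<close>

definition arcs :: "'g set \<Rightarrow> ('g \<Rightarrow> (nat \<Rightarrow> real) set) \<Rightarrow> 'g \<Rightarrow> (nat \<Rightarrow> real) set" where
  "arcs Q W g = {x. nxt Q x = g} \<union> (if g \<in> Q - {\<one>} then W g else {})"

lemma shift_mult: "g \<in> carrier G \<Longrightarrow> h \<in> carrier G \<Longrightarrow> shift g (shift h x) = shift (g \<otimes> h) x"
  using act.composition_rule[of x g h] by simp

lemma shift_one: "shift \<one> x = x"
  using act.action_one[of x] by simp

lemma nxt_carrier [simp]: "nxt Q x \<in> carrier G"
  by (simp add: nxt_def)

lemma arcs_measurable:
  assumes "Q \<subseteq> carrier G" "finite Q" "\<And>g. g \<in> Q \<Longrightarrow> W g \<in> sets iid" "g \<in> carrier G"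
  shows "arcs Q W g \<in> sets iid"
  using nxt_measurable[OF assms(1,2,4)] assms(3)[of g] by (simp add: arcs_def)

lemma arcs_connect_generator:
  assumes Q: "Q \<subseteq> carrier G" "finite Q" and g: "g \<in> Q" and x: "g = \<one> \<or> x \<in> edge_event Q g \<union> W g"
  shows "(\<one>, g) \<in> act.arc_conn (arcs Q W) x"
proof (cases "g = \<one>")
  case True
  then show ?thesis by (simp add: act.arc_conn_def)
next
  case False
  have gc: "g \<in> carrier G" using g Q by auto
  have "inv g \<noteq> \<one>" using False gc by (metis inv_inv inv_one)
  then have S: "g \<in> nbrs Q" "inv g \<in> nbrs Q" using g False by (auto simp: nbrs_def)
  have "x \<in> arcs Q W g \<or> shift g x \<in> arcs Q W (inv g)"
    using x False g nxt_peak[OF Q S(1), of x] nxt_peak[OF Q S(2), of "shift g x"]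
    by (auto simp: edge_event_def arcs_def)
  then show ?thesis using gc by (intro act.arc_connI) (simp add: act.arc_rel_def shift_one)
qed

lemma arcs_connect_nxt:
  "(\<one>, nxt Q x) \<in> act.arc_conn (arcs Q W) x"
  by (intro act.arc_connI) (simp add: act.arc_rel_def shift_one arcs_def)

text \<open>
  Inside \<open>B\<close> the arcs are kept, and every point outside \<open>B\<close> has a single arc, which leads to \<open>B\<close>. The
  arcs \<open>J\<close> will join the classes in \<open>B\<close>.
\<close>

definition repaired_arcs :: "'g set \<Rightarrow> ('g \<Rightarrow> (nat \<Rightarrow> real) set) \<Rightarrow> (nat \<Rightarrow> real) set \<Rightarrow>
    ('g \<Rightarrow> (nat \<Rightarrow> real) set) \<Rightarrow> 'g \<Rightarrow> (nat \<Rightarrow> real) set" where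
  "repaired_arcs Q W B J g =
     {x. (if x \<in> B then nxt Q x else first (\<lambda>h. shift h x \<in> B)) = g} \<union>
     (if g \<in> Q - {\<one>} then W g \<inter> B else {}) \<union> J g"

text \<open>
  As \<open>B\<close> is a union of classes, a path from \<open>u\<close> to \<open>v\<close> does not leave it, and its arcs are kept.
\<close>

lemma repaired_arcs_connect_within:
  assumes B: "\<And>g h. (g, h) \<in> act.arc_conn (arcs Q W) x \<Longrightarrow> shift g x \<in> B \<longleftrightarrow> shift h x \<in> B"
    and uv: "(u, v) \<in> act.arc_conn (arcs Q W) x" and uB: "shift u x \<in> B"
  shows "(u, v) \<in> act.arc_conn (repaired_arcs Q W B J) x"
proof -
  have u: "u \<in> carrier G" and v: "v \<in> carrier G" using uv by (auto simp: act.arc_conn_def)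
  have "(u, v) \<in> (act.arc_rel (arcs Q W) x)\<^sup>*" using uv by (simp add: act.arc_conn_def)
  then have "(u, v) \<in> (act.arc_rel (repaired_arcs Q W B J) x)\<^sup>*"
  proof (induction rule: rtrancl_induct)
    case (step y z)
    have yz: "y \<in> carrier G" "z \<in> carrier G" using step(2) by (auto simp: act.arc_rel_def)
    have "shift y x \<in> B" using B[of u y] step(1) u yz uB by (simp add: act.arc_conn_def)
    moreover have "shift z x \<in> B" using B[OF act.arc_connI[OF step(2)]] calculation by simp
    moreover have "arcs Q W g \<inter> B \<subseteq> repaired_arcs Q W B J g" for g
      by (auto simp: arcs_def repaired_arcs_def)
    ultimately have "(y, z) \<in> act.arc_rel (repaired_arcs Q W B J) x"
      using step(2) by (auto simp: act.arc_rel_def)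
    with step(3) show ?case by (rule rtrancl_into_rtrancl)
  qed simp
  then show ?thesis using u v by (simp add: act.arc_conn_def)
qed

lemma shift_vimage_sets: "B \<in> sets iid \<Longrightarrow> {x. shift g x \<in> B} \<in> sets iid"
  using measurable_sets[OF measurable_shift, of B g] by (simp add: vimage_def)

text \<open>
  The union of the orbits that meet \<open>B\<close> is invariant.
\<close>

lemma ergodic_hits:
  assumes B: "B \<in> sets iid" "0 < measure iid B"
  shows "AE x in iid. \<exists>g\<in>carrier G. shift g x \<in> B"
proof -
  define Y where "Y = {x. \<exists>g\<in>carrier G. shift g x \<in> B}"
  have Y_sets: "Y \<in> sets iid"
  proof -
    have "{x \<in> space iid. \<exists>g\<in>carrier G. shift g x \<in> B} \<in> sets iid"
      using shift_vimage_sets[OF B(1)] by (intro sets.sets_Collect_countable_Ex' countable_carrier) simp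
    then show ?thesis by (simp add: Y_def)
  qed
  moreover have "shift g -` Y = Y" if g: "g \<in> carrier G" for g
  proof -
    have "(\<exists>h\<in>carrier G. shift h (shift g x) \<in> B) \<longleftrightarrow> (\<exists>h\<in>carrier G. shift h x \<in> B)" for x
    proof
      assume "\<exists>h\<in>carrier G. shift h (shift g x) \<in> B"
      then show "\<exists>h\<in>carrier G. shift h x \<in> B" using g by (metis shift_mult m_closed)
    next
      assume "\<exists>h\<in>carrier G. shift h x \<in> B"
      then obtain h where h: "h \<in> carrier G" "shift h x \<in> B" by blast
      then have "shift (h \<otimes> inv g) (shift g x) \<in> B" using g by (simp add: shift_mult m_assoc)
      then show "\<exists>h\<in>carrier G. shift h (shift g x) \<in> B" using h g by (intro bexI[of _ "h \<otimes> inv g"]) auto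
    qed
    then show ?thesis by (auto simp: Y_def)
  qed
  moreover have "0 < measure iid Y"
  proof -
    have "x \<in> Y" if "x \<in> B" for x
      unfolding Y_def using that by (intro CollectI bexI[of _ \<one>]) (simp_all add: shift_one)
    then have "measure iid B \<le> measure iid Y"
      using Y_sets by (intro labels.finite_measure_mono) auto
    then show ?thesis using B(2) by simp
  qed
  ultimately have "measure iid Y = 1" by (intro ergodic_shift)
  then show ?thesis
    using labels.prob_eq_1[OF Y_sets] by (simp add: Y_def)
qed

end

locale label_percolation = countable_infinite_group G for G :: "('g, 'n) monoid_scheme" (structure) +
  fixes Q :: "'g set" and W :: "'g \<Rightarrow> (nat \<Rightarrow> real) set"
  assumes Q_carrier: "Q \<subseteq> carrier G" and finite_Q: "finite Q"
    and W_sets: "W g \<in> sets iid"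
begin

lemma arcs_sets: "g \<in> carrier G \<Longrightarrow> arcs Q W g \<in> sets iid"
  by (rule arcs_measurable[OF Q_carrier finite_Q W_sets])

definition F :: "(nat \<Rightarrow> real) \<Rightarrow> 'g rel" where
  "F = act.arc_conn (arcs Q W)"

sublocale R: random_equivalence G iid shift F
  unfolding F_def by (rule act.random_equivalence_arc_conn[OF labels.prob_space_axioms arcs_sets])

text \<open>
  The points of \<open>B\<close> whose label is almost the supremum of the labels of their class. In almost every
  orbit, each class in \<open>B\<close> contains such a point. Almost no point belongs to \<open>near_sup B j\<close> for all
  \<open>j\<close>, as the point to which \<open>nxt\<close> leads lies in the same class and has a larger label.
\<close>

definition near_sup :: "(nat \<Rightarrow> real) set \<Rightarrow> nat \<Rightarrow> (nat \<Rightarrow> real) set" where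
  "near_sup B j = {x \<in> B. \<forall>g\<in>carrier G. (\<one>, g) \<in> F x \<longrightarrow> x (idx g) < label x + 1 / real (Suc j)}"

definition joins :: "(nat \<Rightarrow> real) set \<Rightarrow> nat \<Rightarrow> 'g \<Rightarrow> (nat \<Rightarrow> real) set" where
  "joins B j g = {x \<in> near_sup B j. g \<in> R.reps x \<and> shift g x \<in> B}"

definition repaired :: "(nat \<Rightarrow> real) set \<Rightarrow> nat \<Rightarrow> 'g \<Rightarrow> (nat \<Rightarrow> real) set" where
  "repaired B j = repaired_arcs Q W B (joins B j)"

lemma near_sup_sets:
  assumes B: "B \<in> sets iid"
  shows "near_sup B j \<in> sets iid"
proof -
  have "{x \<in> space iid. \<forall>g\<in>carrier G. (\<one>, g) \<in> F x \<longrightarrow> x (idx g) < label x + 1 / real (Suc j)} \<in> sets iid"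
  proof (intro sets.sets_Collect_countable_All' countable_carrier sets.sets_Collect_imp)
    fix g assume "g \<in> carrier G"
    then show "{x \<in> space iid. (\<one>, g) \<in> F x} \<in> sets iid" by (intro R.F_measurable) auto
    show "{x \<in> space iid. x (idx g) < label x + 1 / real (Suc j)} \<in> sets iid" by measurable
  qed
  then have "B \<inter> {x \<in> space iid. \<forall>g\<in>carrier G. (\<one>, g) \<in> F x \<longrightarrow> x (idx g) < label x + 1 / real (Suc j)} \<in> sets iid"
    by (rule sets.Int[OF B])
  then show ?thesis by (simp add: near_sup_def Int_def)
qed

lemma joins_sets:
  assumes B: "B \<in> sets iid" and g: "g \<in> carrier G"
  shows "joins B j g \<in> sets iid"
proof -
  have "near_sup B j \<inter> ({x \<in> space iid. g \<in> R.reps x} \<inter> {x. shift g x \<in> B}) \<in> sets iid"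
    by (intro sets.Int near_sup_sets R.reps_measurable shift_vimage_sets B g)
  also have "near_sup B j \<inter> ({x \<in> space iid. g \<in> R.reps x} \<inter> {x. shift g x \<in> B}) = joins B j g"
    by (auto simp: joins_def)
  finally show ?thesis .
qed

text \<open>
  Any point is connected to a point of \<open>B\<close>, and from there, within its class, to a point of
  \<open>near_sup B j\<close>. The arcs \<open>joins\<close> connect the latter to one point in each class of \<open>B\<close>.
\<close>

lemma AE_repaired_connected:
  assumes class_inv: "\<And>x g h. (g, h) \<in> F x \<Longrightarrow> shift g x \<in> B \<longleftrightarrow> shift h x \<in> B"
    and hits: "AE x in iid. \<exists>g\<in>carrier G. shift g x \<in> B"
  shows "AE x in iid. \<forall>g\<in>carrier G. (\<one>, g) \<in> act.arc_conn (repaired B j) x"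
proof -
  have "AE x in iid. x i \<le> 1" for i
  proof -
    have "{x \<in> space iid. x i \<le> 1} \<in> sets iid" by measurable
    then show ?thesis
      using labels.prob_eq_1[of "{x. x i \<le> 1}"] measure_label_le[of 1 i] by simp
  qed
  then have "AE x in iid. \<forall>i. x i \<le> 1" by (simp add: AE_all_countable)
  with hits show ?thesis
  proof eventually_elim
    case (elim x)
    let ?C = "act.arc_conn (repaired B j) x"
    have C_sym: "(v, u) \<in> ?C" if "(u, v) \<in> ?C" for u v
      using act.equiv_arc_conn[of "repaired B j" x] that by (meson equivE symD)
    have C_trans: "(u, w) \<in> ?C" if "(u, v) \<in> ?C" "(v, w) \<in> ?C" for u v w
      using act.equiv_arc_conn[of "repaired B j" x] that by (meson equivE transD)
    have B_class: "shift g x \<in> B \<longleftrightarrow> shift h x \<in> B" if "(g, h) \<in> F x" for g h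
      using class_inv[OF that] by simp
    have within: "(u, v) \<in> ?C" if "(u, v) \<in> F x" "shift u x \<in> B" for u v
      unfolding repaired_def
      by (rule repaired_arcs_connect_within[OF _ _ that(2)]) (use B_class that(1) in \<open>simp_all add: F_def\<close>)
    have arc: "(u, g \<otimes> u) \<in> ?C" if "u \<in> carrier G" "g \<in> carrier G" "shift u x \<in> repaired B j g" for u g
      using that by (intro act.arc_connI) (simp add: act.arc_rel_def m_assoc)
    have to_B: "\<exists>v\<in>carrier G. (u, v) \<in> ?C \<and> shift v x \<in> B" if u: "u \<in> carrier G" for u
    proof (cases "shift u x \<in> B")
      case True
      then show ?thesis using u within[OF R.F_refl] by (intro bexI[of _ u]) auto
    next
      case False
      obtain h where h: "h \<in> carrier G" "shift h x \<in> B" using elim(1) by blast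
      define g where "g = first (\<lambda>h. shift h (shift u x) \<in> B)"
      have hB: "shift (h \<otimes> inv u) (shift u x) \<in> B" using h u by (simp add: shift_mult m_assoc)
      have gB: "shift g (shift u x) \<in> B"
        unfolding g_def
        by (rule first_satisfies[where P = "\<lambda>h. shift h (shift u x) \<in> B" and g = "h \<otimes> inv u"])
          (use h u hB in simp_all)
      have gc: "g \<in> carrier G" by (simp add: g_def)
      have "shift u x \<in> repaired B j g" using False by (simp add: repaired_def repaired_arcs_def g_def)
      from arc[OF u gc this] show ?thesis
        using gB gc u by (intro bexI[of _ "g \<otimes> u"]) (auto simp: shift_mult)
    qed
    have to_S: "\<exists>w\<in>carrier G. (u, w) \<in> F x \<and> shift w x \<in> near_sup B j" if u: "u \<in> carrier G" "shift u x \<in> B" for u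
    proof -
      define L where "L = {x (idx v) | v. (u, v) \<in> F x}"
      have L: "L \<noteq> {}" "bdd_above L"
        using R.F_refl[OF _ u(1), of x] elim(2) by (auto simp: L_def intro: bdd_aboveI[of _ 1])
      have "Sup L - 1 / real (Suc j) < Sup L" by simp
      from less_cSupD[OF L(1) this] obtain z where z: "z \<in> L" "Sup L - 1 / real (Suc j) < z" by blast
      then obtain w where w: "(u, w) \<in> F x" "z = x (idx w)" by (auto simp: L_def)
      have w_sup: "Sup L - 1 / real (Suc j) < x (idx w)" using z(2) w(2) by simp
      have wc: "w \<in> carrier G" using R.F_carrier[OF _ w(1)] by simp
      have "x (idx (g \<otimes> w)) < x (idx w) + 1 / real (Suc j)" if g: "g \<in> carrier G" "(\<one>, g) \<in> F (shift w x)" for g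
      proof -
        have "(w, g \<otimes> w) \<in> F x" using R.F_equivariant[OF wc one_closed g(1), of x] g(2) wc by simp
        then have "(u, g \<otimes> w) \<in> F x" using R.F_trans[OF _ w(1)] by simp
        then have "x (idx (g \<otimes> w)) \<le> Sup L" using L(2) by (intro cSup_upper) (auto simp: L_def)
        then show ?thesis using w_sup by simp
      qed
      moreover have "shift w x (idx g) = x (idx (g \<otimes> w))" if "g \<in> carrier G" for g
        using that by (simp add: shift_def)
      moreover have "shift w x \<in> B" using B_class[OF w(1)] u(2) by simp
      ultimately have "shift w x \<in> near_sup B j"
        using label_shift[OF wc, of x] by (simp add: near_sup_def)
      then show ?thesis using w(1) wc by blast
    qed
    have B_conn: "(u, v) \<in> ?C" if u: "u \<in> carrier G" "shift u x \<in> B" and v: "v \<in> carrier G" "shift v x \<in> B" for u v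
    proof -
      obtain w where w: "w \<in> carrier G" "(u, w) \<in> F x" "shift w x \<in> near_sup B j" using to_S[OF u] by blast
      \<comment> \<open>the element that \<open>joins\<close> uses for the class of \<open>v\<close>, seen from the point \<open>w x\<close>\<close>
      define r where "r = R.rep (shift w x) (v \<otimes> inv w)"
      have r: "r \<in> R.reps (shift w x)" "(v \<otimes> inv w, r) \<in> F (shift w x)"
        using R.rep[of "shift w x" "v \<otimes> inv w"] v w by (auto simp: r_def)
      then have rc: "r \<in> carrier G" by (auto dest: R.reps_carrier)
      have vr: "(v, r \<otimes> w) \<in> F x"
        using R.F_equivariant[of w "v \<otimes> inv w" r x] r(2) rc v w by (simp add: m_assoc)
      then have "shift r (shift w x) \<in> B" using B_class v(2) rc w(1) by (simp add: shift_mult)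
      then have "shift w x \<in> repaired B j r" using r(1) w(3) by (simp add: repaired_def repaired_arcs_def joins_def)
      from arc[OF w(1) rc this] have "(w, r \<otimes> w) \<in> ?C" .
      moreover have "(u, w) \<in> ?C" by (rule within[OF w(2) u(2)])
      moreover have "(r \<otimes> w, v) \<in> ?C" by (rule C_sym[OF within[OF vr v(2)]])
      ultimately show ?thesis using C_trans by blast
    qed
    show ?case
    proof
      fix g assume g: "g \<in> carrier G"
      obtain u where u: "u \<in> carrier G" "(\<one>, u) \<in> ?C" "shift u x \<in> B" using to_B[OF one_closed] by blast
      obtain v where v: "v \<in> carrier G" "(g, v) \<in> ?C" "shift v x \<in> B" using to_B[OF g] by blast
      have "(u, v) \<in> ?C" by (rule B_conn[OF u(1,3) v(1,3)])
      then show "(\<one>, g) \<in> ?C" using C_trans[OF u(2)] C_trans[OF _ C_sym[OF v(2)]] by blast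
    qed
  qed
qed

text \<open>
  The number of arcs in \<open>joins\<close> that start at \<open>x\<close> is the number of classes in \<open>B\<close>, which is
  integrable, if \<open>x\<close> lies in \<open>near_sup B j\<close>, and zero otherwise. These sets decrease to a null set.
\<close>

lemma joins_cost_tendsto_0:
  assumes B: "B \<in> sets iid"
    and class_inv: "\<And>x g h. (g, h) \<in> F x \<Longrightarrow> shift g x \<in> B \<longleftrightarrow> shift h x \<in> B"
    and fin: "(\<integral>\<^sup>+x. emeasure (count_space UNIV) {g \<in> R.reps x. shift g x \<in> B} \<partial>iid) < \<infinity>"
  shows "(\<lambda>j. \<integral>\<^sup>+g. emeasure iid (joins B j g) \<partial>count_space (carrier G)) \<longlonglongrightarrow> 0"
proof -
  define cnt where "cnt = (\<lambda>x. emeasure (count_space UNIV) {g \<in> R.reps x. shift g x \<in> B})"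
  have cnt_eq: "cnt x = (\<integral>\<^sup>+g. indicator {x. g \<in> R.reps x \<and> shift g x \<in> B} x \<partial>count_space (carrier G))" for x
  proof -
    have "{g \<in> R.reps x. shift g x \<in> B} = {g \<in> carrier G. x \<in> {x. g \<in> R.reps x \<and> shift g x \<in> B}}"
      by (auto dest: R.reps_carrier)
    then show ?thesis unfolding cnt_def by (simp only: act.emeasure_count_space_Collect)
  qed
  have cnt_meas: "cnt \<in> borel_measurable iid"
  proof -
    have "{(x, g). x \<in> space iid \<and> g \<in> carrier G \<and> shift g x \<in> B} \<in> R.class_sets"
      by (rule R.class_setsI) (use shift_vimage_sets[OF B] class_inv in auto)
    from R.count_classes_measurable[OF this] show ?thesis
      unfolding cnt_def
      by (rule measurable_cong[THEN iffD1, rotated])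
        (auto intro!: arg_cong2[where f = emeasure] dest: R.reps_carrier)
  qed
  have sum: "(\<integral>\<^sup>+g. emeasure iid (joins B j g) \<partial>count_space (carrier G))
      = (\<integral>\<^sup>+x. indicator (near_sup B j) x * cnt x \<partial>iid)" for j
  proof -
    have "(\<integral>\<^sup>+x. indicator (near_sup B j) x * cnt x \<partial>iid)
        = (\<integral>\<^sup>+x. \<integral>\<^sup>+g. indicator (joins B j g) x \<partial>count_space (carrier G) \<partial>iid)"
    proof (rule nn_integral_cong)
      fix x
      have "indicator (near_sup B j) x * cnt x
          = (\<integral>\<^sup>+g. indicator (near_sup B j) x * indicator {x. g \<in> R.reps x \<and> shift g x \<in> B} x \<partial>count_space (carrier G))"
        unfolding cnt_eq by (rule nn_integral_cmult[symmetric]) simp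
      also have "\<dots> = (\<integral>\<^sup>+g. indicator (joins B j g) x \<partial>count_space (carrier G))"
        by (intro nn_integral_cong) (auto simp: joins_def indicator_def)
      finally show "indicator (near_sup B j) x * cnt x = (\<integral>\<^sup>+g. indicator (joins B j g) x \<partial>count_space (carrier G))" .
    qed
    also have "\<dots> = (\<integral>\<^sup>+g. \<integral>\<^sup>+x. indicator (joins B j g) x \<partial>iid \<partial>count_space (carrier G))"
      by (rule nn_integral_count_space_nn_integral[OF countable_carrier])
        (use joins_sets[OF B] in \<open>auto intro: borel_measurable_indicator\<close>)
    also have "\<dots> = (\<integral>\<^sup>+g. emeasure iid (joins B j g) \<partial>count_space (carrier G))"
      by (intro nn_integral_cong) (use joins_sets[OF B] in auto)
    finally show ?thesis ..
  qed
  have "(\<lambda>j. \<integral>\<^sup>+x. indicator (near_sup B j) x * cnt x \<partial>iid) \<longlonglongrightarrow> (\<integral>\<^sup>+x. 0 \<partial>iid)"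
  proof (rule nn_integral_dominated_convergence[where w = cnt])
    show "AE x in iid. (\<lambda>j. indicator (near_sup B j) x * cnt x) \<longlonglongrightarrow> 0"
      using AE_no_max_label
    proof eventually_elim
      case (elim x)
      have "label x < label (shift (nxt Q x) x)"
        by (rule nxt_increases[OF Q_carrier finite_Q]) (use elim in blast)
      then have inc: "0 < x (idx (nxt Q x)) - label x" using label_shift[of "nxt Q x" x] by simp
      obtain j0 where j0: "1 / real (Suc j0) < x (idx (nxt Q x)) - label x"
        using nat_approx_posE[OF inc] by blast
      have "x \<notin> near_sup B j" if "j \<ge> j0" for j
      proof
        assume "x \<in> near_sup B j"
        then have "x (idx (nxt Q x)) < label x + 1 / real (Suc j)"
          using arcs_connect_nxt[of Q x W] by (simp add: near_sup_def F_def)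
        also have "1 / real (Suc j) \<le> 1 / real (Suc j0)" using that by (intro divide_left_mono) auto
        finally show False using j0 by simp
      qed
      then have "eventually (\<lambda>j. indicator (near_sup B j) x * cnt x = 0) sequentially"
        by (intro eventually_sequentiallyI[of j0]) simp
      then show ?case by (rule tendsto_eventually)
    qed
    show "cnt \<in> borel_measurable iid" by (rule cnt_meas)
    show "(\<lambda>x. indicator (near_sup B j) x * cnt x) \<in> borel_measurable iid" for j
      by (intro borel_measurable_times_ennreal borel_measurable_indicator near_sup_sets B cnt_meas)
    show "(\<integral>\<^sup>+x. cnt x \<partial>iid) < \<infinity>" using fin by (simp add: cnt_def)
    show "AE x in iid. indicator (near_sup B j) x * cnt x \<le> cnt x" for j
      by (intro AE_I2) (simp add: indicator_def)
  qed simp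
  then show ?thesis by (simp add: sum)
qed

text \<open>
  Inside \<open>B\<close> each point has its arc given by \<open>nxt\<close>, outside \<open>B\<close> its arc leading to \<open>B\<close>; together they contribute
  \<open>1\<close>. The only other arcs are those given by \<open>W\<close> and those that join the classes, and the
  contribution of the latter tends to \<open>0\<close>.
\<close>

theorem group_cost_le_of_finite_index:
  assumes B: "B \<in> sets iid"
    and class_inv: "\<And>x g h. (g, h) \<in> F x \<Longrightarrow> shift g x \<in> B \<longleftrightarrow> shift h x \<in> B"
    and pos: "0 < (\<integral>\<^sup>+x. emeasure (count_space UNIV) {g \<in> R.reps x. shift g x \<in> B} \<partial>iid)"
    and fin: "(\<integral>\<^sup>+x. emeasure (count_space UNIV) {g \<in> R.reps x. shift g x \<in> B} \<partial>iid) < \<infinity>"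
  shows "group_cost G \<le> 1 + (\<Sum>g\<in>Q - {\<one>}. emeasure iid (W g))"
proof -
  have "0 < measure iid B"
  proof (rule ccontr)
    assume "\<not> 0 < measure iid B"
    then have "measure iid B = 0" using measure_nonneg[of iid B] by linarith
    then have "B \<in> null_sets iid"
      using B by (simp add: null_sets_def labels.emeasure_eq_measure)
    then have null: "AE x in iid. x \<notin> B" by (rule AE_not_in)
    have "AE x in iid. \<forall>g\<in>carrier G. shift g x \<notin> B"
      using act.AE_action[OF _ null] by (simp add: AE_ball_countable countable_carrier)
    then have "AE x in iid. emeasure (count_space UNIV) {g \<in> R.reps x. shift g x \<in> B} = 0"
    proof eventually_elim
      case (elim x)
      then have "{g \<in> R.reps x. shift g x \<in> B} = {}" using R.reps_carrier by blast
      then show ?case by (simp only: emeasure_empty)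
    qed
    then have "(\<integral>\<^sup>+x. emeasure (count_space UNIV) {g \<in> R.reps x. shift g x \<in> B} \<partial>iid) = (\<integral>\<^sup>+x. 0 \<partial>iid)"
      by (rule nn_integral_cong_AE)
    then show False using pos by simp
  qed
  then have hits: "AE x in iid. \<exists>g\<in>carrier G. shift g x \<in> B" by (rule ergodic_hits[OF B])
  define k where "k = (\<lambda>x. if x \<in> B then nxt Q x else first (\<lambda>h. shift h x \<in> B))"
  have k_sets: "{x \<in> space iid. k x = g} \<in> sets iid" if g: "g \<in> carrier G" for g
  proof -
    have 1: "{x \<in> space iid. first (\<lambda>h. shift h x \<in> B) = g} \<in> sets iid"
      by (rule first_measurable[OF _ g]) (use shift_vimage_sets[OF B] in simp)
    have "(B \<inter> {x. nxt Q x = g}) \<union> ({x \<in> space iid. first (\<lambda>h. shift h x \<in> B) = g} - B) \<in> sets iid"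
      by (intro sets.Un sets.Int sets.Diff B 1 nxt_measurable Q_carrier finite_Q g)
    also have "(B \<inter> {x. nxt Q x = g}) \<union> ({x \<in> space iid. first (\<lambda>h. shift h x \<in> B) = g} - B)
        = {x \<in> space iid. k x = g}"
      by (auto simp: k_def)
    finally show ?thesis .
  qed
  define W' where "W' = (\<lambda>g. if g \<in> Q - {\<one>} then W g \<inter> B else {})"
  have W'_sets: "W' g \<in> sets iid" for g using W_sets B by (simp add: W'_def)
  have repaired_eq: "repaired B j g = {x \<in> space iid. k x = g} \<union> W' g \<union> joins B j g" for j g
    by (simp add: repaired_def repaired_arcs_def k_def W'_def)
  have le: "group_cost G \<le> 1 + (\<Sum>g\<in>Q - {\<one>}. emeasure iid (W g))
      + (\<integral>\<^sup>+g. emeasure iid (joins B j g) \<partial>count_space (carrier G))" for j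
  proof -
    have "group_cost G \<le> cost iid (orbit_rel G iid shift)"
      by (rule group_cost_le_cost)
        (simp_all add: standard_prob_space_def labels.prob_space_axioms standard_borel_iid
          pmp_action_shift free_action_shift)
    also have "\<dots> \<le> (\<integral>\<^sup>+g. emeasure iid (repaired B j g) \<partial>count_space (carrier G))"
    proof (rule act.cost_le_arcs[OF standard_borel_diagonal[OF standard_borel_iid]])
      show "repaired B j g \<in> sets iid" if "g \<in> carrier G" for g
        unfolding repaired_eq by (intro sets.Un k_sets W'_sets joins_sets B that)
      show "AE x in iid. \<forall>g\<in>carrier G. (\<one>, g) \<in> act.arc_conn (repaired B j) x"
        by (rule AE_repaired_connected[OF class_inv hits])
    qed
    also have "\<dots> \<le> (\<integral>\<^sup>+g. emeasure iid {x \<in> space iid. k x = g} + emeasure iid (W' g)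
        + emeasure iid (joins B j g) \<partial>count_space (carrier G))"
    proof (rule nn_integral_mono)
      fix g assume "g \<in> space (count_space (carrier G))"
      then have g: "g \<in> carrier G" by simp
      have "emeasure iid (repaired B j g)
          \<le> emeasure iid ({x \<in> space iid. k x = g} \<union> W' g) + emeasure iid (joins B j g)"
        unfolding repaired_eq by (intro emeasure_subadditive sets.Un k_sets W'_sets joins_sets B g)
      also have "\<dots> \<le> emeasure iid {x \<in> space iid. k x = g} + emeasure iid (W' g)
          + emeasure iid (joins B j g)"
        by (intro add_right_mono emeasure_subadditive k_sets W'_sets g)
      finally show "emeasure iid (repaired B j g) \<le> emeasure iid {x \<in> space iid. k x = g}
          + emeasure iid (W' g) + emeasure iid (joins B j g)" .
    qed
    also have "\<dots> = (\<integral>\<^sup>+g. emeasure iid {x \<in> space iid. k x = g} \<partial>count_space (carrier G))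
        + (\<integral>\<^sup>+g. emeasure iid (W' g) \<partial>count_space (carrier G))
        + (\<integral>\<^sup>+g. emeasure iid (joins B j g) \<partial>count_space (carrier G))"
      by (simp add: nn_integral_add)
    also have "(\<integral>\<^sup>+g. emeasure iid {x \<in> space iid. k x = g} \<partial>count_space (carrier G))
        = emeasure iid (space iid)"
      by (rule sum_level_sets[OF _ k_sets]) (simp_all add: k_def)
    also have "\<dots> = 1" by (rule labels.emeasure_space_1)
    also have "(\<integral>\<^sup>+g. emeasure iid (W' g) \<partial>count_space (carrier G)) = (\<Sum>g\<in>Q - {\<one>}. emeasure iid (W' g))"
      by (rule nn_integral_count_space') (use Q_carrier finite_Q in \<open>auto simp: W'_def\<close>)
    also have "\<dots> \<le> (\<Sum>g\<in>Q - {\<one>}. emeasure iid (W g))"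
      using W_sets by (intro sum_mono emeasure_mono) (auto simp: W'_def)
    finally show ?thesis by (simp add: add_mono)
  qed
  have "(\<lambda>j. 1 + (\<Sum>g\<in>Q - {\<one>}. emeasure iid (W g))
      + (\<integral>\<^sup>+g. emeasure iid (joins B j g) \<partial>count_space (carrier G)))
      \<longlonglongrightarrow> 1 + (\<Sum>g\<in>Q - {\<one>}. emeasure iid (W g)) + 0"
    by (intro tendsto_add tendsto_const joins_cost_tendsto_0 B class_inv fin)
  then show ?thesis
    using le by (intro tendsto_lowerbound[of _ _ sequentially]) auto
qed

end

context countable_infinite_group
begin

text \<open>
  The sets \<open>W g\<close> are chosen so that \<open>F\<close> exceeds the threshold \<open>p\<close> of property (T) by as little as
  possible. Their measure is at most \<open>p - m + \<delta>\<close>, as the arcs of \<open>nxt\<close> already contribute \<open>m\<close>; the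
  bound is nonnegative by \<open>kazhdan_constant_bound\<close>.
\<close>

theorem group_cost_le_of_kazhdan_pair:
  assumes kp: "kazhdan_pair G Q \<epsilon>"
  shows "group_cost G \<le> ennreal (1 + card Q * (1 - \<epsilon>\<^sup>2 / 2 - 2 / (2 * real (card Q) + 1)))"
proof -
  have Q: "Q \<subseteq> carrier G" "finite Q" "0 < \<epsilon>" using kp by (auto simp: kazhdan_pair_def)
  define p where "p = 1 - \<epsilon>\<^sup>2 / 2"
  define m where "m = 2 / (2 * real (card Q) + 1)"
  have p1: "p < 1" using Q(3) by (simp add: p_def)
  have mp: "m \<le> p" using kazhdan_constant_bound[OF kp] by (simp add: p_def m_def)
  have main: "group_cost G \<le> ennreal (1 + card Q * (p - m + \<delta>))" if \<delta>: "0 < \<delta>" for \<delta>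
  proof -
    have "\<exists>W. W \<in> sets iid \<and> p < measure iid (edge_event Q g \<union> W) \<and>
        measure iid W \<le> max 0 (p + \<delta> - measure iid (edge_event Q g))" for g
      by (rule complementary_set_of_measure[OF edge_event_measurable p1 \<delta>, of Q g]) blast
    then have "\<exists>W. \<forall>g. W g \<in> sets iid \<and> p < measure iid (edge_event Q g \<union> W g) \<and>
        measure iid (W g) \<le> max 0 (p + \<delta> - measure iid (edge_event Q g))"
      by (intro choice allI)
    then obtain W where "\<forall>g. W g \<in> sets iid \<and> p < measure iid (edge_event Q g \<union> W g) \<and>
        measure iid (W g) \<le> max 0 (p + \<delta> - measure iid (edge_event Q g))" ..
    then have W: "\<And>g. W g \<in> sets iid"
      "\<And>g. p < measure iid (edge_event Q g \<union> W g)"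
      "\<And>g. measure iid (W g) \<le> max 0 (p + \<delta> - measure iid (edge_event Q g))"
      by simp_all
    have W_small: "measure iid (W g) \<le> p - m + \<delta>" if "g \<in> Q - {\<one>}" for g
      using W(3)[of g] measure_edge_event[OF Q(1,2), of g] that mp \<delta> by (simp add: m_def)
    interpret label_percolation G Q W
      by unfold_locales (rule Q(1) Q(2) W(1))+
    have almost: "1 - \<epsilon>\<^sup>2 / 2 < measure iid {x \<in> space iid. (\<one>, g) \<in> F x}" if g: "g \<in> Q" for g
    proof (cases "g = \<one>")
      case True
      then have "{x \<in> space iid. (\<one>, g) \<in> F x} = space iid"
        using R.F_refl by auto
      then show ?thesis using p1 labels.prob_space by (simp add: p_def)
    next
      case False
      have "edge_event Q g \<union> W g \<subseteq> {x \<in> space iid. (\<one>, g) \<in> F x}"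
        using arcs_connect_generator[OF Q(1,2) g] by (auto simp: F_def)
      then have "measure iid (edge_event Q g \<union> W g) \<le> measure iid {x \<in> space iid. (\<one>, g) \<in> F x}"
        using g Q by (intro labels.finite_measure_mono R.F_measurable) auto
      then show ?thesis using W(2)[of g] by (simp add: p_def)
    qed
    have "group_cost G \<le> 1 + (\<Sum>g\<in>Q - {\<one>}. emeasure iid (W g))"
      by (rule R.kazhdan_finite_index[OF kp almost], assumption)
        (rule group_cost_le_of_finite_index, simp_all)
    also have "(\<Sum>g\<in>Q - {\<one>}. emeasure iid (W g)) \<le> (\<Sum>g\<in>Q - {\<one>}. ennreal (p - m + \<delta>))"
      unfolding labels.emeasure_eq_measure by (intro sum_mono ennreal_leI W_small)
    also have "\<dots> \<le> (\<Sum>g\<in>Q. ennreal (p - m + \<delta>))"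
      by (intro sum_mono2 Q) auto
    also have "\<dots> = ennreal (card Q * (p - m + \<delta>))"
      using mp \<delta> by (simp add: ennreal_of_nat_eq_real_of_nat ennreal_mult)
    also have "1 + ennreal (card Q * (p - m + \<delta>)) = ennreal (1 + card Q * (p - m + \<delta>))"
      using mp \<delta> by (simp add: ennreal_plus)
    finally show ?thesis by (simp add: add_mono)
  qed
  have "group_cost G \<le> ennreal (1 + card Q * (p - m))"
  proof (rule tendsto_lowerbound)
    have "((\<lambda>\<delta>. 1 + card Q * (p - m + \<delta>)) \<longlongrightarrow> 1 + card Q * (p - m + 0)) (at_right 0)"
      by (intro tendsto_intros)
    then show "((\<lambda>\<delta>. ennreal (1 + card Q * (p - m + \<delta>))) \<longlongrightarrow> ennreal (1 + card Q * (p - m))) (at_right 0)"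
      by (intro tendsto_ennrealI) simp
    show "eventually (\<lambda>\<delta>. group_cost G \<le> ennreal (1 + card Q * (p - m + \<delta>))) (at_right 0)"
      using main by (auto simp: eventually_at_right_field intro: exI[of _ 1])
  qed simp
  then show ?thesis by (simp add: p_def m_def)
qed

end

section \<open>The bound for the cost of a Kazhdan group\<close>

theorem theorem8:
  fixes G :: "('g, 'm) monoid_scheme" and Q :: "'g set" and \<epsilon> :: real and n :: nat
  assumes "group G" and "infinite (carrier G)" and "property_T G"
    and "kazhdan_pair G Q \<epsilon>" and "card Q = n"
  shows "enn2ereal (group_cost G)
    \<le> ereal (real n * (1 - \<epsilon>\<^sup>2 / 2) + (real n - 1) / (2 * real n - 1))"
proof -
  interpret group G by fact
  have Q: "Q \<subseteq> carrier G" "finite Q" "generate G Q = carrier G"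
    using assms(4) by (auto simp: kazhdan_pair_def)
  have "countable (carrier G)" using countable_generate[of Q] Q by (simp add: countable_finite)
  interpret countable_infinite_group G by unfold_locales (fact \<open>countable (carrier G)\<close> assms(2))+
  define p where "p = 1 - \<epsilon>\<^sup>2 / 2"
  have n: "2 \<le> real n" using kazhdan_card_ge_2[OF assms(4)] assms(5) by simp
  have p: "2 / (2 * real n + 1) \<le> p" using kazhdan_constant_bound[OF assms(4)] assms(5) by (simp add: p_def)
  have "group_cost G \<le> ennreal (1 + real n * (p - 2 / (2 * real n + 1)))"
    using group_cost_le_of_kazhdan_pair[OF assms(4)] assms(5) by (simp add: p_def)
  then have "enn2ereal (group_cost G) \<le> enn2ereal (ennreal (1 + real n * (p - 2 / (2 * real n + 1))))"
    by (simp add: less_eq_ennreal.rep_eq)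
  also have "\<dots> = ereal (1 + real n * (p - 2 / (2 * real n + 1)))"
    using p by (intro enn2ereal_ennreal) simp
  also have "\<dots> \<le> ereal (real n * p + (real n - 1) / (2 * real n - 1))"
  proof -
    have "1 - 2 * real n / (2 * real n + 1) \<le> (real n - 1) / (2 * real n - 1)"
    proof -
      have "1 - 2 * real n / (2 * real n + 1) = 1 / (2 * real n + 1)" using n by (simp add: field_simps)
      also have "\<dots> \<le> (real n - 1) / (2 * real n - 1)"
      proof -
        have "0 \<le> real n * (2 * real n - 3)" using n by simp
        then show ?thesis using n by (simp add: divide_simps algebra_simps)
      qed
      finally show ?thesis .
    qed
    then show ?thesis by (simp add: algebra_simps)
  qed
  finally show ?thesis by (simp add: p_def)
qed

end
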